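(* For all integers $d,n\geq 2$, the lattice $\mathcal{NC}_{G(d,d,n)}$ of $G(d,d,n)$-noncrossing partitions admits a symmetric Boolean decomposition. Consequently, it admits a symmetric chain decomposition, it is strongly Sperner, and the sequence of its rank numbers is symmetric, unimodal, and $\gamma$-nonnegative.
   Context: $G(d,d,n)$ is the complex reflection group of $n\times n$ monomial matrices whose nonzero entries are $d$-th roots of unity and whose product of nonzero entries is $1$. For a well-generated complex reflection group $W$ with set of reflections $T$, the absolute length $\ell_T(w)$ is the minimal number of reflections whose product is $w$, and the absolute order is $u\leq_T v$ iff $\ell_T(v)=\ell_T(u)+\ell_T(u^{-1}v)$. For a Coxeter element $\gamma$ of $W$ (a $\zeta$-regular element of order $h$, $h$ the largest degree of $W$), $\mathcal{NC}_W$ is the interval $[\varepsilon,\gamma]$ in $(W,\leq_T)$; it is a graded lattice (rank function $\ell_T$) whose isomorphism type does not depend on the choice of $\gamma$. A decomposition of a poset $P$ is a partition of $P$ into parts $D$ such that each $(D,\leq)$ is connected (not a disjoint union of two or more nonempty subposets) and every cover relation of $(D,\leq)$ is a cover relation of $P$. A decomposition of a graded poset of rank $N$ is symmetric if for each part there is a bijection from its minimal to its maximal elements such that corresponding $p,q$ satisfy $\mathrm{rk}(p)+\mathrm{rk}(q)=N$. A symmetric chain (resp. Boolean) decomposition is a symmetric decomposition whose parts are chains (resp. Boolean lattices). A $k$-family is a subset containing no chain with $k+1$ elements; the poset is $k$-Sperner if the maximum size of a $k$-family equals the sum of the $k$ largest rank numbers, and strongly Sperner if it is $k$-Sperner for all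 $k\in[N]$. If the rank-generating polynomial $\sum_k r_k t^k$ is symmetric it can be written $\sum_{j=0}^{\lfloor N/2\rfloor}\gamma_j t^j(1+t)^{N-2j}$; it is $\gamma$-nonnegative if all $\gamma_j\geq 0$. *)

theory Defs
  imports Complex_Main "Jordan_Normal_Form.Matrix" "HOL-Computational_Algebra.Polynomial"
begin

definition Gddn :: "nat \<Rightarrow> nat \<Rightarrow> complex mat set" where
  "Gddn d n = {A \<in> carrier_mat n n.
      (\<forall>i<n. \<exists>!j. j < n \<and> A $$ (i,j) \<noteq> 0) \<and>
      (\<forall>j<n. \<exists>!i. i < n \<and> A $$ (i,j) \<noteq> 0) \<and>
      (\<forall>i<n. \<forall>j<n. A $$ (i,j) \<noteq> 0 \<longrightarrow> (A $$ (i,j)) ^ d = 1) \<and>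
      (\<Prod>p\<in>{(i,j). i < n \<and> j < n \<and> A $$ (i,j) \<noteq> 0}. A $$ p) = 1}"

text \<open>Reflections of a matrix group W acting on C^n: non-identity elements fixing a
  hyperplane pointwise, i.e. t - 1 has rank one (t - 1 = u w^T).\<close>
definition reflections :: "nat \<Rightarrow> complex mat set \<Rightarrow> complex mat set" where
  "reflections n W = {t \<in> W. t \<noteq> 1\<^sub>m n \<and>
      (\<exists>u w. u \<in> carrier_vec n \<and> w \<in> carrier_vec n \<and>
             t - 1\<^sub>m n = mat n n (\<lambda>(i,j). u $ i * w $ j))}"

definition mat_list_prod :: "nat \<Rightarrow> complex mat list \<Rightarrow> complex mat" where
  "mat_list_prod n ts = foldr (*) ts (1\<^sub>m n)"

definition abs_len :: "nat \<Rightarrow> complex mat set \<Rightarrow> complex mat \<Rightarrow> nat" where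
  "abs_len n W w = (LEAST k. \<exists>ts. length ts = k \<and> set ts \<subseteq> reflections n W \<and>
                                  w = mat_list_prod n ts)"

text \<open>Absolute order: u \<le>_T v iff l_T(v) = l_T(u) + l_T(u^{-1} v); here x = u^{-1} v is the
  unique element of the group W with v = u x.\<close>
definition abs_le :: "nat \<Rightarrow> complex mat set \<Rightarrow> complex mat \<Rightarrow> complex mat \<Rightarrow> bool" where
  "abs_le n W u v \<longleftrightarrow> u \<in> W \<and> v \<in> W \<and>
     (\<exists>x\<in>W. v = u * x \<and> abs_len n W v = abs_len n W u + abs_len n W x)"

text \<open>Coxeter number of G(d,d,n), d,n \<ge> 2: its largest degree, namely (n-1) d
  (degrees are d, 2d, ..., (n-1)d, n).\<close>
definition cox_num_Gddn :: "nat \<Rightarrow> nat \<Rightarrow> nat" where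
  "cox_num_Gddn d n = (n - 1) * d"

text \<open>gamma is zeta-regular of order h, zeta = exp(2 pi i / h): it has an eigenvector with
  eigenvalue zeta lying on no reflecting hyperplane, and gamma has order h.\<close>
definition coxeter_element :: "nat \<Rightarrow> complex mat set \<Rightarrow> nat \<Rightarrow> complex mat \<Rightarrow> bool" where
  "coxeter_element n W h g \<longleftrightarrow> g \<in> W \<and> 0 < h \<and>
     g ^\<^sub>m h = 1\<^sub>m n \<and> (\<forall>k. 0 < k \<and> k < h \<longrightarrow> g ^\<^sub>m k \<noteq> 1\<^sub>m n) \<and>
     (\<exists>v \<in> carrier_vec n.
        g *\<^sub>v v = exp (2 * pi * \<i> / of_nat h) \<cdot>\<^sub>v v \<and>
        (\<forall>t\<in>reflections n W. t *\<^sub>v v \<noteq> v))"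

definition NC :: "nat \<Rightarrow> complex mat set \<Rightarrow> complex mat \<Rightarrow> complex mat set" where
  "NC n W g = {w \<in> W. abs_le n W (1\<^sub>m n) w \<and> abs_le n W w g}"

definition lt_on :: "('a \<Rightarrow> 'a \<Rightarrow> bool) \<Rightarrow> 'a \<Rightarrow> 'a \<Rightarrow> bool" where
  "lt_on leq x y \<longleftrightarrow> leq x y \<and> x \<noteq> y"

definition covers_in :: "'a set \<Rightarrow> ('a \<Rightarrow> 'a \<Rightarrow> bool) \<Rightarrow> 'a \<Rightarrow> 'a \<Rightarrow> bool" where
  "covers_in P leq x y \<longleftrightarrow> x \<in> P \<and> y \<in> P \<and> lt_on leq x y \<and>
      \<not> (\<exists>z\<in>P. lt_on leq x z \<and> lt_on leq z y)"

definition connected_poset :: "'a set \<Rightarrow> ('a \<Rightarrow> 'a \<Rightarrow> bool) \<Rightarrow> bool" where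
  "connected_poset D leq \<longleftrightarrow> D \<noteq> {} \<and>
     \<not> (\<exists>A B. A \<noteq> {} \<and> B \<noteq> {} \<and> A \<inter> B = {} \<and> A \<union> B = D \<and>
             (\<forall>a\<in>A. \<forall>b\<in>B. \<not> leq a b \<and> \<not> leq b a))"

definition is_decomposition :: "'a set \<Rightarrow> ('a \<Rightarrow> 'a \<Rightarrow> bool) \<Rightarrow> 'a set set \<Rightarrow> bool" where
  "is_decomposition P leq \<D> \<longleftrightarrow>
     \<Union>\<D> = P \<and> (\<forall>D\<in>\<D>. \<forall>D'\<in>\<D>. D \<noteq> D' \<longrightarrow> D \<inter> D' = {}) \<and>
     (\<forall>D\<in>\<D>. connected_poset D leq \<and>
        (\<forall>x y. covers_in D leq x y \<longrightarrow> covers_in P leq x y))"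

definition minimal_elems :: "'a set \<Rightarrow> ('a \<Rightarrow> 'a \<Rightarrow> bool) \<Rightarrow> 'a set" where
  "minimal_elems D leq = {x\<in>D. \<not> (\<exists>y\<in>D. lt_on leq y x)}"

definition maximal_elems :: "'a set \<Rightarrow> ('a \<Rightarrow> 'a \<Rightarrow> bool) \<Rightarrow> 'a set" where
  "maximal_elems D leq = {x\<in>D. \<not> (\<exists>y\<in>D. lt_on leq x y)}"

definition symmetric_decomposition ::
  "'a set \<Rightarrow> ('a \<Rightarrow> 'a \<Rightarrow> bool) \<Rightarrow> ('a \<Rightarrow> nat) \<Rightarrow> nat \<Rightarrow> 'a set set \<Rightarrow> bool" where
  "symmetric_decomposition P leq rk N \<D> \<longleftrightarrow> is_decomposition P leq \<D> \<and>
     (\<forall>D\<in>\<D>. \<exists>f. bij_betw f (minimal_elems D leq) (maximal_elems D leq) \<and>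
               (\<forall>p\<in>minimal_elems D leq. rk p + rk (f p) = N))"

definition is_chain :: "'a set \<Rightarrow> ('a \<Rightarrow> 'a \<Rightarrow> bool) \<Rightarrow> bool" where
  "is_chain C leq \<longleftrightarrow> (\<forall>x\<in>C. \<forall>y\<in>C. leq x y \<or> leq y x)"

definition is_boolean_lattice :: "'a set \<Rightarrow> ('a \<Rightarrow> 'a \<Rightarrow> bool) \<Rightarrow> bool" where
  "is_boolean_lattice D leq \<longleftrightarrow> (\<exists>(k::nat) g. bij_betw g D (Pow {..<k}) \<and>
       (\<forall>x\<in>D. \<forall>y\<in>D. leq x y \<longleftrightarrow> g x \<subseteq> g y))"

definition symmetric_chain_decomposition ::
  "'a set \<Rightarrow> ('a \<Rightarrow> 'a \<Rightarrow> bool) \<Rightarrow> ('a \<Rightarrow> nat) \<Rightarrow> nat \<Rightarrow> bool" where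
  "symmetric_chain_decomposition P leq rk N \<longleftrightarrow>
     (\<exists>\<D>. symmetric_decomposition P leq rk N \<D> \<and> (\<forall>D\<in>\<D>. is_chain D leq))"

definition symmetric_boolean_decomposition ::
  "'a set \<Rightarrow> ('a \<Rightarrow> 'a \<Rightarrow> bool) \<Rightarrow> ('a \<Rightarrow> nat) \<Rightarrow> nat \<Rightarrow> bool" where
  "symmetric_boolean_decomposition P leq rk N \<longleftrightarrow>
     (\<exists>\<D>. symmetric_decomposition P leq rk N \<D> \<and> (\<forall>D\<in>\<D>. is_boolean_lattice D leq))"

definition rank_number :: "'a set \<Rightarrow> ('a \<Rightarrow> nat) \<Rightarrow> nat \<Rightarrow> nat" where
  "rank_number P rk i = card {p\<in>P. rk p = i}"

definition k_family :: "'a set \<Rightarrow> ('a \<Rightarrow> 'a \<Rightarrow> bool) \<Rightarrow> nat \<Rightarrow> 'a set \<Rightarrow> bool" where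
  "k_family P leq k F \<longleftrightarrow> F \<subseteq> P \<and>
     \<not> (\<exists>C\<subseteq>F. is_chain C leq \<and> finite C \<and> card C = k + 1)"

definition k_Sperner ::
  "'a set \<Rightarrow> ('a \<Rightarrow> 'a \<Rightarrow> bool) \<Rightarrow> ('a \<Rightarrow> nat) \<Rightarrow> nat \<Rightarrow> nat \<Rightarrow> bool" where
  "k_Sperner P leq rk N k \<longleftrightarrow>
     Max {card F | F. k_family P leq k F} =
     Max {(\<Sum>i\<in>K. rank_number P rk i) | K. K \<subseteq> {0..N} \<and> card K = k}"

definition strongly_Sperner ::
  "'a set \<Rightarrow> ('a \<Rightarrow> 'a \<Rightarrow> bool) \<Rightarrow> ('a \<Rightarrow> nat) \<Rightarrow> nat \<Rightarrow> bool" where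
  "strongly_Sperner P leq rk N \<longleftrightarrow> (\<forall>k\<in>{1..N}. k_Sperner P leq rk N k)"

definition symmetric_seq :: "(nat \<Rightarrow> nat) \<Rightarrow> nat \<Rightarrow> bool" where
  "symmetric_seq r N \<longleftrightarrow> (\<forall>i\<le>N. r i = r (N - i))"

definition unimodal_seq :: "(nat \<Rightarrow> nat) \<Rightarrow> nat \<Rightarrow> bool" where
  "unimodal_seq r N \<longleftrightarrow> (\<exists>m\<le>N. (\<forall>i j. i \<le> j \<and> j \<le> m \<longrightarrow> r i \<le> r j) \<and>
                                 (\<forall>i j. m \<le> i \<and> i \<le> j \<and> j \<le> N \<longrightarrow> r j \<le> r i))"

definition gamma_nonneg :: "(nat \<Rightarrow> nat) \<Rightarrow> nat \<Rightarrow> bool" where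
  "gamma_nonneg r N \<longleftrightarrow> (\<exists>\<gamma> :: nat \<Rightarrow> int. (\<forall>j\<le>N div 2. \<gamma> j \<ge> 0) \<and>
     (\<Sum>k\<le>N. monom (int (r k)) k) =
     (\<Sum>j\<le>N div 2. smult (\<gamma> j) (monom 1 j * [:1, 1:] ^ (N - 2 * j))))"

end

theory Submission
  imports Defs "HOL-Library.Set_Algebras"
begin

text \<open>
  Let \<open>\<gamma>\<close> be a Coxeter element, i.e. an \<open>(n - 1)\<close>-cycle of colour \<open>\<omega>\<close> on \<open>p, p\<^sub>2, \<dots>, p\<^bsub>n-1\<^esub>\<close>
  together with a scaling by \<open>1 / \<omega>\<close> of a coordinate \<open>e\<close>. On \<open>[1, \<gamma>]\<close> the absolute length is the
  codimension of the fixed space. The elements \<open>w\<close> of the interval are sorted by the image \<open>q\<close> of \<open>p\<close>.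
  Those with \<open>w p = q\<close> are \<open>t w'\<close>, where \<open>t\<close> is the reflection taking \<open>p\<close> to \<open>q\<close> and \<open>w'\<close> runs through the
  interval below the part of \<open>t\<^sup>-\<^sup>1 \<gamma>\<close> that fixes \<open>p\<close>. That interval is a product of intervals of
  the same kind and of intervals below ordinary cycles. Most of these translated products are
  centred in \<open>[1, \<gamma>]\<close>. The remaining ones, one of them cut into smaller products first, are matched in pairs \<open>a Q\<close>, \<open>a r Q\<close> with \<open>r\<close> a reflection, and
  such a pair is a product of \<open>Q\<close> with a chain of length one. By induction the interval is partitioned into
  symmetric cubes.
\<close>

section \<open>Partitions into symmetric cubes and chains\<close>

text \<open>Codimension is computable fibre by fibre, but in G(d,d,n) the reflection length can
  exceed it: for d = n = 3 a primitive cube root of unity times the identity has codimension 3 and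
  determinant 1, while all reflections have determinant -1. So length and order are first studied in
  the group of all monomial operators, the interval is then intersected with \<open>W\<close>, and
  each partition carries the certificate \<open>good\<close> that codimension is attained by
  reflections of the group.

  Centring is measured by the sum of bottom and top rank. With L points in \<open>qs\<close> it must
  be L + 2. A reflection in front adds 2, and products add. The fibres over \<open>p\<close> and
  \<open>qs ! 0\<close> give L + 1 and L + 3 and differ by a reflection. The fibres over
  \<open>scl (1 / \<omega>) (qs ! 0)\<close> and \<open>scl \<omega> p\<close> also give L + 1 and L
  + 3, but the translating elements differ by an element of codimension 3. Therefore the centred
  fibre over \<open>e\<close> is cut open: two of its pieces, with sums L + 1 and L + 3, become the
  missing partners, and the others are centred.\<close>

definition sym_cube :: "('a \<Rightarrow> 'a \<Rightarrow> bool) \<Rightarrow> ('a \<Rightarrow> nat) \<Rightarrow> nat \<Rightarrow> 'a set \<Rightarrow> bool" where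
  "sym_cube leq rk N D \<longleftrightarrow> (\<exists>k f. D = f ` Pow {..<k} \<and>
     (\<forall>A B. A \<subseteq> {..<k} \<longrightarrow> B \<subseteq> {..<k} \<longrightarrow> (leq (f A) (f B) \<longleftrightarrow> A \<subseteq> B)) \<and>
     (\<forall>A. A \<subseteq> {..<k} \<longrightarrow> rk (f A) = rk (f {}) + card A) \<and> 2 * rk (f {}) + k = N)"

definition sym_chain :: "('a \<Rightarrow> 'a \<Rightarrow> bool) \<Rightarrow> ('a \<Rightarrow> nat) \<Rightarrow> nat \<Rightarrow> 'a set \<Rightarrow> bool" where
  "sym_chain leq rk N C \<longleftrightarrow> (\<exists>a h. 2 * a \<le> N \<and> C = h ` {a..N - a} \<and>
     (\<forall>i\<in>{a..N - a}. rk (h i) = i) \<and>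
     (\<forall>i\<in>{a..N - a}. \<forall>j\<in>{a..N - a}. i \<le> j \<longrightarrow> leq (h i) (h j)))"

definition partitioned :: "('a set \<Rightarrow> bool) \<Rightarrow> 'a set \<Rightarrow> bool" where
  "partitioned part P \<longleftrightarrow> (\<exists>\<D>. \<Union>\<D> = P \<and> pairwise disjnt \<D> \<and> (\<forall>D\<in>\<D>. part D))"

lemma partitioned_self: "part P \<Longrightarrow> partitioned part P"
  unfolding partitioned_def by (rule exI[of _ "{P}"]) auto

lemma partitioned_UN:
  assumes "\<And>j. j \<in> J \<Longrightarrow> partitioned part (P j)"
    and "\<And>i j. i \<in> J \<Longrightarrow> j \<in> J \<Longrightarrow> i \<noteq> j \<Longrightarrow> P i \<inter> P j = {}"
  shows "partitioned part (\<Union>j\<in>J. P j)"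
proof -
  obtain \<D> where \<D>: "\<And>j. j \<in> J \<Longrightarrow> \<Union>(\<D> j) = P j \<and> pairwise disjnt (\<D> j) \<and> (\<forall>D\<in>\<D> j. part D)"
    using assms(1) unfolding partitioned_def by metis
  have "pairwise disjnt (\<Union>j\<in>J. \<D> j)"
  proof (rule pairwiseI)
    fix D E assume "D \<in> (\<Union>j\<in>J. \<D> j)" "E \<in> (\<Union>j\<in>J. \<D> j)" "D \<noteq> E"
    then obtain i j where ij: "i \<in> J" "j \<in> J" "D \<in> \<D> i" "E \<in> \<D> j" by auto
    show "disjnt D E"
    proof (cases "i = j")
      case True
      then show ?thesis using \<D>[of j] ij \<open>D \<noteq> E\<close> by (auto simp: pairwise_def)
    next
      case False
      then have "P i \<inter> P j = {}" using assms(2) ij by blast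
      then show ?thesis using \<D>[of i] \<D>[of j] ij by (auto simp: disjnt_def)
    qed
  qed
  moreover have "\<Union>(\<Union>j\<in>J. \<D> j) = (\<Union>j\<in>J. \<Union>(\<D> j))" by blast
  moreover have "\<dots> = (\<Union>j\<in>J. P j)" using \<D> by simp
  ultimately show ?thesis unfolding partitioned_def using \<D> by (intro exI[of _ "\<Union>j\<in>J. \<D> j"]) auto
qed

lemma partitioned_fibres:
  assumes "\<And>j. partitioned part {w \<in> P. key w = j}"
  shows "partitioned part P"
proof -
  have "partitioned part (\<Union>j. {w \<in> P. key w = j})"
    by (rule partitioned_UN) (use assms in auto)
  moreover have "(\<Union>j. {w \<in> P. key w = j}) = P" by auto
  ultimately show ?thesis by simp
qed

lemma partitioned_empty: "partitioned part {}"
  unfolding partitioned_def by (rule exI[of _ "{}"]) auto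

lemma partitioned_refine:
  assumes "partitioned part P" and "\<And>D. part D \<Longrightarrow> partitioned part' D"
  shows "partitioned part' P"
proof -
  obtain \<D> where \<D>: "\<Union>\<D> = P" "pairwise disjnt \<D>" "\<forall>D\<in>\<D>. part D"
    using assms(1) by (auto simp: partitioned_def)
  have "partitioned part' (\<Union>D\<in>\<D>. D)"
    by (rule partitioned_UN) (use assms(2) \<D> in \<open>auto simp: pairwise_def disjnt_def\<close>)
  then show ?thesis using \<D> by simp
qed

lemma partitioned_image:
  assumes "partitioned part P" "inj_on f P"
    and "\<And>D. D \<subseteq> P \<Longrightarrow> part D \<Longrightarrow> part' (f ` D)"
  shows "partitioned part' (f ` P)"
proof -
  obtain \<D> where \<D>: "\<Union>\<D> = P" "pairwise disjnt \<D>" "\<forall>D\<in>\<D>. part D"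
    using assms(1) by (auto simp: partitioned_def)
  have "partitioned part' (\<Union>D\<in>\<D>. f ` D)"
  proof (rule partitioned_UN)
    fix D assume "D \<in> \<D>"
    then show "partitioned part' (f ` D)" using assms(3)[of D] \<D> by (auto intro: partitioned_self)
  next
    fix D E assume DE: "D \<in> \<D>" "E \<in> \<D>" "D \<noteq> E"
    then have "D \<inter> E = {}" using \<D>(2) by (auto simp: pairwise_def disjnt_def)
    then show "f ` D \<inter> f ` E = {}"
      using assms(2) DE \<D>(1) by (metis Union_upper image_empty inj_on_image_Int)
  qed
  moreover have "(\<Union>D\<in>\<D>. f ` D) = f ` P" using \<D> by auto
  ultimately show ?thesis by simp
qed

abbreviation sbd :: "('a \<Rightarrow> 'a \<Rightarrow> bool) \<Rightarrow> ('a \<Rightarrow> nat) \<Rightarrow> nat \<Rightarrow> 'a set \<Rightarrow> bool" where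
  "sbd leq rk N \<equiv> partitioned (sym_cube leq rk N)"

text \<open>A pair of subsets of \<open>{..<k}\<close> and \<open>{..<l}\<close> is coded as one
  subset of \<open>{..<k+l}\<close>, the second one shifted by \<open>k\<close>. The map
  \<open>m\<close> stays abstract because it will be multiplication in a non-commutative group,
  where compatibility with order and rank is known on \<open>P\<close> and \<open>Q\<close>
  only.\<close>

lemma sym_cube_product:
  assumes P: "sym_cube leqP rkP M P" and Q: "sym_cube leqQ rkQ N Q"
    and leq: "\<And>p p' q q'. p \<in> P \<Longrightarrow> p' \<in> P \<Longrightarrow> q \<in> Q \<Longrightarrow> q' \<in> Q \<Longrightarrow>
        leq (m p q) (m p' q') \<longleftrightarrow> leqP p p' \<and> leqQ q q'"
    and rk: "\<And>p q. p \<in> P \<Longrightarrow> q \<in> Q \<Longrightarrow> rk (m p q) = rkP p + rkQ q"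
  shows "sym_cube leq rk (M + N) {m p q |p q. p \<in> P \<and> q \<in> Q}"
proof -
  obtain k f where f: "P = f ` Pow {..<k}"
      "\<And>A B. A \<subseteq> {..<k} \<Longrightarrow> B \<subseteq> {..<k} \<Longrightarrow> leqP (f A) (f B) \<longleftrightarrow> A \<subseteq> B"
      "\<And>A. A \<subseteq> {..<k} \<Longrightarrow> rkP (f A) = rkP (f {}) + card A" "2 * rkP (f {}) + k = M"
    using P unfolding sym_cube_def by metis
  obtain l g where g: "Q = g ` Pow {..<l}"
      "\<And>A B. A \<subseteq> {..<l} \<Longrightarrow> B \<subseteq> {..<l} \<Longrightarrow> leqQ (g A) (g B) \<longleftrightarrow> A \<subseteq> B"
      "\<And>A. A \<subseteq> {..<l} \<Longrightarrow> rkQ (g A) = rkQ (g {}) + card A" "2 * rkQ (g {}) + l = N"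
    using Q unfolding sym_cube_def by metis
  define lo where "lo C = C \<inter> {..<k}" for C
  define hi where "hi C = {i. i + k \<in> C}" for C
  define h where "h C = m (f (lo C)) (g (hi C))" for C
  have lo: "lo C \<subseteq> {..<k}" and hi: "C \<subseteq> {..<k+l} \<Longrightarrow> hi C \<subseteq> {..<l}" for C
    by (auto simp: lo_def hi_def)
  have C: "C = lo C \<union> (\<lambda>i. i + k) ` hi C" for C
  proof -
    have "x \<in> (\<lambda>i. i + k) ` hi C" if "x \<in> C" "\<not> x < k" for x
      using that by (intro image_eqI[of _ _ "x - k"]) (auto simp: hi_def)
    then show ?thesis by (auto simp: lo_def hi_def)
  qed
  have sub: "A \<subseteq> B \<longleftrightarrow> lo A \<subseteq> lo B \<and> hi A \<subseteq> hi B" for A B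
    using C[of A] C[of B] by (auto simp: lo_def hi_def)
  have card: "card A = card (lo A) + card (hi A)" if "A \<subseteq> {..<k+l}" for A
  proof -
    have "finite (lo A)" "finite (hi A)" using lo[of A] hi[OF that] finite_subset by blast+
    then have "card (lo A \<union> (\<lambda>i. i + k) ` hi A) = card (lo A) + card (hi A)"
      by (subst card_Un_disjoint) (auto simp: lo_def card_image)
    then show ?thesis using C[of A] by simp
  qed
  have [simp]: "lo {} = {}" "hi {} = {}" by (auto simp: lo_def hi_def)
  show ?thesis
    unfolding sym_cube_def
  proof (intro exI conjI allI impI)
    show "{m p q |p q. p \<in> P \<and> q \<in> Q} = h ` Pow {..<k+l}"
    proof safe
      fix p q assume "p \<in> P" "q \<in> Q"
      then obtain A B where AB: "A \<subseteq> {..<k}" "B \<subseteq> {..<l}" "p = f A" "q = g B" using f(1) g(1) by auto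
      then have "lo (A \<union> (\<lambda>i. i + k) ` B) = A" "hi (A \<union> (\<lambda>i. i + k) ` B) = B"
        by (auto simp: lo_def hi_def)
      then show "m p q \<in> h ` Pow {..<k+l}"
        using AB by (intro image_eqI[of _ _ "A \<union> (\<lambda>i. i + k) ` B"]) (auto simp: h_def)
    next
      fix C assume "C \<subseteq> {..<k+l}"
      then show "\<exists>p q. h C = m p q \<and> p \<in> P \<and> q \<in> Q"
        using lo[of C] hi[of C] f(1) g(1) unfolding h_def by blast
    qed
  next
    fix A B assume "A \<subseteq> {..<k+l}" "B \<subseteq> {..<k+l}"
    then show "leq (h A) (h B) \<longleftrightarrow> A \<subseteq> B"
      using lo[of A] lo[of B] hi[of A] hi[of B] unfolding h_def sub[of A B]
      by (subst leq) (auto simp: f g)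
  next
    fix A assume A: "A \<subseteq> {..<k+l}"
    have *: "rk (h A) = rkP (f (lo A)) + rkQ (g (hi A))" if "A \<subseteq> {..<k+l}" for A
      unfolding h_def by (rule rk) (use lo[of A] hi[OF that] f(1) g(1) in auto)
    show "rk (h A) = rk (h {}) + card A"
      using *[OF A] *[of "{}"] f(3)[OF lo[of A]] g(3)[OF hi[OF A]] card[OF A] by simp
  next
    have "rk (h {}) = rkP (f {}) + rkQ (g {})"
      unfolding h_def by (subst rk) (use f(1) g(1) in auto)
    then show "2 * rk (h {}) + (k + l) = M + N" using f(4) g(4) by simp
  qed
qed

lemma sbd_product:
  assumes "sbd leqP rkP M P" "sbd leqQ rkQ N Q"
    and leq: "\<And>p p' q q'. p \<in> P \<Longrightarrow> p' \<in> P \<Longrightarrow> q \<in> Q \<Longrightarrow> q' \<in> Q \<Longrightarrow>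
        leq (m p q) (m p' q') \<longleftrightarrow> leqP p p' \<and> leqQ q q'"
    and rk: "\<And>p q. p \<in> P \<Longrightarrow> q \<in> Q \<Longrightarrow> rk (m p q) = rkP p + rkQ q"
    and inj: "\<And>p p' q q'. p \<in> P \<Longrightarrow> p' \<in> P \<Longrightarrow> q \<in> Q \<Longrightarrow> q' \<in> Q \<Longrightarrow>
        m p q = m p' q' \<Longrightarrow> p = p' \<and> q = q'"
  shows "sbd leq rk (M + N) {m p q |p q. p \<in> P \<and> q \<in> Q}"
proof -
  obtain \<D> where \<D>: "\<Union>\<D> = P" "pairwise disjnt \<D>" "\<forall>D\<in>\<D>. sym_cube leqP rkP M D"
    using assms(1) by (auto simp: partitioned_def)
  obtain \<E> where \<E>: "\<Union>\<E> = Q" "pairwise disjnt \<E>" "\<forall>E\<in>\<E>. sym_cube leqQ rkQ N E"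
    using assms(2) by (auto simp: partitioned_def)
  define F where "F = (\<lambda>(D, E). {m p q |p q. p \<in> D \<and> q \<in> E})"
  have "sbd leq rk (M + N) (\<Union>(F ` (\<D> \<times> \<E>)))"
  proof (rule partitioned_UN)
    fix j assume "j \<in> \<D> \<times> \<E>"
    then obtain D E where j: "j = (D, E)" "D \<in> \<D>" "E \<in> \<E>" by auto
    then have sub: "D \<subseteq> P" "E \<subseteq> Q" using \<D> \<E> by auto
    have "sym_cube leq rk (M + N) (F j)"
      unfolding F_def j prod.case
      by (rule sym_cube_product[of leqP rkP M D leqQ rkQ N E])
        (use j \<D> \<E> sub leq rk in \<open>auto simp: subset_iff\<close>)
    then show "sbd leq rk (M + N) (F j)" by (rule partitioned_self)
  next
    fix i j assume "i \<in> \<D> \<times> \<E>" "j \<in> \<D> \<times> \<E>" "i \<noteq> j"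
    then obtain D E D' E' where *: "i = (D, E)" "j = (D', E')" "D \<in> \<D>" "D' \<in> \<D>" "E \<in> \<E>" "E' \<in> \<E>"
        "D \<noteq> D' \<or> E \<noteq> E'" by auto
    then have disj: "D \<inter> D' = {} \<or> E \<inter> E' = {}"
      using \<D>(2) \<E>(2) by (metis disjnt_def pairwiseD)
    have sub: "D \<subseteq> P" "D' \<subseteq> P" "E \<subseteq> Q" "E' \<subseteq> Q" using \<D> \<E> * by auto
    show "F i \<inter> F j = {}"
    proof (rule ccontr)
      assume "F i \<inter> F j \<noteq> {}"
      then obtain p q p' q' where "p \<in> D" "q \<in> E" "p' \<in> D'" "q' \<in> E'" "m p q = m p' q'"
        by (auto simp: F_def *)
      then show False using inj[of p p' q q'] sub disj by blast
    qed
  qed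
  moreover have "\<Union>(F ` (\<D> \<times> \<E>)) = {m p q |p q. p \<in> P \<and> q \<in> Q}"
    unfolding F_def using \<D>(1) \<E>(1) by fast
  ultimately show ?thesis by simp
qed

text \<open>The classical induction: a chain of subsets of \<open>{..<k}\<close> yields two chains
  one dimension up. \<open>C1\<close> is the chain extended by its top with \<open>k\<close>
  inserted, and \<open>C2\<close> is the chain without its top, with \<open>k\<close> inserted
  throughout. Both are centred again.\<close>

lemma cube_chains: "partitioned (sym_chain (\<subseteq>) card k) (Pow {..<k})"
proof (induction k)
  case 0
  have "sym_chain (\<subseteq>) card 0 {{} :: nat set}"
    unfolding sym_chain_def by (rule exI[of _ 0], rule exI[of _ "\<lambda>_. {}"]) auto
  then show ?case by (simp add: partitioned_self)
next
  case (Suc k)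
  obtain \<C> where \<C>: "\<Union>\<C> = Pow {..<k}" "pairwise disjnt \<C>" "\<forall>C\<in>\<C>. sym_chain (\<subseteq>) card k C"
    using Suc by (auto simp: partitioned_def)
  have "partitioned (sym_chain (\<subseteq>) card (Suc k)) (\<Union>C\<in>\<C>. C \<union> insert k ` C)"
  proof (rule partitioned_UN)
    fix C assume "C \<in> \<C>"
    then obtain a h where h: "2 * a \<le> k" "C = h ` {a..k - a}" "\<And>i. i \<in> {a..k - a} \<Longrightarrow> card (h i) = i"
      "\<And>i j. i \<in> {a..k - a} \<Longrightarrow> j \<in> {a..k - a} \<Longrightarrow> i \<le> j \<Longrightarrow> h i \<subseteq> h j"
      using \<C>(3) unfolding sym_chain_def by metis
    have sub: "h i \<subseteq> {..<k}" if "i \<in> {a..k - a}" for i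
      using h(2) \<C>(1) \<open>C \<in> \<C>\<close> that by blast
    have fin: "finite (h i)" "k \<notin> h i" if "i \<in> {a..k - a}" for i
      using sub[OF that] finite_subset by auto
    define u where "u = (\<lambda>i. if i \<le> k - a then h i else insert k (h (k - a)))"
    define v where "v = (\<lambda>i. insert k (h (i - 1)))"
    define C1 where "C1 = u ` {a..Suc k - a}"
    define C2 where "C2 = v ` {Suc a..k - a}"
    have set1: "{a..Suc k - a} = insert (Suc (k - a)) {a..k - a}" using h(1) by auto
    have C1: "C1 = insert (insert k (h (k - a))) C"
      unfolding C1_def set1 using h(1,2) by (auto simp: u_def)
    have "{a..k - a} = insert (k - a) {a..<k - a}" using h(1) by auto
    then have "insert k ` C = insert (insert k (h (k - a))) ((\<lambda>i. insert k (h i)) ` {a..<k - a})"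
      unfolding h(2) image_image by (metis image_insert)
    moreover have "(\<lambda>i. insert k (h i)) ` {a..<k - a} = C2"
    proof -
      have "{Suc a..k - a} = Suc ` {a..<k - a}" by (simp add: image_Suc_atLeastLessThan atLeastLessThanSuc_atLeastAtMost)
      then show ?thesis by (simp only: C2_def v_def image_image) simp
    qed
    ultimately have split: "C \<union> insert k ` C = C1 \<union> C2" using C1 by auto
    have "sym_chain (\<subseteq>) card (Suc k) C1"
      unfolding sym_chain_def
    proof (intro exI conjI ballI impI)
      show "C1 = u ` {a..Suc k - a}" by (simp add: C1_def)
      show "2 * a \<le> Suc k" using h(1) by simp
      have ka: "k - a \<in> {a..k - a}" using h(1) by auto
      show "card (u i) = i" if "i \<in> {a..Suc k - a}" for i
        using that h(1) h(3)[of i] h(3)[OF ka] fin[OF ka] by (auto simp: u_def)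
      show "u i \<subseteq> u j" if "i \<in> {a..Suc k - a}" "j \<in> {a..Suc k - a}" "i \<le> j" for i j
        using that h(4)[of i j] h(4)[OF _ ka, of i] by (auto simp: u_def)
    qed
    \<comment> \<open>\<open>C2\<close> is empty precisely when the old chain has a single element,
      that is when \<open>2 * a = k\<close>.\<close>
    moreover have "C2 = {} \<or> sym_chain (\<subseteq>) card (Suc k) C2"
    proof (cases "2 * Suc a \<le> Suc k")
      case True
      have "sym_chain (\<subseteq>) card (Suc k) C2"
        unfolding sym_chain_def
      proof (intro exI conjI ballI impI)
        show "C2 = v ` {Suc a..Suc k - Suc a}" by (simp add: C2_def)
        show "2 * Suc a \<le> Suc k" by (rule True)
        show "card (v i) = i" if "i \<in> {Suc a..Suc k - Suc a}" for i
        proof -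
          have "i - 1 \<in> {a..k - a}" using that by auto
          from h(3)[OF this] fin[OF this] show ?thesis using that by (auto simp: v_def)
        qed
        show "v i \<subseteq> v j" if "i \<in> {Suc a..Suc k - Suc a}" "j \<in> {Suc a..Suc k - Suc a}" "i \<le> j" for i j
        proof -
          have "h (i - 1) \<subseteq> h (j - 1)" using that by (intro h(4)) auto
          then show ?thesis by (auto simp: v_def)
        qed
      qed
      then show ?thesis ..
    qed (auto simp: C2_def)
    moreover have "C1 \<inter> C2 = {}"
    proof -
      have ne: "insert k (h i) \<noteq> insert k (h (k - a))" if "i \<in> {a..<k - a}" for i
      proof
        assume "insert k (h i) = insert k (h (k - a))"
        then have "h i = h (k - a)" using fin[of i] fin[of "k - a"] that by (metis atLeastLessThan_iff atLeastAtMost_iff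
              insert_ident less_imp_le order_refl le_trans)
        then show False using h(3)[of i] h(3)[of "k - a"] that by auto
      qed
      have notin: "X \<noteq> insert k Y" if "X \<in> C" for X Y
        using that h(2) fin(2) by blast
      have "insert k (h (k - a)) \<notin> C2"
      proof
        assume "insert k (h (k - a)) \<in> C2"
        then obtain i where "i \<in> {Suc a..k - a}" "insert k (h (k - a)) = insert k (h (i - 1))"
          unfolding C2_def v_def by blast
        moreover from this have "i - 1 \<in> {a..<k - a}" by simp arith
        ultimately show False using ne by metis
      qed
      moreover have "C \<inter> C2 = {}" unfolding C2_def v_def using notin by blast
      ultimately show ?thesis unfolding C1 by simp
    qed
    ultimately show "partitioned (sym_chain (\<subseteq>) card (Suc k)) (C \<union> insert k ` C)"
      unfolding split partitioned_def
      by (cases "C2 = {}") (rule exI[of _ "{C1}"], simp,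
          rule exI[of _ "{C1, C2}"], auto simp: pairwise_def disjnt_def)
  next
    fix C D assume CD: "C \<in> \<C>" "D \<in> \<C>" "C \<noteq> D"
    then have "C \<inter> D = {}" using \<C>(2) by (auto simp: pairwise_def disjnt_def)
    moreover have "k \<notin> X" if "X \<in> C \<or> X \<in> D" for X using that \<C>(1) CD by blast
    ultimately show "(C \<union> insert k ` C) \<inter> (D \<union> insert k ` D) = {}"
      by auto (metis insert_ident disjoint_iff)+
  qed
  moreover have "(\<Union>C\<in>\<C>. C \<union> insert k ` C) = Pow {..<Suc k}"
  proof -
    have "(\<Union>C\<in>\<C>. C \<union> insert k ` C) = \<Union>\<C> \<union> insert k ` \<Union>\<C>" by blast
    also have "\<dots> = Pow (insert k {..<k})" unfolding \<C>(1) Pow_insert ..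
    finally show ?thesis unfolding lessThan_Suc .
  qed
  ultimately show ?case by simp
qed

text \<open>Each cube inherits the chains of the Boolean lattice. The rank \<open>r\<close> of its
  bottom is the shift between cardinality and rank.\<close>

lemma sbd_imp_chains:
  assumes "sbd leq rk N P"
  shows "partitioned (sym_chain leq rk N) P"
proof (rule partitioned_refine[OF assms])
  fix D assume "sym_cube leq rk N D"
  then obtain k f where f: "D = f ` Pow {..<k}"
      "\<And>A B. A \<subseteq> {..<k} \<Longrightarrow> B \<subseteq> {..<k} \<Longrightarrow> leq (f A) (f B) \<longleftrightarrow> A \<subseteq> B"
      "\<And>A. A \<subseteq> {..<k} \<Longrightarrow> rk (f A) = rk (f {}) + card A" "2 * rk (f {}) + k = N"
    unfolding sym_cube_def by metis
  show "partitioned (sym_chain leq rk N) D"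
    unfolding f(1)
  proof (rule partitioned_image[OF cube_chains])
    show "inj_on f (Pow {..<k})"
      using f(2) by (auto simp: inj_on_def) (metis subset_eq)+
    fix C assume C: "C \<subseteq> Pow {..<k}" "sym_chain (\<subseteq>) card k C"
    then obtain a h where h: "2 * a \<le> k" "C = h ` {a..k - a}" "\<And>i. i \<in> {a..k - a} \<Longrightarrow> card (h i) = i"
      "\<And>i j. i \<in> {a..k - a} \<Longrightarrow> j \<in> {a..k - a} \<Longrightarrow> i \<le> j \<Longrightarrow> h i \<subseteq> h j"
      unfolding sym_chain_def by metis
    have sub: "h i \<subseteq> {..<k}" if "i \<in> {a..k - a}" for i using h(2) C(1) that by blast
    define r where "r = rk (f {})"
    have int: "{a + r..N - (a + r)} = (\<lambda>i. i + r) ` {a..k - a}"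
    proof -
      have "N - (a + r) = k - a + r" using f(4) h(1) by (simp add: r_def)
      then show ?thesis by simp
    qed
    show "sym_chain leq rk N (f ` C)"
      unfolding sym_chain_def
    proof (intro exI conjI ballI impI)
      show "f ` C = (\<lambda>i. f (h (i - r))) ` {a + r..N - (a + r)}"
        unfolding int h(2) image_image by simp
      show "2 * (a + r) \<le> N" using f(4) h(1) by (simp add: r_def)
      show "rk (f (h (i - r))) = i" if i: "i \<in> {a + r..N - (a + r)}" for i
      proof -
        obtain i' where "i' \<in> {a..k - a}" "i = i' + r" using i unfolding int by blast
        then show ?thesis using f(3)[OF sub] h(3) by (simp add: r_def)
      qed
      show "leq (f (h (i - r))) (f (h (j - r)))"
        if i: "i \<in> {a + r..N - (a + r)}" and j: "j \<in> {a + r..N - (a + r)}" and "i \<le> j" for i j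
      proof -
        obtain i' j' where "i' \<in> {a..k - a}" "i = i' + r" "j' \<in> {a..k - a}" "j = j' + r"
          using i j unfolding int by blast
        then show ?thesis using f(2)[OF sub sub] h(4) \<open>i \<le> j\<close> by simp
      qed
    qed
  qed
qed

section \<open>Consequences for graded posets\<close>

locale graded_set =
  fixes P :: "'a set" and leq :: "'a \<Rightarrow> 'a \<Rightarrow> bool" and rk :: "'a \<Rightarrow> nat" and N :: nat
  assumes fin: "finite P"
    and rk_mono: "\<And>x y. x \<in> P \<Longrightarrow> y \<in> P \<Longrightarrow> leq x y \<Longrightarrow> rk x \<le> rk y"
    and rk_inj: "\<And>x y. x \<in> P \<Longrightarrow> y \<in> P \<Longrightarrow> leq x y \<Longrightarrow> rk x = rk y \<Longrightarrow> x = y"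
begin

lemma rk_less: "x \<in> P \<Longrightarrow> y \<in> P \<Longrightarrow> lt_on leq x y \<Longrightarrow> rk x < rk y"
  using rk_mono rk_inj by (fastforce simp: lt_on_def)

lemma covers_in_of_rk: "x \<in> P \<Longrightarrow> y \<in> P \<Longrightarrow> lt_on leq x y \<Longrightarrow> rk y \<le> Suc (rk x) \<Longrightarrow> covers_in P leq x y"
  unfolding covers_in_def by (meson leD less_trans_Suc order.strict_trans2 rk_less)

lemma connectedI:
  assumes "b \<in> D" "\<And>x. x \<in> D \<Longrightarrow> leq b x"
  shows "connected_poset D leq"
  using assms unfolding connected_poset_def by blast

text \<open>Each part has a least element \<open>b\<close> and a greatest element \<open>t\<close>.
  Hence it is connected, its minimal and maximal elements are unique, and the constant map to
  \<open>t\<close> is the required bijection. A cover inside the part rises by at most one rank,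
  which leaves no room for an element of \<open>P\<close> in between.\<close>

lemma symmetric_decompositionI:
  assumes "\<Union>\<D> = P" "pairwise disjnt \<D>"
    and "\<And>D. D \<in> \<D> \<Longrightarrow> \<exists>b\<in>D. \<exists>t\<in>D. (\<forall>x\<in>D. leq b x \<and> leq x t) \<and> rk b + rk t = N"
    and "\<And>D x y. D \<in> \<D> \<Longrightarrow> covers_in D leq x y \<Longrightarrow> rk y \<le> Suc (rk x)"
  shows "symmetric_decomposition P leq rk N \<D>"
  unfolding symmetric_decomposition_def is_decomposition_def
proof (intro conjI ballI allI impI)
  show "\<Union>\<D> = P" by fact
  show "D \<inter> D' = {}" if "D \<in> \<D>" "D' \<in> \<D>" "D \<noteq> D'" for D D'
    using assms(2) that by (auto simp: pairwise_def disjnt_def)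
  fix D assume D: "D \<in> \<D>"
  then have DP: "D \<subseteq> P" using assms(1) by auto
  obtain b t where bt: "b \<in> D" "t \<in> D" "\<And>x. x \<in> D \<Longrightarrow> leq b x" "\<And>x. x \<in> D \<Longrightarrow> leq x t" "rk b + rk t = N"
    using assms(3)[OF D] by blast
  show "connected_poset D leq" using bt by (intro connectedI)
  show "covers_in P leq x y" if "covers_in D leq x y" for x y
    using assms(4)[OF D that] that DP covers_in_of_rk unfolding covers_in_def[of D] by blast
  have anti: "x = y" if "x \<in> D" "y \<in> D" "leq x y" "leq y x" for x y
    using that DP rk_mono rk_inj by (meson le_antisym subsetD)
  have "minimal_elems D leq = {b}" "maximal_elems D leq = {t}"
    using bt(1-4) anti unfolding minimal_elems_def maximal_elems_def lt_on_def by blast+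
  then show "\<exists>f. bij_betw f (minimal_elems D leq) (maximal_elems D leq) \<and>
      (\<forall>p\<in>minimal_elems D leq. rk p + rk (f p) = N)"
    using bt(5) by (intro exI[of _ "\<lambda>_. t"]) (auto simp: bij_betw_def)
qed

lemma boolean_decomposition:
  assumes "sbd leq rk N P"
  shows "symmetric_boolean_decomposition P leq rk N"
proof -
  obtain \<D> where \<D>: "\<Union>\<D> = P" "pairwise disjnt \<D>" "\<And>D. D \<in> \<D> \<Longrightarrow> sym_cube leq rk N D"
    using assms by (auto simp: partitioned_def)
  have cube: "(\<exists>b\<in>D. \<exists>t\<in>D. (\<forall>x\<in>D. leq b x \<and> leq x t) \<and> rk b + rk t = N) \<and>
      (\<forall>x y. covers_in D leq x y \<longrightarrow> rk y \<le> Suc (rk x)) \<and> is_boolean_lattice D leq"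
    if D: "D \<in> \<D>" for D
  proof -
    obtain k f where f: "D = f ` Pow {..<k}"
      "\<And>A B. A \<subseteq> {..<k} \<Longrightarrow> B \<subseteq> {..<k} \<Longrightarrow> leq (f A) (f B) \<longleftrightarrow> A \<subseteq> B"
      "\<And>A. A \<subseteq> {..<k} \<Longrightarrow> rk (f A) = rk (f {}) + card A" "2 * rk (f {}) + k = N"
      using \<D>(3)[OF D] unfolding sym_cube_def by metis
    have inj: "inj_on f (Pow {..<k})"
      using f(2) by (auto simp: inj_on_def) (metis subset_eq)+
    have 1: "\<exists>b\<in>D. \<exists>t\<in>D. (\<forall>x\<in>D. leq b x \<and> leq x t) \<and> rk b + rk t = N"
    proof (rule bexI[of _ "f {}"], rule bexI[of _ "f {..<k}"], intro conjI ballI)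
      show "f {} \<in> D" "f {..<k} \<in> D" using f(1) by auto
      show "leq (f {}) x" "leq x (f {..<k})" if "x \<in> D" for x
        using that f(1,2) by auto
      show "rk (f {}) + rk (f {..<k}) = N" using f(3)[of "{..<k}"] f(4) by simp
    qed
    have 2: "rk y \<le> Suc (rk x)" if xy: "covers_in D leq x y" for x y
    proof -
      obtain A B where AB: "A \<subseteq> {..<k}" "B \<subseteq> {..<k}" "x = f A" "y = f B"
        using xy f(1) unfolding covers_in_def by auto
      then have "A \<subset> B" using xy f(2) by (auto simp: covers_in_def lt_on_def)
      then obtain i where i: "i \<in> B" "i \<notin> A" by auto
      have "insert i A = B"
      proof (rule ccontr)
        assume ne: "insert i A \<noteq> B"
        have sub: "insert i A \<subseteq> {..<k}" using i AB by auto
        have "f (insert i A) \<noteq> f A" "f (insert i A) \<noteq> f B"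
          using inj sub AB i ne by (auto dest!: inj_onD)
        then have "lt_on leq x (f (insert i A))" "lt_on leq (f (insert i A)) y"
          using f(2)[OF AB(1) sub] f(2)[OF sub AB(2)] i \<open>A \<subset> B\<close> by (auto simp: lt_on_def AB)
        moreover have "f (insert i A) \<in> D" using f(1) sub by blast
        ultimately show False using xy unfolding covers_in_def by blast
      qed
      then have "card B = Suc (card A)" using i AB finite_subset by fastforce
      then show ?thesis using f(3)[OF AB(1)] f(3)[OF AB(2)] AB by simp
    qed
    have "is_boolean_lattice D leq"
      unfolding is_boolean_lattice_def
    proof (intro exI conjI ballI)
      show "bij_betw (inv_into (Pow {..<k}) f) D (Pow {..<k})"
        unfolding f(1) using inj by (intro bij_betw_inv_into) (auto simp: bij_betw_def)
      show "leq x y \<longleftrightarrow> inv_into (Pow {..<k}) f x \<subseteq> inv_into (Pow {..<k}) f y" if "x \<in> D" "y \<in> D" for x y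
        using that f(1,2) inj by auto
    qed
    then show ?thesis using 1 2 by blast
  qed
  show ?thesis
    unfolding symmetric_boolean_decomposition_def
    using symmetric_decompositionI[OF \<D>(1,2)] cube by blast
qed

lemma sym_chain_top_bottom:
  assumes "sym_chain leq rk N C"
  shows "\<exists>b\<in>C. \<exists>t\<in>C. (\<forall>x\<in>C. leq b x \<and> leq x t) \<and> rk b + rk t = N"
proof -
  obtain a h where h: "2 * a \<le> N" "C = h ` {a..N - a}" "\<And>i. i \<in> {a..N - a} \<Longrightarrow> rk (h i) = i"
      "\<And>i j. i \<in> {a..N - a} \<Longrightarrow> j \<in> {a..N - a} \<Longrightarrow> i \<le> j \<Longrightarrow> leq (h i) (h j)"
    using assms unfolding sym_chain_def by metis
  have "a \<in> {a..N - a}" "N - a \<in> {a..N - a}" "a + (N - a) = N" using h(1) by auto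
  then show ?thesis
    unfolding h(2) using h(3)[of a] h(3)[of "N - a"] h(4)
    by (intro bexI[of _ "h a"] bexI[of _ "h (N - a)"]) auto
qed

lemma chain_decomposition:
  assumes "partitioned (sym_chain leq rk N) P"
  shows "symmetric_chain_decomposition P leq rk N"
proof -
  obtain \<C> where \<C>: "\<Union>\<C> = P" "pairwise disjnt \<C>" "\<And>C. C \<in> \<C> \<Longrightarrow> sym_chain leq rk N C"
    using assms by (auto simp: partitioned_def)
  have "(\<forall>x y. covers_in C leq x y \<longrightarrow> rk y \<le> Suc (rk x)) \<and> is_chain C leq" if C: "C \<in> \<C>" for C
  proof -
    obtain a h where h: "2 * a \<le> N" "C = h ` {a..N - a}" "\<And>i. i \<in> {a..N - a} \<Longrightarrow> rk (h i) = i"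
      "\<And>i j. i \<in> {a..N - a} \<Longrightarrow> j \<in> {a..N - a} \<Longrightarrow> i \<le> j \<Longrightarrow> leq (h i) (h j)"
      using \<C>(3)[OF C] unfolding sym_chain_def by metis
    have "is_chain C leq"
      unfolding is_chain_def h(2) using h(4) by (auto) (meson atLeastAtMost_iff nat_le_linear)
    moreover have "rk y \<le> Suc (rk x)" if xy: "covers_in C leq x y" for x y
    proof -
      obtain i j where ij: "i \<in> {a..N - a}" "j \<in> {a..N - a}" "x = h i" "y = h j"
        using xy unfolding covers_in_def h(2) by auto
      have "j \<le> Suc i"
      proof (rule ccontr)
        assume "\<not> j \<le> Suc i"
        then have m: "Suc i \<in> {a..N - a}" "i < Suc i" "Suc i < j" using ij by auto
        then have "lt_on leq x (h (Suc i))" "lt_on leq (h (Suc i)) y"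
          using h(4)[OF ij(1) m(1)] h(4)[OF m(1) ij(2)] h(3)[OF ij(1)] h(3)[OF m(1)] h(3)[OF ij(2)]
          by (auto simp: lt_on_def ij) (metis n_not_Suc_n)?
        then show False using xy m(1) unfolding covers_in_def h(2) by blast
      qed
      then show ?thesis using h(3) ij by simp
    qed
    ultimately show ?thesis by blast
  qed
  then show ?thesis
    unfolding symmetric_chain_decomposition_def
    using symmetric_decompositionI[OF \<C>(1,2)] sym_chain_top_bottom \<C>(3) by blast
qed

section \<open>Sperner property, rank numbers and the gamma vector\<close>

lemma is_chain_card_le:
  assumes "C \<subseteq> P" "is_chain C leq" "rk ` C \<subseteq> K" "finite K"
  shows "card C \<le> card K"
proof (rule card_inj_on_le)
  show "inj_on rk C"
    using assms(1,2) rk_inj unfolding is_chain_def by (auto simp: inj_on_def) (metis subsetD)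
qed (use assms in auto)

lemma k_family_ranks:
  assumes "card K \<le> k" "finite K"
  shows "k_family P leq k {x \<in> P. rk x \<in> K}"
  unfolding k_family_def
proof (intro conjI notI)
  assume "\<exists>C\<subseteq>{x \<in> P. rk x \<in> K}. is_chain C leq \<and> finite C \<and> card C = k + 1"
  then obtain C where "C \<subseteq> {x \<in> P. rk x \<in> K}" "is_chain C leq" "card C = k + 1" by blast
  then show False using is_chain_card_le[of C K] assms by auto
qed auto

lemma card_ranks:
  assumes "finite K"
  shows "card {x \<in> P. rk x \<in> K} = (\<Sum>i\<in>K. rank_number P rk i)"
proof -
  have "{x \<in> P. rk x \<in> K} = (\<Union>i\<in>K. {x \<in> P. rk x = i})" by auto
  then show ?thesis
    unfolding rank_number_def using assms fin by (simp add: card_UN_disjoint disjoint_iff)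
qed

lemma sym_chain_card:
  assumes "sym_chain leq rk N C"
  obtains a where "2 * a \<le> N" "rk ` C = {a..N - a}" "inj_on rk C" "is_chain C leq"
proof -
  obtain a h where h: "2 * a \<le> N" "C = h ` {a..N - a}" "\<And>i. i \<in> {a..N - a} \<Longrightarrow> rk (h i) = i"
      "\<And>i j. i \<in> {a..N - a} \<Longrightarrow> j \<in> {a..N - a} \<Longrightarrow> i \<le> j \<Longrightarrow> leq (h i) (h j)"
    using assms unfolding sym_chain_def by metis
  have "rk ` C = {a..N - a}" "inj_on rk C" unfolding h(2) inj_on_def image_image using h(3) by auto
  moreover have "is_chain C leq"
    unfolding is_chain_def h(2) using h(4) by (auto) (meson atLeastAtMost_iff nat_le_linear)
  ultimately show ?thesis using h(1) that by blast
qed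

text \<open>A k-family meets a chain \<open>C\<close> of the partition in at most
  \<open>min k (card C)\<close> elements, and the \<open>k\<close> middle ranks attain this bound on
  all symmetric chains at once.\<close>

lemma strongly_Sperner:
  assumes "partitioned (sym_chain leq rk N) P"
  shows "strongly_Sperner P leq rk N"
  unfolding strongly_Sperner_def
proof
  obtain \<C> where \<C>: "\<Union>\<C> = P" "pairwise disjnt \<C>" "\<And>C. C \<in> \<C> \<Longrightarrow> sym_chain leq rk N C"
    using assms by (auto simp: partitioned_def)
  have fin\<C>: "finite \<C>" using \<C>(1) fin finite_UnionD by blast
  have card_split: "card F = (\<Sum>C\<in>\<C>. card (F \<inter> C))" if "F \<subseteq> P" for F
  proof -
    have "F = (\<Union>C\<in>\<C>. F \<inter> C)" using that \<C>(1) by auto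
    moreover have "card (\<Union>C\<in>\<C>. F \<inter> C) = (\<Sum>C\<in>\<C>. card (F \<inter> C))"
      using fin\<C> finite_subset[OF that fin] \<C>(2)
      by (intro card_UN_disjoint) (auto simp: pairwise_def disjnt_def)
    ultimately show ?thesis by simp
  qed
  fix k assume k: "k \<in> {1..N}"
  \<comment> \<open>Of the \<open>N + 1\<close> ranks, \<open>N + 1 - k\<close> stay outside the
    window \<open>{m..<m + k}\<close>, half of them (rounded down) below it.\<close>
  define m where "m = (N + 1 - k) div 2"
  define M where "M = {x \<in> P. rk x \<in> {m..<m + k}}"
  have M: "k_family P leq k M" unfolding M_def by (rule k_family_ranks) auto
  have bound: "card F \<le> card M" if F: "k_family P leq k F" for F
  proof -
    have FP: "F \<subseteq> P" using F by (simp add: k_family_def)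
    have "card (F \<inter> C) \<le> card (M \<inter> C)" if C: "C \<in> \<C>" for C
    proof -
      obtain a where a: "2 * a \<le> N" "rk ` C = {a..N - a}" "inj_on rk C" "is_chain C leq"
        using sym_chain_card[OF \<C>(3)[OF C]] .
      have CP: "C \<subseteq> P" using C \<C>(1) by auto
      have finC: "finite C" using CP fin finite_subset by blast
      have cM: "card (M \<inter> C) = card ({a..N - a} \<inter> {m..<m + k})"
      proof -
        have "rk ` (M \<inter> C) = {a..N - a} \<inter> {m..<m + k}"
          using CP unfolding a(2)[symmetric] M_def by auto
        moreover have "inj_on rk (M \<inter> C)" using a(3) inj_on_subset by blast
        ultimately show ?thesis using card_image by metis
      qed
      have "card (F \<inter> C) \<le> k"
      proof (rule ccontr)
        assume "\<not> ?thesis"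
        then obtain X where X: "X \<subseteq> F \<inter> C" "card X = k + 1" "finite X"
          using obtain_subset_with_card_n[of "k + 1" "F \<inter> C"] by auto
        then have "is_chain X leq" using a(4) unfolding is_chain_def by blast
        then show False using X F unfolding k_family_def by blast
      qed
      moreover have "card (F \<inter> C) \<le> card C" using finC by (intro card_mono) auto
      moreover have "card C = N - a + 1 - a"
        using card_image[OF a(3)] a(2) by simp
      \<comment> \<open>Both intervals of ranks are centred at half of \<open>N\<close> up to
        rounding, so the shorter one lies inside the longer one.\<close>
      moreover have "k \<le> N - a + 1 - a \<and> {a..N - a} \<inter> {m..<m + k} = {m..<m + k} \<or>
          {a..N - a} \<inter> {m..<m + k} = {a..N - a}"
      proof (cases "k \<le> N - a + 1 - a")
        case True
        then have "a \<le> m" "m + k \<le> N - a + 1" using k a(1) unfolding m_def by auto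
        then show ?thesis using True by auto
      next
        case False
        then have "m \<le> a" "N - a < m + k" using k a(1) unfolding m_def by auto
        then show ?thesis by auto
      qed
      ultimately show ?thesis using cM by auto
    qed
    then have "(\<Sum>C\<in>\<C>. card (F \<inter> C)) \<le> (\<Sum>C\<in>\<C>. card (M \<inter> C))" by (rule sum_mono)
    then show ?thesis using card_split[OF FP] card_split[of M] by (simp add: M_def)
  qed
  have 1: "Max {card F | F. k_family P leq k F} = card M"
    using M bound by (intro Max_eqI) (auto intro: finite_subset[of _ "{..card M}"])
  \<comment> \<open>Any \<open>k\<close> ranks together form a k-family, so the bound for families
    also covers sums of rank numbers.\<close>
  have 2: "Max {(\<Sum>i\<in>K. rank_number P rk i) | K. K \<subseteq> {0..N} \<and> card K = k} = card M"
  proof (rule Max_eqI)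
    show "finite {(\<Sum>i\<in>K. rank_number P rk i) | K. K \<subseteq> {0..N} \<and> card K = k}"
      by (rule finite_subset[of _ "(\<lambda>K. \<Sum>i\<in>K. rank_number P rk i) ` Pow {0..N}"]) auto
    show "s \<le> card M" if s: "s \<in> {(\<Sum>i\<in>K. rank_number P rk i) | K. K \<subseteq> {0..N} \<and> card K = k}" for s
    proof -
      obtain K where K: "s = (\<Sum>i\<in>K. rank_number P rk i)" "K \<subseteq> {0..N}" "card K = k" using s by blast
      then have "finite K" using finite_subset by blast
      then show ?thesis using bound[OF k_family_ranks[of K k]] card_ranks K by simp
    qed
    have "{m..<m + k} \<subseteq> {0..N}" using k unfolding m_def by auto
    then show "card M \<in> {(\<Sum>i\<in>K. rank_number P rk i) | K. K \<subseteq> {0..N} \<and> card K = k}"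
      unfolding M_def mem_Collect_eq
      by (intro exI[of _ "{m..<m + k}"] conjI card_ranks finite_atLeastLessThan) simp_all
  qed
  show "k_Sperner P leq rk N k" unfolding k_Sperner_def 1 2 ..
qed

text \<open>A symmetric chain from rank \<open>b C\<close> to rank \<open>N - b C\<close> has
  exactly one element in each rank between them, so a rank number counts chains.\<close>

lemma rank_number_chains:
  assumes "partitioned (sym_chain leq rk N) P"
  shows "\<exists>\<C> (b :: 'a set \<Rightarrow> nat). finite \<C> \<and>
    (\<forall>i\<le>N. rank_number P rk i = card {C \<in> \<C>. b C \<le> i \<and> b C \<le> N - i})"
proof -
  obtain \<C> where \<C>: "\<Union>\<C> = P" "pairwise disjnt \<C>" "\<And>C. C \<in> \<C> \<Longrightarrow> sym_chain leq rk N C"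
    using assms by (auto simp: partitioned_def)
  have fin\<C>: "finite \<C>" using \<C>(1) fin finite_UnionD by blast
  have "\<forall>C. \<exists>a. C \<in> \<C> \<longrightarrow> 2 * a \<le> N \<and> rk ` C = {a..N - a} \<and> inj_on rk C"
    using sym_chain_card \<C>(3) by metis
  then obtain b where b: "\<And>C. C \<in> \<C> \<Longrightarrow> 2 * b C \<le> N \<and> rk ` C = {b C..N - b C} \<and> inj_on rk C"
    by metis
  show ?thesis
  proof (rule exI[of _ \<C>], rule exI[of _ b], rule conjI)
    show "finite \<C>" by fact
    show "\<forall>i\<le>N. rank_number P rk i = card {C \<in> \<C>. b C \<le> i \<and> b C \<le> N - i}"
    proof (intro allI impI)
      fix i assume i: "i \<le> N"
      let ?J = "{C \<in> \<C>. b C \<le> i \<and> b C \<le> N - i}"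
      have iff: "i \<in> {b C..N - b C} \<longleftrightarrow> C \<in> ?J" if "C \<in> \<C>" for C
        using b[OF that] that i by auto
      have "\<forall>C\<in>?J. \<exists>x. x \<in> C \<and> rk x = i"
        using iff b by (metis (no_types, lifting) imageE mem_Collect_eq)
      then obtain x where x: "\<And>C. C \<in> ?J \<Longrightarrow> x C \<in> C \<and> rk (x C) = i" by metis
      have "bij_betw x ?J {p \<in> P. rk p = i}"
        unfolding bij_betw_def
      proof
        show "inj_on x ?J"
          using x \<C>(2) unfolding inj_on_def pairwise_def disjnt_def
          by (metis (no_types, lifting) disjoint_iff mem_Collect_eq)
        have "p \<in> x ` ?J" if p: "p \<in> P" "rk p = i" for p
        proof -
          obtain C where C: "C \<in> \<C>" "p \<in> C" using p \<C>(1) by auto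
          have "i \<in> rk ` C" using C p by blast
          then have "C \<in> ?J" using iff[OF C(1)] b[OF C(1)] by metis
          have "p = x C"
            using x[OF \<open>C \<in> ?J\<close>] b[OF C(1)] C p by (metis inj_onD)
          with \<open>C \<in> ?J\<close> show ?thesis by blast
        qed
        moreover have "x C \<in> P \<and> rk (x C) = i" if "C \<in> ?J" for C
          using x[OF that] that \<C>(1) by blast
        ultimately show "x ` ?J = {p \<in> P. rk p = i}" by blast
      qed
      from bij_betw_same_card[OF this] show "rank_number P rk i = card ?J"
        unfolding rank_number_def by (rule sym)
    qed
  qed
qed

text \<open>The chain count treats \<open>i\<close> and \<open>N - i\<close> alike and grows with
  \<open>min i (N - i)\<close>.\<close>

lemma symmetric_unimodal:
  assumes "partitioned (sym_chain leq rk N) P"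
  shows "symmetric_seq (rank_number P rk) N" "unimodal_seq (rank_number P rk) N"
proof -
  obtain \<C> and b :: "'a set \<Rightarrow> nat" where b: "finite \<C>"
    "\<forall>i\<le>N. rank_number P rk i = card {C \<in> \<C>. b C \<le> i \<and> b C \<le> N - i}"
    using rank_number_chains[OF assms] by (elim exE conjE)
  show "symmetric_seq (rank_number P rk) N"
    unfolding symmetric_seq_def using b(2) by (auto simp: conj_commute)
  have le: "rank_number P rk i \<le> rank_number P rk j" if "i \<le> N" "j \<le> N" "min i (N - i) \<le> min j (N - j)" for i j
    unfolding b(2)[rule_format, OF that(1)] b(2)[rule_format, OF that(2)] using b(1) that(3)
    by (intro card_mono) auto
  show "unimodal_seq (rank_number P rk) N"
    unfolding unimodal_seq_def
  proof (rule exI[of _ "N div 2"], intro conjI allI impI)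
    show "rank_number P rk i \<le> rank_number P rk j" if "i \<le> j \<and> j \<le> N div 2" for i j
    proof (rule le)
      have "i \<le> j" "j \<le> N - j" using that by auto
      then show "min i (N - i) \<le> min j (N - j)" by simp
    qed (use that in auto)
    show "rank_number P rk j \<le> rank_number P rk i" if "N div 2 \<le> i \<and> i \<le> j \<and> j \<le> N" for i j
    proof (rule le)
      have "N - j \<le> i \<or> i = j" "N - j \<le> N - i" using that by auto
      then show "min j (N - j) \<le> min i (N - i)" by auto
    qed (use that in auto)
  qed simp
qed

lemma cube_rank_polynomial:
  assumes "sym_cube leq rk N D"
  obtains j where "j \<le> N div 2" "finite D"
    "(\<Sum>x\<in>D. monom (1::int) (rk x)) = monom 1 j * [:1, 1:] ^ (N - 2 * j)"
proof -
  obtain k f where f: "D = f ` Pow {..<k}"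
      "\<And>A B. A \<subseteq> {..<k} \<Longrightarrow> B \<subseteq> {..<k} \<Longrightarrow> leq (f A) (f B) \<longleftrightarrow> A \<subseteq> B"
      "\<And>A. A \<subseteq> {..<k} \<Longrightarrow> rk (f A) = rk (f {}) + card A" "2 * rk (f {}) + k = N"
    using assms unfolding sym_cube_def by metis
  have inj: "inj_on f (Pow {..<k})"
    using f(2) by (auto simp: inj_on_def) (metis subset_eq)+
  \<comment> \<open>The product of \<open>k\<close> factors t + 1 is expanded over the sets of
    factors that contribute t.\<close>
  have binom: "(\<Sum>A\<in>Pow {..<k}. monom (1::int) (card A)) = [:1, 1:] ^ k" for k
  proof -
    have "(\<Sum>A\<in>Pow {..<k}. monom (1::int) (card A)) = (\<Sum>A\<in>Pow {..<k}. (\<Prod>i\<in>A. monom 1 1) * (\<Prod>i\<in>{..<k} - A. 1))"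
      by (simp add: monom_power)
    also have "\<dots> = (\<Prod>i<k. monom 1 1 + 1)" by (rule prod_add[symmetric]) simp
    also have "\<dots> = [:1, 1:] ^ k" by (simp add: monom_altdef one_pCons)
    finally show ?thesis .
  qed
  have "(\<Sum>x\<in>D. monom (1::int) (rk x)) = (\<Sum>A\<in>Pow {..<k}. monom 1 (rk (f A)))"
    unfolding f(1) by (simp add: sum.reindex[OF inj])
  also have "\<dots> = (\<Sum>A\<in>Pow {..<k}. monom 1 (rk (f {})) * monom 1 (card A))"
  proof (rule sum.cong)
    fix A assume "A \<in> Pow {..<k}"
    then have "rk (f A) = rk (f {}) + card A" using f(3) by blast
    then show "monom 1 (rk (f A)) = monom (1::int) (rk (f {})) * monom 1 (card A)"
      by (simp only: mult_monom) simp
  qed simp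
  also have "\<dots> = monom 1 (rk (f {})) * [:1, 1:] ^ k"
    by (simp add: sum_distrib_left[symmetric] binom)
  finally have "(\<Sum>x\<in>D. monom (1::int) (rk x)) = monom 1 (rk (f {})) * [:1, 1:] ^ (N - 2 * rk (f {}))"
    using f(4) by auto
  then show ?thesis using that[of "rk (f {})"] f(1,4) by auto
qed

text \<open>The coefficient \<open>\<gamma> j\<close> is the number of cubes whose bottom has rank
  \<open>j\<close>, since each of them contributes t^j (1+t)^(N-2j) to the rank polynomial.\<close>

lemma gamma_nonneg:
  assumes "sbd leq rk N P" and rk_le: "\<And>x. x \<in> P \<Longrightarrow> rk x \<le> N"
  shows "gamma_nonneg (rank_number P rk) N"
proof -
  obtain \<D> where \<D>: "\<Union>\<D> = P" "pairwise disjnt \<D>" "\<And>D. D \<in> \<D> \<Longrightarrow> sym_cube leq rk N D"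
    using assms by (auto simp: partitioned_def)
  have fin\<D>: "finite \<D>" using \<D>(1) fin finite_UnionD by blast
  have "\<forall>D. \<exists>j. D \<in> \<D> \<longrightarrow> j \<le> N div 2 \<and> finite D \<and>
    (\<Sum>x\<in>D. monom (1::int) (rk x)) = monom 1 j * [:1, 1:] ^ (N - 2 * j)"
    using cube_rank_polynomial \<D>(3) by metis
  then obtain j where j: "\<And>D. D \<in> \<D> \<Longrightarrow> j D \<le> N div 2 \<and> finite D \<and>
    (\<Sum>x\<in>D. monom (1::int) (rk x)) = monom 1 (j D) * [:1, 1:] ^ (N - 2 * j D)"
    by metis
  define \<gamma> where "\<gamma> i = int (card {D \<in> \<D>. j D = i})" for i
  let ?q = "\<lambda>i. monom (1::int) i * [:1, 1:] ^ (N - 2 * i)"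
  have "(\<Sum>k\<le>N. monom (int (rank_number P rk k)) k) = (\<Sum>k\<le>N. \<Sum>x\<in>{x \<in> P. rk x = k}. monom 1 (rk x))"
    by (intro sum.cong) (auto simp: rank_number_def of_nat_poly smult_monom mult.commute)
  also have "\<dots> = (\<Sum>x\<in>P. monom 1 (rk x))"
    using rk_le fin by (intro sum.group) auto
  also have "\<dots> = (\<Sum>D\<in>\<D>. \<Sum>x\<in>D. monom 1 (rk x))"
    unfolding \<D>(1)[symmetric] using j \<D>(2) by (subst sum.Union_disjoint) (auto simp: pairwise_def disjnt_def)
  also have "\<dots> = (\<Sum>D\<in>\<D>. ?q (j D))" using j by (intro sum.cong) auto
  also have "\<dots> = (\<Sum>i\<le>N div 2. \<Sum>D\<in>{D \<in> \<D>. j D = i}. ?q (j D))"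
    using j fin\<D> by (intro sum.group[symmetric]) auto
  also have "\<dots> = (\<Sum>i\<le>N div 2. smult (\<gamma> i) (?q i))"
    by (intro sum.cong) (auto simp: \<gamma>_def of_nat_poly)
  finally show ?thesis
    unfolding gamma_nonneg_def by (intro exI[of _ \<gamma>]) (auto simp: \<gamma>_def)
qed

end

section \<open>Monomial operators\<close>

text \<open>The pair \<open>(i, z)\<close> stands for the vector \<open>z e\<^sub>i\<close>, and a monomial matrix acts on these pairs.
  The group operation is written additively, so \<open>u + v\<close> is the (non-commutative) product \<open>u v\<close>.\<close>

definition scl :: "complex \<Rightarrow> nat \<times> complex \<Rightarrow> nat \<times> complex" where
  "scl c p = (fst p, c * snd p)"

lemma fst_scl [simp]: "fst (scl c p) = fst p"
  and snd_scl [simp]: "snd (scl c p) = c * snd p"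
  and scl_scl [simp]: "scl c (scl d p) = scl (c * d) p"
  and scl_one [simp]: "scl 1 p = p"
  and scl_Pair: "scl c (i, z) = (i, c * z)"
  by (auto simp: scl_def)

lemma pt_eq_scl: "p = scl (snd p) (fst p, 1)"
  by (simp add: scl_def)

text \<open>The type fixes neither the dimension nor the order of the scalars, so it contains the
  dilations of a single axis, which lie outside G(d,d,n). Finite support keeps the codimension of
  the fixed space finite. Compatibility with \<open>scl 0\<close> makes the zero points
  \<open>(i, 0)\<close> follow their axis.\<close>

typedef mperm = "{f :: nat \<times> complex \<Rightarrow> nat \<times> complex. bij f \<and>
    (\<forall>c p. f (scl c p) = scl c (f p)) \<and> finite {i. f (i, 1) \<noteq> (i, 1)}}"
  morphisms app Mperm
  by (rule exI[of _ id]) (auto)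

setup_lifting type_definition_mperm

lemma app_scl [simp]: "app w (scl c p) = scl c (app w p)"
  using app[of w] by blast

lemma bij_app: "bij (app w)"
  using app[of w] by auto

lemma finite_app: "finite {i. app w (i, 1) \<noteq> (i, 1)}"
  using app[of w] by auto

lemma app_eq_iff [simp]: "app w p = app w q \<longleftrightarrow> p = q"
  using bij_app[of w] by (metis bij_pointE)

lemma inv_scale:
  assumes "bij f" "\<forall>c p. f (scl c p) = scl c (f p)"
  shows "inv_into UNIV f (scl c p) = scl c (inv_into UNIV f p)"
  using assms by (metis bij_inv_eq_iff)

lemma app_eq_scl: "app w p = scl (snd p) (app w (fst p, 1))"
  by (metis app_scl pt_eq_scl)

instantiation mperm :: group_add
begin

lift_definition zero_mperm :: mperm is id by auto

lift_definition plus_mperm :: "mperm \<Rightarrow> mperm \<Rightarrow> mperm" is "(\<circ>)"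
proof (intro conjI allI)
  fix f g :: "nat \<times> complex \<Rightarrow> nat \<times> complex"
  assume f: "bij f \<and> (\<forall>c p. f (scl c p) = scl c (f p)) \<and> finite {i. f (i, 1) \<noteq> (i, 1)}"
    and g: "bij g \<and> (\<forall>c p. g (scl c p) = scl c (g p)) \<and> finite {i. g (i, 1) \<noteq> (i, 1)}"
  show "bij (f \<circ> g)" using f g by (simp add: bij_comp)
  show "(f \<circ> g) (scl c p) = scl c ((f \<circ> g) p)" for c p using f g by (metis comp_apply)
  have "{i. (f \<circ> g) (i, 1) \<noteq> (i, 1)} \<subseteq> {i. f (i, 1) \<noteq> (i, 1)} \<union> {i. g (i, 1) \<noteq> (i, 1)}"
    by auto
  then show "finite {i. (f \<circ> g) (i, 1) \<noteq> (i, 1)}"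
    by (rule finite_subset) (use f g in simp)
qed

lift_definition uminus_mperm :: "mperm \<Rightarrow> mperm" is "inv_into UNIV"
proof (intro conjI allI)
  fix f :: "nat \<times> complex \<Rightarrow> nat \<times> complex"
  assume f: "bij f \<and> (\<forall>c p. f (scl c p) = scl c (f p)) \<and> finite {i. f (i, 1) \<noteq> (i, 1)}"
  show "bij (inv_into UNIV f)" using f by (simp add: bij_imp_bij_inv)
  show "inv_into UNIV f (scl c p) = scl c (inv_into UNIV f p)" for c p using f inv_scale by blast
  have "{i. inv_into UNIV f (i, 1) \<noteq> (i, 1)} = {i. f (i, 1) \<noteq> (i, 1)}"
    using f by (metis bij_inv_eq_iff)
  then show "finite {i. inv_into UNIV f (i, 1) \<noteq> (i, 1)}"
    using f by simp
qed

definition minus_mperm :: "mperm \<Rightarrow> mperm \<Rightarrow> mperm" where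
  "minus_mperm u v = u + - v"

instance
proof
  fix a b c :: mperm
  show "a + b + c = a + (b + c)" by transfer (simp add: o_assoc)
  show "0 + a = a" "a + 0 = a" by (transfer, simp)+
  show "- a + a = 0" by transfer (auto simp: bij_def)
  show "a + - b = a - b" by (simp add: minus_mperm_def)
qed

end

lemma app_plus [simp]: "app (u + v) p = app u (app v p)"
  by transfer simp

lemma app_zero [simp]: "app 0 p = p"
  by transfer simp

lemma app_uminus_cancel [simp]: "app (- u) (app u p) = p" "app u (app (- u) p) = p"
  by (metis app_plus app_zero left_minus, metis app_plus app_zero right_minus)

lemma app_uminus_eq_iff: "app (- u) p = q \<longleftrightarrow> p = app u q"
  by (metis app_uminus_cancel)

lemma mperm_eqI: "u = v" if "\<And>i. app u (i, 1) = app v (i, 1)"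
proof -
  have "app u = app v"
    using that app_eq_scl by (metis ext)
  then show ?thesis by (simp add: app_inject)
qed

lemma snd_app_nonzero: "snd (app w p) \<noteq> 0 \<longleftrightarrow> snd p \<noteq> 0"
proof -
  have "snd (app w p) = 0 \<longleftrightarrow> app w p = scl 0 (app w p)"
    by (metis mult_zero_left prod.collapse scl_Pair snd_conv)
  also have "\<dots> \<longleftrightarrow> p = scl 0 p" by (metis app_eq_iff app_scl)
  also have "\<dots> \<longleftrightarrow> snd p = 0"
    by (metis mult_zero_left prod.collapse scl_Pair snd_conv)
  finally show ?thesis by simp
qed

lemma fst_app: "fst (app w p) = fst (app w (fst p, 1))"
  by (subst app_eq_scl) simp

lemma fst_app_eq_iff: "fst (app w p) = fst (app w q) \<longleftrightarrow> fst p = fst q"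
proof
  assume "fst (app w p) = fst (app w q)"
  then have *: "fst (app w (fst p, 1)) = fst (app w (fst q, 1))"
    using fst_app by metis
  \<comment> \<open>Multiplying each image by the scalar of the other one makes both images equal,
    and injectivity then compares the arguments.\<close>
  define a b where "a = snd (app w (fst p, 1))" and "b = snd (app w (fst q, 1))"
  have "a \<noteq> 0" "b \<noteq> 0" unfolding a_def b_def by (auto simp: snd_app_nonzero)
  have "app w (scl b (fst p, 1)) = app w (scl a (fst q, 1))"
    using * by (simp only: app_scl) (simp add: prod_eq_iff a_def b_def)
  then show "fst p = fst q" by (metis app_eq_iff fst_conv fst_scl)
next
  assume "fst p = fst q" then show "fst (app w p) = fst (app w q)" using fst_app by metis
qed

lemma app_fixes_scale: "app w p = p" if "app w q = q" "snd q \<noteq> 0" "fst p = fst q"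
proof -
  have "p = scl (snd p / snd q) q" using that by (simp add: prod_eq_iff)
  then show ?thesis using that by (metis app_scl)
qed

section \<open>The codimension of the fixed space\<close>

text \<open>Here \<open>x\<close> is a covector, and its value is taken at the vector that the pair
  \<open>p\<close> stands for.\<close>

definition ev :: "(nat \<Rightarrow> complex) \<Rightarrow> nat \<times> complex \<Rightarrow> complex" where
  "ev x p = snd p * x (fst p)"

lemma ev_scl [simp]: "ev x (scl c p) = c * ev x p"
  by (simp add: ev_def)

lemma ev_add: "ev (\<lambda>i. x i + c * y i) p = ev x p + c * ev y p"
  by (simp add: ev_def algebra_simps)

text \<open>Fixed vectors are taken in the dual space, where invariance is preservation of the values
  \<open>ev x\<close> at all points.\<close>

definition Fix :: "mperm \<Rightarrow> (nat \<Rightarrow> complex) set" where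
  "Fix w = {x. \<forall>p. ev x (app w p) = ev x p}"

lemma ev_app: "ev x (app w p) = snd p * ev x (app w (fst p, 1))"
  by (subst app_eq_scl) simp

lemma FixI: "x \<in> Fix w" if "\<And>i. ev x (app w (i, 1)) = x i"
proof -
  have "ev x (app w p) = ev x p" for p
    using that[of "fst p"] by (subst ev_app) (simp add: ev_def)
  then show ?thesis by (simp add: Fix_def)
qed

lemma FixD: "x \<in> Fix w \<Longrightarrow> ev x (app w p) = ev x p"
  unfolding Fix_def by blast

lemma Fix_add_scaled: "x \<in> Fix w \<Longrightarrow> y \<in> Fix w \<Longrightarrow> (\<lambda>i. x i + c * y i) \<in> Fix w"
  by (simp add: Fix_def ev_add)

lemma Fix_zero [simp]: "Fix 0 = UNIV"
  by (simp add: Fix_def)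

lemma Fix_plus: "x \<in> Fix u \<Longrightarrow> x \<in> Fix v \<Longrightarrow> x \<in> Fix (u + v)"
  by (auto intro!: FixI simp: FixD) (simp add: ev_def)

lemma Fix_uminus [simp]: "Fix (- u) = Fix u"
proof -
  have "x \<in> Fix (- u)" if "x \<in> Fix u" for x u
    using FixD[OF that, of "app (- u) p" for p] by (simp add: Fix_def)
  from this[of _ u] this[of _ "- u"] show ?thesis by auto
qed

definition lin :: "((nat \<Rightarrow> complex) \<Rightarrow> complex) \<Rightarrow> bool" where
  "lin \<phi> \<longleftrightarrow> (\<forall>x y c. \<phi> (\<lambda>i. x i + c * y i) = \<phi> x + c * \<phi> y)"

text \<open>The least length of such a list is the codimension of \<open>S\<close> if
  \<open>S\<close> is a subspace of finite codimension. Counting functionals gives a codimension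
  inside the infinite-dimensional space of all covectors.\<close>

definition cuts :: "((nat \<Rightarrow> complex) \<Rightarrow> complex) list \<Rightarrow> (nat \<Rightarrow> complex) set \<Rightarrow> bool" where
  "cuts \<phi>s S \<longleftrightarrow> (\<forall>\<phi>\<in>set \<phi>s. lin \<phi>) \<and> (\<forall>x. (\<forall>\<phi>\<in>set \<phi>s. \<phi> x = 0) \<longrightarrow> x \<in> S)"

definition codim :: "(nat \<Rightarrow> complex) set \<Rightarrow> nat" where
  "codim S = (LEAST k. \<exists>\<phi>s. length \<phi>s = k \<and> cuts \<phi>s S)"

lemma codim_le: "cuts \<phi>s S \<Longrightarrow> codim S \<le> length \<phi>s"
  unfolding codim_def by (rule Least_le) blast

lemma codim_witness:
  assumes "cuts \<phi>s S"
  obtains \<psi>s where "cuts \<psi>s S" "length \<psi>s = codim S"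
proof -
  have "\<exists>\<psi>s. length \<psi>s = codim S \<and> cuts \<psi>s S"
    unfolding codim_def by (rule LeastI) (use assms in blast)
  then show ?thesis using that by blast
qed

text \<open>One step of Gaussian elimination. The functional \<open>\<phi>\<close> is dropped, and a
  multiple of it is subtracted from each of the others so that they vanish at \<open>x\<close>.
  Their common kernel then consists of vectors of \<open>S\<close> plus multiples of
  \<open>x\<close>.\<close>

lemma cuts_eliminate:
  assumes "cuts \<phi>s S" "\<phi> \<in> set \<phi>s" "\<phi> x \<noteq> 0"
    and T: "\<And>y c. y \<in> S \<Longrightarrow> (\<lambda>i. y i + c * x i) \<in> T"
  obtains \<psi>s where "cuts \<psi>s T" "length \<psi>s < length \<phi>s"
proof -
  have lin: "lin \<psi>" if "\<psi> \<in> set \<phi>s" for \<psi> using assms(1) that by (auto simp: cuts_def)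
  define f where "f \<psi> = (\<lambda>y. \<psi> y - \<psi> x / \<phi> x * \<phi> y)" for \<psi> :: "(nat \<Rightarrow> complex) \<Rightarrow> complex"
  define \<psi>s where "\<psi>s = map f (remove1 \<phi> \<phi>s)"
  have "lin (f \<psi>)" if "\<psi> \<in> set \<phi>s" for \<psi>
    using lin[OF that] lin[OF assms(2)] unfolding lin_def f_def
    by (simp add: algebra_simps)
  then have 1: "\<forall>\<psi>\<in>set \<psi>s. lin \<psi>"
    using set_remove1_subset[of \<phi> \<phi>s] by (auto simp: \<psi>s_def)
  have "y \<in> T" if y: "\<forall>\<psi>\<in>set \<psi>s. \<psi> y = 0" for y
  proof -
    define z where "z = (\<lambda>i. y i + (- (\<phi> y / \<phi> x)) * x i)"
    have "\<psi> z = 0" if \<psi>: "\<psi> \<in> set \<phi>s" for \<psi>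
    proof -
      have *: "\<psi> z = \<psi> y + (- (\<phi> y / \<phi> x)) * \<psi> x"
        using lin[OF \<psi>] unfolding lin_def z_def by blast
      show ?thesis
      proof (cases "\<psi> = \<phi>")
        case True then show ?thesis using * assms(3) by simp
      next
        case False
        then have "f \<psi> y = 0" using y \<psi> by (auto simp: \<psi>s_def)
        then show ?thesis using * by (simp add: f_def)
      qed
    qed
    then have "z \<in> S" using assms(1) by (auto simp: cuts_def)
    from T[OF this, of "\<phi> y / \<phi> x"] show ?thesis by (simp add: z_def)
  qed
  then have "cuts \<psi>s T" using 1 by (auto simp: cuts_def)
  moreover have "length \<psi>s < length \<phi>s"
    using assms(2) length_pos_if_in_set[OF assms(2)] by (simp add: \<psi>s_def length_remove1)
  ultimately show ?thesis using that by blast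
qed

lemma cuts_Fix: "\<exists>\<phi>s. cuts \<phi>s (Fix w)"
proof -
  obtain js where js: "set js = {i. app w (i, 1) \<noteq> (i, 1)}"
    using finite_app finite_list by blast
  have "cuts (map (\<lambda>i x. ev x (app w (i, 1)) - x i) js) (Fix w)"
    unfolding cuts_def
  proof (intro conjI allI impI)
    show "\<forall>\<phi>\<in>set (map (\<lambda>i x. ev x (app w (i, 1)) - x i) js). lin \<phi>"
      by (auto simp: lin_def ev_def algebra_simps)
    fix x assume "\<forall>\<phi>\<in>set (map (\<lambda>i x. ev x (app w (i, 1)) - x i) js). \<phi> x = 0"
    then have "ev x (app w (i, 1)) = x i" if "app w (i, 1) \<noteq> (i, 1)" for i
      using that js by auto
    then have "ev x (app w (i, 1)) = x i" for i
      by (cases "app w (i, 1) = (i, 1)") (auto simp: ev_def)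
    then show "x \<in> Fix w" by (rule FixI)
  qed
  then show ?thesis by blast
qed

definition len :: "mperm \<Rightarrow> nat" where
  "len w = codim (Fix w)"

lemma len_witness:
  obtains \<phi>s where "cuts \<phi>s (Fix w)" "length \<phi>s = len w"
  using cuts_Fix codim_witness unfolding len_def by metis

lemma len_le: "cuts \<phi>s (Fix w) \<Longrightarrow> len w \<le> length \<phi>s"
  unfolding len_def by (rule codim_le)

text \<open>Eliminating with \<open>x\<close> shortens an optimal list for \<open>Fix v\<close>.
  What it cuts out consists of sums of a vector in \<open>Fix v\<close> and a multiple of
  \<open>x\<close>, and these lie in \<open>Fix u\<close>.\<close>

lemma len_less:
  assumes "x \<notin> Fix v" "x \<in> Fix u" "Fix v \<subseteq> Fix u"
  shows "len u < len v"
proof -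
  obtain \<phi>s where \<phi>s: "cuts \<phi>s (Fix v)" "length \<phi>s = len v" by (rule len_witness)
  then obtain \<phi> where "\<phi> \<in> set \<phi>s" "\<phi> x \<noteq> 0" using assms(1) by (auto simp: cuts_def)
  then obtain \<psi>s where "cuts \<psi>s (Fix u)" "length \<psi>s < length \<phi>s"
    using cuts_eliminate[OF \<phi>s(1), of \<phi> x "Fix u"] assms Fix_add_scaled by blast
  then show ?thesis using len_le \<phi>s by fastforce
qed

lemma len_zero [simp]: "len 0 = 0"
  using len_le[of "[]" 0] by (simp add: cuts_def)

lemma len_uminus [simp]: "len (- w) = len w"
  by (simp add: len_def)

lemma cuts_append: "cuts \<phi>s (Fix u) \<Longrightarrow> cuts \<psi>s (Fix v) \<Longrightarrow> cuts (\<phi>s @ \<psi>s) (Fix (u + v))"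
  unfolding cuts_def using Fix_plus by auto

lemma len_plus_le: "len (u + v) \<le> len u + len v"
  by (rule len_witness[of u], rule len_witness[of v]) (metis cuts_append len_le length_append)

lemma Fix_eq_UNIV: "Fix w = UNIV \<Longrightarrow> w = 0"
proof (rule mperm_eqI)
  fix i assume "Fix w = UNIV"
  then have *: "ev x (app w (i, 1)) = x i" for x
    using FixD[of x w "(i, 1)"] by (auto simp: ev_def)
  from *[of "\<lambda>j. if j = i then 1 else 0"] have "app w (i, 1) = (i, 1)"
    by (auto simp: ev_def prod_eq_iff split: if_splits)
  then show "app w (i, 1) = app 0 (i, 1)" by simp
qed

lemma len_eq_0 [simp]: "len w = 0 \<longleftrightarrow> w = 0"
proof
  assume *: "len w = 0"
  obtain \<phi>s where "cuts \<phi>s (Fix w)" "length \<phi>s = len w" by (rule len_witness)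
  with * have "Fix w = UNIV" by (auto simp: cuts_def)
  then show "w = 0" by (rule Fix_eq_UNIV)
qed simp

lemma len_conj: "len (- u + w + u) = len w"
proof -
  have "len (- u + w + u) \<le> len w" for u w
  proof -
    obtain \<phi>s where \<phi>s: "cuts \<phi>s (Fix w)" "length \<phi>s = len w" by (rule len_witness)
    \<comment> \<open>\<open>t x\<close> is the covector \<open>x\<close> composed with the inverse
      of \<open>u\<close>; it carries functionals for \<open>Fix w\<close> to functionals for the
      conjugate.\<close>
    define t where "t x = (\<lambda>i. ev x (app (- u) (i, 1)))" for x
    have ev_t: "ev (t x) p = ev x (app (- u) p)" for x p
      by (subst ev_app) (simp add: t_def ev_def[of "t x"] ev_def[of "\<lambda>i. ev x (app (- u) (i, 1))"])
    have "cuts (map (\<lambda>\<phi> x. \<phi> (t x)) \<phi>s) (Fix (- u + w + u))"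
      unfolding cuts_def
    proof (intro conjI allI impI)
      have "t (\<lambda>i. x i + c * y i) = (\<lambda>i. t x i + c * t y i)" for x y c
        by (simp add: t_def ev_add)
      then show "\<forall>\<psi>\<in>set (map (\<lambda>\<phi> x. \<phi> (t x)) \<phi>s). lin \<psi>"
        using \<phi>s(1) by (auto simp: cuts_def lin_def)
      fix x assume "\<forall>\<psi>\<in>set (map (\<lambda>\<phi> x. \<phi> (t x)) \<phi>s). \<psi> x = 0"
      then have "t x \<in> Fix w" using \<phi>s(1) by (auto simp: cuts_def)
      then have "ev (t x) (app w (app u p)) = ev (t x) (app u p)" for p by (rule FixD)
      then show "x \<in> Fix (- u + w + u)" using ev_t[of x] by (simp add: Fix_def)
    qed
    then show ?thesis using len_le \<phi>s(2) by fastforce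
  qed
  from this[of u w] this[of "- u" "- u + w + u"] show ?thesis
    by (simp add: add.assoc)
qed

lemma len_plus_commute: "len (u + v) = len (v + u)"
  using len_conj[of u "u + v"] by (simp add: add.assoc)

text \<open>The absolute order for codimension, taken in the group of all monomial operators.
  \<open>abs_le_below\<close> relates it to the order of G(d,d,n).\<close>

definition le :: "mperm \<Rightarrow> mperm \<Rightarrow> bool" where
  "le u v \<longleftrightarrow> len v = len u + len (- u + v)"

text \<open>Optimal lists for \<open>w\<close> and \<open>- w + c\<close> concatenate to a list for
  \<open>c\<close>, and \<open>le w c\<close> says that this list is optimal as well. A vector of
  \<open>Fix c\<close> outside \<open>Fix w\<close> would allow one more elimination.\<close>

lemma Fix_subset: 
  assumes "le w c" shows "Fix c \<subseteq> Fix w"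
proof
  fix x assume x: "x \<in> Fix c"
  obtain \<phi>s where \<phi>s: "cuts \<phi>s (Fix w)" "length \<phi>s = len w" by (rule len_witness)
  obtain \<psi>s where \<psi>s: "cuts \<psi>s (Fix (- w + c))" "length \<psi>s = len (- w + c)" by (rule len_witness)
  have *: "cuts (\<phi>s @ \<psi>s) (Fix c)" using cuts_append[OF \<phi>s(1) \<psi>s(1)] by (simp add: add.assoc[symmetric])
  show "x \<in> Fix w"
  proof (rule ccontr)
    assume "x \<notin> Fix w"
    then obtain \<phi> where "\<phi> \<in> set \<phi>s" "\<phi> x \<noteq> 0" using \<phi>s(1) by (auto simp: cuts_def)
    then obtain \<chi>s where "cuts \<chi>s (Fix c)" "length \<chi>s < length (\<phi>s @ \<psi>s)"
      using cuts_eliminate[OF *, of \<phi> x "Fix c"] x Fix_add_scaled by auto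
    then show False using len_le \<phi>s(2) \<psi>s(2) assms by (fastforce simp: le_def)
  qed
qed

section \<open>Reflections and cycles\<close>

declare add_uminus_conv_diff [simp del]

text \<open>\<open>rfl p q\<close> swaps \<open>p\<close> and \<open>q\<close> if they lie on different axes, and it is the diagonal map taking \<open>p\<close> to \<open>q\<close>
  if they lie on the same axis. If one of the scalars is \<open>0\<close>, it is the identity.\<close>

lift_definition rfl :: "nat \<times> complex \<Rightarrow> nat \<times> complex \<Rightarrow> mperm" is
  "\<lambda>p q r. if snd p = 0 \<or> snd q = 0 then r
     else if fst r = fst p then (fst q, snd r * snd q / snd p)
     else if fst r = fst q then (fst p, snd r * snd p / snd q) else r"
proof (intro conjI allI)
  fix p q :: "nat \<times> complex"
  define f where "f p q r = (if snd p = 0 \<or> snd q = 0 then r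
     else if fst r = fst p then (fst q, snd r * snd q / snd p)
     else if fst r = fst q then (fst p, snd r * snd p / snd q) else r)" 
    for p q r :: "nat \<times> complex"
  have "f q p (f p q r) = r" for p q r
    by (auto simp: f_def prod_eq_iff)
  then show "bij (\<lambda>r. if snd p = 0 \<or> snd q = 0 then r
     else if fst r = fst p then (fst q, snd r * snd q / snd p)
     else if fst r = fst q then (fst p, snd r * snd p / snd q) else r)"
    unfolding f_def[symmetric] by (intro o_bij[of "f q p"]) (simp_all add: fun_eq_iff)
  show "f p q (scl c r) = scl c (f p q r)" for c r
    by (auto simp: f_def scl_def)
  have "{i. f p q (i, 1) \<noteq> (i, 1)} \<subseteq> {fst p, fst q}"
    by (auto simp: f_def)
  then show "finite {i. f p q (i, 1) \<noteq> (i, 1)}"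
    by (rule finite_subset) simp
qed

lemma app_rfl: "snd p \<noteq> 0 \<Longrightarrow> snd q \<noteq> 0 \<Longrightarrow> app (rfl p q) r =
    (if fst r = fst p then (fst q, snd r * snd q / snd p)
     else if fst r = fst q then (fst p, snd r * snd p / snd q) else r)"
  by transfer auto

lemma app_rfl_left [simp]: "snd p \<noteq> 0 \<Longrightarrow> snd q \<noteq> 0 \<Longrightarrow> app (rfl p q) p = q"
  by (simp add: app_rfl)

lemma app_rfl_right [simp]:
  "snd p \<noteq> 0 \<Longrightarrow> snd q \<noteq> 0 \<Longrightarrow> fst p \<noteq> fst q \<Longrightarrow> app (rfl p q) q = p"
  by (simp add: app_rfl)

lemma app_rfl_other [simp]: "fst r \<noteq> fst p \<Longrightarrow> fst r \<noteq> fst q \<Longrightarrow> app (rfl p q) r = r"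
  by transfer auto

lemma rfl_same [simp]: "rfl p p = 0"
  by (rule mperm_eqI) (transfer, auto)

lemma uminus_rfl: "- rfl p q = rfl q p"
proof -
  have "rfl q p + rfl p q = 0"
    by (rule mperm_eqI, simp, transfer) (auto simp: prod_eq_iff)
  then show ?thesis by (metis minus_unique minus_minus)
qed

lemma rfl_commute: "fst p \<noteq> fst q \<Longrightarrow> rfl p q = rfl q p"
  by (rule mperm_eqI) (transfer, auto)

lemma rfl_rfl [simp]: "fst p \<noteq> fst q \<Longrightarrow> rfl p q + rfl p q = 0"
  by (metis rfl_commute left_minus uminus_rfl)

lemma uminus_rfl_swap: "fst p \<noteq> fst q \<Longrightarrow> - rfl p q = rfl p q"
  by (metis rfl_commute uminus_rfl)

lemma rfl_scl: "c \<noteq> 0 \<Longrightarrow> rfl (scl c p) (scl c q) = rfl p q"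
  by (rule mperm_eqI, transfer) auto

lemma rfl_conj: "u + rfl p q = rfl (app u p) (app u q) + u"
proof (cases "snd p = 0 \<or> snd q = 0")
  case True
  have "rfl p q = 0" "rfl (app u p) (app u q) = 0"
    using True snd_app_nonzero[of u p] snd_app_nonzero[of u q]
    by (auto intro!: mperm_eqI) (transfer, auto)+
  then show ?thesis by simp
next
  case False
  then have nz: "snd p \<noteq> 0" "snd q \<noteq> 0" "snd (app u p) \<noteq> 0" "snd (app u q) \<noteq> 0"
    by (auto simp: snd_app_nonzero)
  show ?thesis
  proof (rule mperm_eqI)
    fix i :: nat
    let ?r = "(i, 1 :: complex)"
    consider "i = fst p" | "i = fst q" "i \<noteq> fst p" | "i \<noteq> fst p" "i \<noteq> fst q" by auto
    then show "app (u + rfl p q) ?r = app (rfl (app u p) (app u q) + u) ?r"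
    proof cases
      case 1
      then have "?r = scl (1 / snd p) p" using nz by (simp add: prod_eq_iff)
      then show ?thesis using nz by simp
    next
      case 2
      then have "?r = scl (1 / snd q) q" using nz by (simp add: prod_eq_iff)
      moreover have "fst p \<noteq> fst q" "fst (app u p) \<noteq> fst (app u q)"
        using 2 by (auto simp: fst_app_eq_iff)
      ultimately show ?thesis using nz by simp
    next
      case 3
      then have "fst (app u ?r) \<noteq> fst (app u p)" "fst (app u ?r) \<noteq> fst (app u q)"
        by (simp_all add: fst_app_eq_iff)
      then show ?thesis using 3 by simp
    qed
  qed
qed

lemma Fix_rfl: "ev x p = ev x q \<Longrightarrow> x \<in> Fix (rfl p q)"
proof (rule FixI)
  fix i assume *: "ev x p = ev x q"
  show "ev x (app (rfl p q) (i, 1)) = x i"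
  proof (cases "snd p = 0 \<or> snd q = 0")
    case True
    then have "app (rfl p q) (i, 1) = (i, 1)" by transfer auto
    then show ?thesis by (simp add: ev_def)
  next
    case False
    then show ?thesis using * by (auto simp: app_rfl ev_def field_simps)
  qed
qed

lemma len_rfl_le: "len (rfl p q) \<le> 1"
proof -
  have "cuts [\<lambda>x. ev x p - ev x q] (Fix (rfl p q))"
    by (auto simp: cuts_def lin_def ev_def Fix_rfl algebra_simps)
  then show ?thesis using len_le by fastforce
qed

definition coord :: "nat \<times> complex \<Rightarrow> nat \<Rightarrow> complex" where
  "coord p i = (if i = fst p then 1 else 0)"

lemma Fix_coord:
  assumes "app w p = p" "snd p \<noteq> 0"
  shows "coord p \<in> Fix w"
proof (rule FixI)
  fix i
  show "ev (coord p) (app w (i, 1)) = coord p i"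
  proof (cases "i = fst p")
    case True
    then show ?thesis using app_fixes_scale[OF assms, of "(i, 1)"] by (simp add: ev_def coord_def)
  next
    case False
    then have "fst (app w (i, 1)) \<noteq> fst p"
      using fst_app_eq_iff[of w "(i, 1)" p] assms(1) by simp
    then show ?thesis using False by (simp add: ev_def coord_def)
  qed
qed

text \<open>A vector fixed by \<open>rfl p q + w\<close> takes the same value at \<open>p\<close> and \<open>q\<close>, so it is fixed by
  both factors, whereas the coordinate vector of \<open>p\<close> is fixed by \<open>w\<close> only.\<close>

lemma len_rfl_plus:
  assumes "app w p = p" "q \<noteq> p" "snd p \<noteq> 0" "snd q \<noteq> 0"
  shows "len (rfl p q + w) = Suc (len w)"
proof -
  let ?v = "rfl p q + w"
  have "Fix ?v \<subseteq> Fix w"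
  proof
    fix x assume x: "x \<in> Fix ?v"
    have "ev x p = ev x q" using FixD[OF x, of p] assms by simp
    then have "x \<in> Fix (- rfl p q)" by (simp add: Fix_rfl)
    from Fix_plus[OF this x] show "x \<in> Fix w" by (simp add: add.assoc[symmetric])
  qed
  moreover have "coord p \<in> Fix w" using Fix_coord assms by blast
  moreover have "coord p \<notin> Fix ?v"
  proof
    assume y: "coord p \<in> Fix ?v"
    have "ev (coord p) q = ev (coord p) p" using FixD[OF y, of p] assms by simp
    then have "q = p" using assms by (auto simp: ev_def coord_def prod_eq_iff split: if_splits)
    then show False using assms by simp
  qed
  ultimately have "len w < len ?v" by (intro len_less)
  moreover have "len ?v \<le> 1 + len w"
    using len_plus_le[of "rfl p q" w] len_rfl_le[of p q] by linarith
  ultimately show ?thesis by simp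
qed

lemma len_rfl: "p \<noteq> q \<Longrightarrow> snd p \<noteq> 0 \<Longrightarrow> snd q \<noteq> 0 \<Longrightarrow> len (rfl p q) = 1"
  using len_rfl_plus[of 0 p q] by simp

text \<open>The coordinate covector of \<open>p\<close> is fixed by \<open>c\<close>, hence by
  \<open>w\<close>. Its value at \<open>app w p\<close> then determines both the axis and the scalar
  of that point.\<close>

lemma le_fixes:
  assumes "le w c" "app c p = p" "snd p \<noteq> 0"
  shows "app w p = p"
proof -
  have "coord p \<in> Fix w"
    using Fix_coord[OF assms(2,3)] Fix_subset[OF assms(1)] by auto
  from FixD[OF this, of p] assms(3) show ?thesis
    by (auto simp: ev_def coord_def prod_eq_iff split: if_splits)
qed

definition below :: "mperm \<Rightarrow> mperm set" where
  "below c = {w. le w c}"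

text \<open>Deletes \<open>p\<close> from its cycle: the factor that carries \<open>p\<close> to its
  image is stripped off on the left, and the remainder fixes \<open>p\<close>.\<close>

definition peel :: "nat \<times> complex \<Rightarrow> mperm \<Rightarrow> mperm" where
  "peel p c = - rfl p (app c p) + c"

lemma le_zero [simp]: "le 0 c" and le_self [simp]: "le c c"
  by (simp_all add: le_def)

text \<open>Since \<open>w\<close> fixes \<open>p\<close>, moving \<open>- w\<close> past the
  stripped reflection gives another reflection that moves \<open>p\<close>. By
  \<open>len_rfl_plus\<close> the lengths of \<open>c\<close> and of \<open>- w + c\<close>
  therefore drop by the same 1.\<close>

lemma le_peel_iff:
  assumes "app w p = p" "snd p \<noteq> 0"
  shows "le w (peel p c) \<longleftrightarrow> le w c"
proof (cases "app c p = p")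
  case True
  then show ?thesis by (simp add: peel_def)
next
  case False
  let ?q = "app c p"
  have nz: "snd ?q \<noteq> 0" using assms(2) by (simp add: snd_app_nonzero)
  have pc: "app (peel p c) p = p"
    using assms nz by (simp add: peel_def app_uminus_eq_iff)
  have c: "c = rfl p ?q + peel p c" by (simp add: peel_def add.assoc[symmetric])
  have 1: "len c = Suc (len (peel p c))"
    by (subst c) (use len_rfl_plus[OF pc False assms(2) nz] in simp)
  have wp: "app (- w) p = p" using assms(1) by (simp add: app_uminus_eq_iff)
  have "- w + c = (- w + rfl p ?q) + peel p c" by (subst c) (simp add: add.assoc)
  also have "- w + rfl p ?q = rfl p (app (- w) ?q) + - w"
    using rfl_conj[of "- w" p ?q] wp by simp
  finally have "- w + c = rfl p (app (- w) ?q) + (- w + peel p c)" by (simp add: add.assoc)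
  moreover have "app (- w + peel p c) p = p" using pc wp by simp
  moreover have "app (- w) ?q \<noteq> p" using False assms(1) by (metis app_uminus_eq_iff)
  ultimately have "len (- w + c) = Suc (len (- w + peel p c))"
    using len_rfl_plus assms(2) nz by (metis snd_app_nonzero)
  then show ?thesis using 1 by (simp add: le_def)
qed

lemma app_peel: "snd p \<noteq> 0 \<Longrightarrow> app (peel p c) p = p"
  by (simp add: peel_def app_uminus_eq_iff snd_app_nonzero)

lemma below_fixing:
  assumes "snd p \<noteq> 0"
  shows "{w \<in> below c. app w p = p} = below (peel p c)"
  using le_peel_iff[OF _ assms] le_fixes[OF _ app_peel[OF assms] assms]
  by (auto simp: below_def)

text \<open>An element taking \<open>p\<close> to \<open>q\<close> is \<open>rfl p q + v\<close>
  with \<open>v\<close> fixing \<open>p\<close>, and its length is one more than that of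
  \<open>v\<close>. Subadditivity then makes \<open>le (rfl p q + v) c\<close> equivalent to two
  separate conditions: the reflection shortens \<open>c\<close>, and \<open>v\<close> lies below the
  quotient. The elements there that fix \<open>p\<close> are described by
  \<open>below_fixing\<close>.\<close>

lemma below_moving:
  assumes "q \<noteq> p" "snd p \<noteq> 0" "snd q \<noteq> 0"
  shows "{w \<in> below c. app w p = q} =
    (if Suc (len (- rfl p q + c)) = len c
     then (+) (rfl p q) ` below (peel p (- rfl p q + c)) else {})"
proof -
  let ?c = "- rfl p q + c"
  have *: "le (rfl p q + v) c \<longleftrightarrow> Suc (len ?c) = len c \<and> le v ?c" if v: "app v p = p" for v
  proof -
    have 1: "len (rfl p q + v) = Suc (len v)" by (rule len_rfl_plus) (use v assms in auto)
    have 2: "- (rfl p q + v) + c = - v + ?c" by (simp add: minus_add add.assoc)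
    have 3: "len ?c \<le> len v + len (- v + ?c)"
      using len_plus_le[of v "- v + ?c"] by (simp add: add.assoc[symmetric])
    have 4: "len c \<le> Suc (len ?c)"
      using len_plus_le[of "rfl p q" ?c] len_rfl_le[of p q] by (simp add: add.assoc[symmetric])
    show ?thesis unfolding le_def 1 2 using 3 4 by auto
  qed
  have fix_iff: "le v (peel p ?c) \<longleftrightarrow> app v p = p \<and> le v ?c" for v
    using below_fixing[OF assms(2), of ?c] by (auto simp: below_def)
  have "w \<in> below c \<and> app w p = q \<longleftrightarrow>
    (Suc (len ?c) = len c \<and> (\<exists>v. le v (peel p ?c) \<and> w = rfl p q + v))" (is "?l \<longleftrightarrow> ?r") for w
  proof
    assume l: ?l
    define v where "v = - rfl p q + w"
    have w: "w = rfl p q + v" by (simp add: v_def add.assoc[symmetric])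
    have v: "app v p = p" using l assms by (simp add: v_def app_uminus_eq_iff)
    show ?r using l *[OF v] v unfolding fix_iff below_def w by auto
  next
    assume r: ?r
    then obtain v where v: "le v (peel p ?c)" "w = rfl p q + v" by blast
    then show ?l using r * fix_iff assms unfolding below_def by auto
  qed
  then show ?thesis by (auto simp: below_def)
qed

section \<open>Coloured cycles as products of reflections\<close>

definition pts :: "(nat \<times> complex) list \<Rightarrow> bool" where
  "pts ps \<longleftrightarrow> distinct (map fst ps) \<and> (\<forall>p\<in>set ps. snd p \<noteq> 0)"

lemma pts_simps [simp]: "pts []" "pts (p # ps) \<longleftrightarrow> fst p \<notin> fst ` set ps \<and> snd p \<noteq> 0 \<and> pts ps"
  by (auto simp: pts_def)

lemma pts_append: "pts (xs @ ys) \<longleftrightarrow> pts xs \<and> pts ys \<and> fst ` set xs \<inter> fst ` set ys = {}"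
  by (auto simp: pts_def)

text \<open>\<open>cyc \<eta> [p\<^sub>1, \<dots>, p\<^sub>k]\<close> takes each \<open>p\<^sub>i\<close> to \<open>p\<^bsub>i+1\<^esub>\<close> and \<open>p\<^sub>k\<close> to \<open>\<eta> p\<^sub>1\<close>.\<close>

fun cyc :: "complex \<Rightarrow> (nat \<times> complex) list \<Rightarrow> mperm" where
  "cyc \<eta> [] = 0"
| "cyc \<eta> [p] = rfl p (scl \<eta> p)"
| "cyc \<eta> (p # q # ps) = rfl p q + cyc \<eta> (q # ps)"

definition fixes_all :: "mperm \<Rightarrow> (nat \<times> complex) list \<Rightarrow> bool" where
  "fixes_all c ps \<longleftrightarrow> (\<forall>p\<in>set ps. app c p = p)"

lemma fixes_all_simps [simp]: "fixes_all c []"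
  "fixes_all c (p # ps) \<longleftrightarrow> app c p = p \<and> fixes_all c ps"
  "fixes_all 0 ps"
  by (auto simp: fixes_all_def)

lemma app_cyc_other: "fst r \<notin> fst ` set ps \<Longrightarrow> app (cyc \<eta> ps) r = r"
  by (induction \<eta> ps rule: cyc.induct) auto

text \<open>Each reflection in the definition of \<open>cyc\<close> moves a point that everything to
  its right fixes, so it adds one to the length. The last one is the identity exactly for
  \<open>\<eta> = 1\<close>.\<close>

lemma len_cyc_plus:
  "pts ps \<Longrightarrow> \<eta> \<noteq> 0 \<Longrightarrow> fixes_all c ps \<Longrightarrow>
    len (cyc \<eta> ps + c) = length ps - (if \<eta> = 1 then 1 else 0) + len c"
proof (induction \<eta> ps rule: cyc.induct)
  case (2 \<eta> p)
  show ?case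
  proof (cases "\<eta> = 1")
    case False
    then have "scl \<eta> p \<noteq> p" using 2 by (auto simp: prod_eq_iff)
    then show ?thesis using 2 False len_rfl_plus[of c p "scl \<eta> p"] by simp
  qed simp
next
  case (3 \<eta> p q ps)
  have "app (cyc \<eta> (q # ps) + c) p = p"
    using 3 app_cyc_other[of p "q # ps"] by simp
  moreover have "q \<noteq> p" using 3 by auto
  ultimately have "len (rfl p q + (cyc \<eta> (q # ps) + c)) = Suc (len (cyc \<eta> (q # ps) + c))"
    using 3 by (intro len_rfl_plus) auto
  then show ?case using 3 by (simp add: add.assoc)
qed simp

lemma rfl_dilate: "snd p \<noteq> 0 \<Longrightarrow> snd q \<noteq> 0 \<Longrightarrow> fst p \<noteq> fst q \<Longrightarrow> \<zeta> \<noteq> 0 \<Longrightarrow>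
    rfl p q + rfl q (scl \<zeta> q) = rfl p (scl \<zeta> p) + rfl p q"
  using rfl_conj[of "rfl p q" q "scl \<zeta> q"] by simp

text \<open>The colour sits in a dilation at the last point. By \<open>rfl_dilate\<close> a part of
  it can be carried back along the cycle to the first point.\<close>

lemma cyc_scale:
  "pts (p # ps) \<Longrightarrow> \<eta> \<noteq> 0 \<Longrightarrow> \<zeta> \<noteq> 0 \<Longrightarrow>
    cyc (\<eta> * \<zeta>) (p # ps) = rfl p (scl \<zeta> p) + cyc \<eta> (p # ps)"
proof (induction ps arbitrary: p)
  case Nil
  then show ?case by (intro mperm_eqI) (auto simp: app_rfl)
next
  case (Cons q ps)
  have "cyc (\<eta> * \<zeta>) (p # q # ps) = rfl p q + rfl q (scl \<zeta> q) + cyc \<eta> (q # ps)"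
    using Cons by (simp add: add.assoc)
  also have "\<dots> = rfl p (scl \<zeta> p) + cyc \<eta> (p # q # ps)"
    using Cons.prems by (simp add: rfl_dilate add.assoc)
  finally show ?case .
qed

text \<open>A reflection joining two axes of a cycle cuts the cycle there. The scalar
  \<open>\<zeta>\<close> decides how the colour \<open>\<eta>\<close> is distributed over the two
  arcs; the product of their colours is always \<open>\<eta>\<close>.\<close>

lemma cyc_split:
  "pts (x # xs @ y # ys) \<Longrightarrow> \<eta> \<noteq> 0 \<Longrightarrow> \<zeta> \<noteq> 0 \<Longrightarrow>
    rfl x (scl \<zeta> y) + (cyc (1 / \<zeta>) (x # xs) + cyc (\<eta> * \<zeta>) (y # ys)) = cyc \<eta> (x # xs @ y # ys)"
proof (induction xs arbitrary: x)
  case Nil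
  have "rfl x (scl \<zeta> y) + rfl x (scl (1 / \<zeta>) x) + rfl y (scl \<zeta> y) = rfl x y"
    using Nil by (intro mperm_eqI) (auto simp: app_rfl)
  then show ?case using Nil by (simp add: cyc_scale add.assoc[symmetric] del: cyc.simps(3)) simp
next
  case (Cons x' xs)
  have "rfl x (scl \<zeta> y) + rfl x x' = rfl x x' + rfl x' (scl \<zeta> y)"
    using rfl_conj[of "rfl x x'" x' "scl \<zeta> y"] Cons.prems by auto
  moreover have "rfl x' (scl \<zeta> y) + (cyc (1 / \<zeta>) (x' # xs) + cyc (\<eta> * \<zeta>) (y # ys)) = cyc \<eta> (x' # xs @ y # ys)"
    using Cons by auto
  ultimately show ?case by (simp add: add.assoc[symmetric]) (simp add: add.assoc)
qed

lemma peel_cyc: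
  assumes "pts (p # ps)" "\<eta> \<noteq> 0" "app c p = p"
  shows "peel p (cyc \<eta> (p # ps) + c) = cyc \<eta> ps + c"
proof (cases ps)
  case Nil
  then show ?thesis using assms by (simp add: peel_def add.assoc[symmetric])
next
  case (Cons q qs)
  have "app (cyc \<eta> (p # ps) + c) p = q"
    using assms app_cyc_other[of p "q # qs" \<eta>] by (simp add: Cons)
  then show ?thesis by (simp add: peel_def Cons add.assoc[symmetric])
qed

section \<open>Intervals below balanced cycles\<close>

lemma dual_of_pts:
  "pts ps \<Longrightarrow> \<exists>x. (\<forall>p\<in>set ps. ev x p = 1) \<and> (\<forall>i. i \<notin> fst ` set ps \<longrightarrow> x i = 0)"
proof (induction ps)
  case (Cons p ps)
  then obtain x where x: "\<forall>p\<in>set ps. ev x p = 1" "\<forall>i. i \<notin> fst ` set ps \<longrightarrow> x i = 0"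
    by auto
  let ?x = "x(fst p := 1 / snd p)"
  have "ev ?x q = 1" if "q \<in> set ps" for q
  proof -
    have "fst q \<noteq> fst p" using that Cons.prems by (metis pts_simps(2) imageI)
    then have "ev ?x q = ev x q" by (simp add: ev_def)
    then show ?thesis using x(1) that by simp
  qed
  moreover have "ev ?x p = 1" using Cons.prems by (simp add: ev_def)
  moreover have "?x i = 0" if "i \<notin> fst ` set (p # ps)" for i using x(2) that by simp
  ultimately show ?case by (intro exI[of _ ?x]) (simp del: fun_upd_apply)
qed auto

lemma Fix_cyc: "\<forall>p\<in>set ps. ev x p = 1 \<Longrightarrow> x \<in> Fix (cyc 1 ps)"
proof (induction "1 :: complex" ps rule: cyc.induct)
  case (3 p q ps)
  then show ?case by (auto intro!: Fix_plus Fix_rfl)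
qed auto

text \<open>The covector with value 1 on all points of \<open>ps\<close> and 0 on the other axes is
  fixed by the balanced cycle and by \<open>c\<close>, hence by every \<open>w\<close> below. Value
  1 at \<open>app w p\<close> leaves only the points of \<open>ps\<close>, with their exact
  scalars.\<close>

lemma below_cyc_moves_within:
  assumes "pts ps" "fixes_all c ps" "w \<in> below (cyc 1 ps + c)" "p \<in> set ps"
  shows "app w p \<in> set ps"
proof -
  obtain x where x: "\<And>p. p \<in> set ps \<Longrightarrow> ev x p = 1" "\<And>i. i \<notin> fst ` set ps \<Longrightarrow> x i = 0"
    using dual_of_pts[OF assms(1)] by metis
  have "x \<in> Fix c"
  proof (rule FixI)
    fix i
    show "ev x (app c (i, 1)) = x i"
    proof (cases "i \<in> fst ` set ps")
      case True
      then obtain q where q: "q \<in> set ps" "i = fst q" by auto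
      then have "app c (i, 1) = (i, 1)"
      proof -
        have "app c q = q" "snd q \<noteq> 0" using q(1) assms(1,2) by (auto simp: fixes_all_def pts_def)
        then show ?thesis using app_fixes_scale q(2) by simp
      qed
      then show ?thesis by (simp add: ev_def)
    next
      case False
      have "fst (app c (i, 1)) \<noteq> fst q" if "q \<in> set ps" for q
      proof -
        have "app c q = q" "i \<noteq> fst q" using that False assms(2) by (auto simp: fixes_all_def)
        then show ?thesis using fst_app_eq_iff[of c "(i, 1)" q] by simp
      qed
      then have "fst (app c (i, 1)) \<notin> fst ` set ps" by auto
      then show ?thesis using False x(2) by (simp add: ev_def)
    qed
  qed
  then have "x \<in> Fix (cyc 1 ps + c)" using x(1) by (intro Fix_plus Fix_cyc) auto
  moreover have "le w (cyc 1 ps + c)" using assms(3) by (simp add: below_def)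
  ultimately have "x \<in> Fix w" using Fix_subset by blast
  then have 1: "ev x (app w p) = 1" using FixD[of x w p] x(1)[OF assms(4)] by simp
  have "fst (app w p) \<in> fst ` set ps"
  proof (rule ccontr)
    assume "fst (app w p) \<notin> fst ` set ps"
    then show False using 1 x(2) by (simp add: ev_def)
  qed
  then obtain q where q: "q \<in> set ps" "fst (app w p) = fst q" by auto
  have xq: "snd q * x (fst q) = 1" using x(1)[OF q(1)] by (simp add: ev_def)
  moreover have "snd (app w p) * x (fst q) = 1" using 1 q(2) by (simp add: ev_def)
  ultimately have "snd (app w p) = snd q" by (metis mult_cancel_right mult_zero_right zero_neq_one)
  then have "app w p = q" using q(2) by (simp add: prod_eq_iff)
  then show ?thesis using q(1) by simp
qed

lemma below_zero [simp]: "below 0 = {0}"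
  by (auto simp: below_def le_def)

lemma fixes_all_plus [simp]: "fixes_all u ps \<Longrightarrow> fixes_all v ps \<Longrightarrow> fixes_all (u + v) ps"
  by (auto simp: fixes_all_def)

lemma fixes_all_cyc: "fst ` set ps \<inter> fst ` set qs = {} \<Longrightarrow> fixes_all (cyc \<eta> qs) ps"
  unfolding fixes_all_def by (auto intro!: app_cyc_other)

lemma fixes_all_append [simp]: "fixes_all c (xs @ ys) \<longleftrightarrow> fixes_all c xs \<and> fixes_all c ys"
  by (auto simp: fixes_all_def)

lemma rfl_plus_cyc:
  assumes "pts (p # xs @ y # ys)" "\<eta> \<noteq> 0" "\<zeta> \<noteq> 0"
  shows "- rfl p (scl \<zeta> y) + (cyc \<eta> (p # xs @ y # ys) + c) =
    cyc (1 / \<zeta>) (p # xs) + (cyc (\<eta> * \<zeta>) (y # ys) + c)"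
  by (subst cyc_split[symmetric, OF assms]) (simp add: add.assoc[symmetric])

lemma below_cyc_fixing:
  assumes "pts (p # ps)" "app c p = p" "\<eta> \<noteq> 0"
  shows "{w \<in> below (cyc \<eta> (p # ps) + c). app w p = p} = below (cyc \<eta> ps + c)"
  using below_fixing[of p "cyc \<eta> (p # ps) + c"] peel_cyc[of p ps \<eta> c] assms by simp

text \<open>The reflection cuts the cycle into arcs of colours \<open>1 / \<zeta>\<close> and
  \<open>\<eta> * \<zeta>\<close>. A balanced cycle is one shorter in length than an unbalanced one,
  so comparing lengths shows that the reflection lies below exactly if one arc is balanced (both, if
  \<open>\<eta> = 1\<close>). Peeling then deletes \<open>p\<close> from its arc.\<close>

lemma below_cyc_moving:
  assumes "pts (p # xs @ y # ys)" "fixes_all c (p # xs @ y # ys)" "\<eta> \<noteq> 0" "\<zeta> \<noteq> 0"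
  shows "{w \<in> below (cyc \<eta> (p # xs @ y # ys) + c). app w p = scl \<zeta> y} =
    (if \<zeta> = 1 \<or> \<eta> * \<zeta> = 1
     then (+) (rfl p (scl \<zeta> y)) ` below (cyc (1 / \<zeta>) xs + (cyc (\<eta> * \<zeta>) (y # ys) + c)) else {})"
proof -
  let ?c = "cyc \<eta> (p # xs @ y # ys) + c"
  have p1: "pts (p # xs)" and p2: "pts (y # ys)" and disj: "fst ` set (p # xs) \<inter> fst ` set (y # ys) = {}"
    using assms(1) pts_append[of "p # xs" "y # ys"] by auto
  have split: "- rfl p (scl \<zeta> y) + ?c = cyc (1 / \<zeta>) (p # xs) + (cyc (\<eta> * \<zeta>) (y # ys) + c)"
    by (rule rfl_plus_cyc) (use assms in auto)
  have 1: "len ?c = Suc (Suc (length xs + length ys)) - (if \<eta> = 1 then 1 else 0) + len c"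
    using len_cyc_plus[OF assms(1,3,2)] by simp
  have fx: "fixes_all (cyc (\<eta> * \<zeta>) (y # ys) + c) (p # xs)"
    using disj assms(2) by (intro fixes_all_plus fixes_all_cyc) auto
  have 2: "len (- rfl p (scl \<zeta> y) + ?c) = Suc (length xs) - (if \<zeta> = 1 then 1 else 0) +
      (Suc (length ys) - (if \<eta> * \<zeta> = 1 then 1 else 0) + len c)"
    unfolding split using p1 p2 fx assms by (simp add: len_cyc_plus del: cyc.simps)
  have drop: "Suc (len (- rfl p (scl \<zeta> y) + ?c)) = len ?c \<longleftrightarrow> \<zeta> = 1 \<or> \<eta> * \<zeta> = 1"
    unfolding 1 2 by auto
  have "peel p (- rfl p (scl \<zeta> y) + ?c) = cyc (1 / \<zeta>) xs + (cyc (\<eta> * \<zeta>) (y # ys) + c)"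
    unfolding split by (rule peel_cyc) (use p1 fx assms in auto)
  moreover have "scl \<zeta> y \<noteq> p" "snd p \<noteq> 0" "snd (scl \<zeta> y) \<noteq> 0" using assms p2 by auto
  ultimately show ?thesis using below_moving[of "scl \<zeta> y" p ?c] drop by simp
qed

text \<open>A dilation of \<open>p\<close> leaves a cycle of colour \<open>\<eta> / \<zeta>\<close>,
  and the length drops only if that cycle is balanced.\<close>

lemma below_cyc_scaling:
  assumes "pts (p # ps)" "fixes_all c (p # ps)" "\<eta> \<noteq> 0" "\<zeta> \<noteq> 0" "\<zeta> \<noteq> 1"
  shows "{w \<in> below (cyc \<eta> (p # ps) + c). app w p = scl \<zeta> p} =
    (if \<zeta> = \<eta> then (+) (rfl p (scl \<eta> p)) ` below (cyc 1 ps + c) else {})"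
proof -
  let ?c = "cyc \<eta> (p # ps) + c"
  have "cyc \<eta> (p # ps) = rfl p (scl \<zeta> p) + cyc (\<eta> / \<zeta>) (p # ps)"
    using cyc_scale[of p ps "\<eta> / \<zeta>" \<zeta>] assms by simp
  then have split: "- rfl p (scl \<zeta> p) + ?c = cyc (\<eta> / \<zeta>) (p # ps) + c"
    by (simp only: add.assoc[symmetric]) (simp del: cyc.simps)
  have drop: "Suc (len (- rfl p (scl \<zeta> p) + ?c)) = len ?c \<longleftrightarrow> \<zeta> = \<eta>"
    unfolding split using assms by (simp add: len_cyc_plus del: cyc.simps)
  have "peel p (- rfl p (scl \<zeta> p) + ?c) = cyc (\<eta> / \<zeta>) ps + c"
    unfolding split by (rule peel_cyc) (use assms in auto)
  moreover have "scl \<zeta> p \<noteq> p" "snd p \<noteq> 0" "snd (scl \<zeta> p) \<noteq> 0" using assms by (auto simp: prod_eq_iff)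
  ultimately show ?thesis using below_moving[of "scl \<zeta> p" p ?c] drop assms(3) by (cases "\<zeta> = \<eta>") simp_all
qed

lemma below_cyc_moving_nth:
  assumes "pts (p # ps)" "fixes_all c (p # ps)" "k < length ps"
  shows "{w \<in> below (cyc 1 (p # ps) + c). app w p = ps ! k} =
    (+) (rfl p (ps ! k)) ` below (cyc 1 (take k ps) + (cyc 1 (drop k ps) + c))"
  using below_cyc_moving[of p "take k ps" "ps ! k" "drop (Suc k) ps" c 1 1] assms
  by (simp add: Cons_nth_drop_Suc del: pts_simps fixes_all_simps cyc.simps)

text \<open>The Catalan recursion for noncrossing partitions: the image of \<open>p\<close>
  separates the remaining points into two arcs.\<close>

lemma below_cyc_Cons:
  assumes "pts (p # ps)" "fixes_all c (p # ps)"
  shows "below (cyc 1 (p # ps) + c) = below (cyc 1 ps + c) \<union>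
    (\<Union>k<length ps. (+) (rfl p (ps ! k)) ` below (cyc 1 (take k ps) + (cyc 1 (drop k ps) + c)))"
proof -
  let ?I = "below (cyc 1 (p # ps) + c)"
  have "app w p = p \<or> (\<exists>k<length ps. app w p = ps ! k)" if "w \<in> ?I" for w
    using below_cyc_moves_within[OF assms that, of p] by (auto simp: in_set_conv_nth)
  then have "?I = {w \<in> ?I. app w p = p} \<union> (\<Union>k<length ps. {w \<in> ?I. app w p = ps ! k})"
    by blast
  also have "(\<Union>k<length ps. {w \<in> ?I. app w p = ps ! k}) =
    (\<Union>k<length ps. (+) (rfl p (ps ! k)) ` below (cyc 1 (take k ps) + (cyc 1 (drop k ps) + c)))"
    using below_cyc_moving_nth[OF assms] by (intro SUP_cong) auto
  finally show ?thesis using below_cyc_fixing[of p ps c 1] assms by simp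
qed

lemma image_plus_set_plus: "(+) a ` ((A :: mperm set) + B) = (+) a ` A + B"
  by (force simp: set_plus_def image_iff add.assoc)

lemma UN_set_plus: "(\<Union>i\<in>I. F i) + (B :: mperm set) = (\<Union>i\<in>I. F i + B)"
  and Un_set_plus: "(A \<union> A') + B = (A + B) \<union> (A' + B)"
  by (auto simp: set_plus_def)

text \<open>Both sides obey the same recursion on the image of the first point, and the arcs in it
  are shorter cycles. Balance is essential: below \<open>cyc \<omega> ps + E\<close> there are
  elements that move points of \<open>ps\<close> to the axis of \<open>E\<close>, as
  \<open>F_e\<close> shows.\<close>

lemma below_cyc_plus:
  "pts ps \<Longrightarrow> fixes_all c ps \<Longrightarrow> below (cyc 1 ps + c) = below (cyc 1 ps) + below c"
proof (induction ps arbitrary: c rule: length_induct)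
  case (1 ps)
  show ?case
  proof (cases ps)
    case Nil
    then show ?thesis by (simp add: set_plus_def)
  next
    case (Cons p qs)
    have IH: "below (cyc 1 rs + c) = below (cyc 1 rs) + below c"
      if "length rs < length ps" "pts rs" "fixes_all c rs" for rs c
      using 1 that by blast
    have tail: "below (cyc 1 qs + c) = below (cyc 1 qs) + below c"
      using 1 Cons by (intro IH) auto
    have part: "below (cyc 1 (take k qs) + (cyc 1 (drop k qs) + c)) =
        below (cyc 1 (take k qs) + cyc 1 (drop k qs)) + below c" for k
    proof -
      have qs: "pts (take k qs @ drop k qs)" "fixes_all c (take k qs @ drop k qs)"
        using 1(2,3) Cons by auto
      then have pts: "pts (take k qs)" "pts (drop k qs)" "fst ` set (take k qs) \<inter> fst ` set (drop k qs) = {}"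
          "fixes_all c (take k qs)" "fixes_all c (drop k qs)"
        unfolding pts_append fixes_all_append by auto
      have "fixes_all (cyc 1 (drop k qs)) (take k qs)" using pts by (intro fixes_all_cyc) auto
      then show ?thesis
        using IH[of "take k qs"] IH[of "drop k qs"] pts Cons by (simp add: add.assoc)
    qed
    have "below (cyc 1 ps + c) = below (cyc 1 qs + c) \<union>
      (\<Union>k<length qs. (+) (rfl p (qs ! k)) ` below (cyc 1 (take k qs) + (cyc 1 (drop k qs) + c)))"
      using below_cyc_Cons[of p qs c] 1(2,3) unfolding Cons by blast
    also have "\<dots> = (below (cyc 1 qs) \<union>
      (\<Union>k<length qs. (+) (rfl p (qs ! k)) ` below (cyc 1 (take k qs) + cyc 1 (drop k qs)))) + below c"
      unfolding part tail image_plus_set_plus UN_set_plus Un_set_plus ..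
    also have "\<dots> = below (cyc 1 ps) + below c"
      using below_cyc_Cons[of p qs 0] 1(2) unfolding Cons
      by (simp only: add_0_right fixes_all_simps app_zero simp_thms)
    finally show ?thesis .
  qed
qed

section \<open>Cube partitions of intervals\<close>

lemma app_uminus_fixed: "app w p = p \<Longrightarrow> app (- w) p = p"
  by (simp add: app_uminus_eq_iff)

text \<open>Induction on the number of axes moved by \<open>z\<close>. Peeling a moved point off
  \<open>z\<close> takes away one reflection and shrinks the support, and \<open>x\<close> fixes the
  peeled point, so \<open>len_rfl_plus\<close> applies with and without \<open>x\<close>.\<close>

lemma len_plus_disjoint:
  "(\<And>i. app z (i, 1) \<noteq> (i, 1) \<Longrightarrow> app x (i, 1) = (i, 1)) \<Longrightarrow> len (z + x) = len z + len x"
proof (induction "card {i. app z (i, 1) \<noteq> (i, 1)}" arbitrary: z rule: less_induct)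
  case less
  show ?case
  proof (cases "z = 0")
    case False
    then obtain i where i: "app z (i, 1) \<noteq> (i, 1)" using mperm_eqI[of z 0] by auto
    define p where "p = (i, 1 :: complex)"
    define q where "q = app z p"
    have pq: "q \<noteq> p" "snd p \<noteq> 0" "snd q \<noteq> 0"
      using i by (simp_all add: p_def q_def snd_app_nonzero)
    define z' where "z' = peel p z"
    have z: "z = rfl p q + z'" by (simp add: z'_def peel_def q_def add.assoc[symmetric])
    have z'p: "app z' p = p" using pq by (simp add: z'_def app_peel)
    have fixed: "app z' (j, 1) = (j, 1)" if "app z (j, 1) = (j, 1)" for j
    proof -
      have "j \<noteq> fst p" using that i by (auto simp: p_def)
      moreover have "j \<noteq> fst q"
        using fst_app_eq_iff[of z p "(j, 1)"] that \<open>j \<noteq> fst p\<close> by (auto simp: q_def)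
      ultimately have "app (rfl p q) (j, 1) = (j, 1)" by simp
      then show ?thesis
        using that unfolding z'_def peel_def q_def[symmetric] by (simp add: app_uminus_eq_iff)
    qed
    have sub: "{j. app z' (j, 1) \<noteq> (j, 1)} \<subset> {j. app z (j, 1) \<noteq> (j, 1)}"
      using fixed i z'p by (auto simp: p_def)
    have "len (z' + x) = len z' + len x"
    proof (rule less.hyps)
      show "card {j. app z' (j, 1) \<noteq> (j, 1)} < card {j. app z (j, 1) \<noteq> (j, 1)}"
        using sub by (rule psubset_card_mono[OF finite_app])
    qed (use fixed less.prems in blast)
    moreover have "app (z' + x) p = p"
      using z'p less.prems[OF i] by (simp add: p_def)
    then have "len (rfl p q + (z' + x)) = Suc (len (z' + x))" using pq by (intro len_rfl_plus)
    moreover have "len (rfl p q + z') = Suc (len z')" using z'p pq by (intro len_rfl_plus)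
    ultimately show ?thesis unfolding z by (simp add: add.assoc)
  qed simp
qed

lemma plus_commute_disjoint:
  assumes "\<And>i. app u (i, 1) = (i, 1) \<or> app v (i, 1) = (i, 1)"
  shows "u + v = v + u"
proof -
  have *: "app v (app u (i, 1)) = app u (i, 1)"
    if "app u (i, 1) \<noteq> (i, 1)" and uv: "\<And>i. app u (i, 1) = (i, 1) \<or> app v (i, 1) = (i, 1)" for u v i
  proof -
    obtain j z where jz: "app u (i, 1) = (j, z)" by fastforce
    show ?thesis
    proof (cases "app v (j, 1) = (j, 1)")
      case True
      then show ?thesis using app_fixes_scale[of v "(j, 1)" "(j, z)"] jz by simp
    next
      case False
      then have "app u (j, 1) = (j, 1)" using uv by blast
      then have "i = j" using fst_app_eq_iff[of u "(i, 1)" "(j, 1)"] jz by simp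
      then show ?thesis using that \<open>app u (j, 1) = (j, 1)\<close> by simp
    qed
  qed
  show ?thesis
  proof (rule mperm_eqI)
    fix i
    show "app (u + v) (i, 1) = app (v + u) (i, 1)"
      using *[of u i v] *[of v i u] assms by (metis app_plus)
  qed
qed

lemma le_eq_len: "le u v \<Longrightarrow> len u = len v \<Longrightarrow> u = v"
  by (simp add: le_def eq_neg_iff_add_eq_0[symmetric] neg_eq_iff_add_eq_0[symmetric])

lemma le_antisym: "le u v \<Longrightarrow> le v u \<Longrightarrow> u = v"
  by (rule le_eq_len) (auto simp: le_def)

text \<open>The factors need not commute. Invariance of length under cyclic rotation turns the
  quotient of the two products into \<open>(- p + p') + (q' + - q)\<close>, which explains the form
  of the last hypothesis.\<close>

lemma le_plus_iff:
  assumes "len (p + q) = len p + len q" "len (p' + q') = len p' + len q'"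
    and "len ((- p + p') + (q' + - q)) = len (- p + p') + len (q' + - q)"
  shows "le (p + q) (p' + q') \<longleftrightarrow> le p p' \<and> le q q'"
proof -
  have "- (p + q) + (p' + q') = - q + ((- p + p') + q')" by (simp add: minus_add add.assoc)
  then have "len (- (p + q) + (p' + q')) = len ((- p + p') + q' + - q)"
    using len_plus_commute by metis
  then have *: "len (- (p + q) + (p' + q')) = len (- p + p') + len (- q + q')"
    using assms(3) len_plus_commute[of q' "- q"] by (simp add: add.assoc)
  have "len p' \<le> len p + len (- p + p')" "len q' \<le> len q + len (- q + q')"
    using len_plus_le[of p "- p + p'"] len_plus_le[of q "- q + q'"] by (simp_all add: add.assoc[symmetric])
  then show ?thesis unfolding le_def assms(1,2) * by auto
qed

lemma sbd_plus:
  assumes "sbd le len M P" "sbd le len N Q"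
    and "\<And>p q. p \<in> P \<Longrightarrow> q \<in> Q \<Longrightarrow> len (p + q) = len p + len q"
    and "\<And>p p' q q'. p \<in> P \<Longrightarrow> p' \<in> P \<Longrightarrow> q \<in> Q \<Longrightarrow> q' \<in> Q \<Longrightarrow>
      len ((- p + p') + (q' + - q)) = len (- p + p') + len (q' + - q)"
  shows "sbd le len (M + N) (P + Q)"
proof -
  have iff: "le (p + q) (p' + q') \<longleftrightarrow> le p p' \<and> le q q'"
    if "p \<in> P" "p' \<in> P" "q \<in> Q" "q' \<in> Q" for p p' q q'
    by (rule le_plus_iff; intro assms(3,4) that)
  have "sbd le len (M + N) {p + q |p q. p \<in> P \<and> q \<in> Q}"
  proof (rule sbd_product[OF assms(1,2), where m = "(+)" and leq = le and rk = len])
    show "le (p + q) (p' + q') \<longleftrightarrow> le p p' \<and> le q q'"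
      if "p \<in> P" "p' \<in> P" "q \<in> Q" "q' \<in> Q" for p p' q q'
      using that by (rule iff)
    show "len (p + q) = len p + len q" if "p \<in> P" "q \<in> Q" for p q
      using that by (rule assms(3))
    fix p p' q q' assume *: "p \<in> P" "p' \<in> P" "q \<in> Q" "q' \<in> Q" "p + q = p' + q'"
    have "le p p' \<and> le q q'" using iff[OF *(1-4)] *(5) by simp
    moreover have "le p' p \<and> le q' q" using iff[OF *(2,1,4,3)] *(5) by simp
    ultimately show "p = p' \<and> q = q'" using le_antisym by blast
  qed
  moreover have "{p + q |p q. p \<in> P \<and> q \<in> Q} = P + Q" by (auto simp: set_plus_def)
  ultimately show ?thesis by simp
qed

section \<open>Cube partitions certified by reflections of the group\<close>

locale gddn =
  fixes d n :: nat
  assumes d_pos: "0 < d"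
begin

definition rpts :: "(nat \<times> complex) list \<Rightarrow> bool" where
  "rpts ps \<longleftrightarrow> distinct (map fst ps) \<and> (\<forall>p\<in>set ps. fst p < n \<and> snd p ^ d = 1)"

lemma root_nonzero: "z ^ d = 1 \<Longrightarrow> z \<noteq> (0::complex)"
  using d_pos by (auto simp: power_0_left)

lemma rpts_imp_pts: "rpts ps \<Longrightarrow> pts ps"
  using root_nonzero by (auto simp: rpts_def pts_def)

lemma rpts_append: "rpts (xs @ ys) \<longleftrightarrow> rpts xs \<and> rpts ys \<and> fst ` set xs \<inter> fst ` set ys = {}"
  by (auto simp: rpts_def)

lemma rpts_Cons: "rpts (p # ps) \<longleftrightarrow> fst p \<notin> fst ` set ps \<and> fst p < n \<and> snd p ^ d = 1 \<and> rpts ps"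
  by (auto simp: rpts_def)

text \<open>Only reflections that exchange two axes are listed; a nontrivial dilation of one axis
  has product of entries different from 1.\<close>

definition trefl :: "mperm set" where
  "trefl = {rfl p q |p q. fst p \<noteq> fst q \<and> fst p < n \<and> fst q < n \<and> snd p ^ d = 1 \<and> snd q ^ d = 1}"

text \<open>The certificate that the codimension of \<open>w\<close> is attained by reflections of
  the group. It gives equality of the two lengths in \<open>abs_len_good\<close>.\<close>

definition good :: "mperm \<Rightarrow> bool" where
  "good w \<longleftrightarrow> (\<exists>ts. set ts \<subseteq> trefl \<and> length ts = len w \<and> w = sum_list ts)"

lemma good_zero: "good 0"
  by (auto simp: good_def intro!: exI[of _ "[]"])

lemma good_rfl:
  assumes "fst p \<noteq> fst q" "fst p < n" "fst q < n" "snd p ^ d = 1" "snd q ^ d = 1"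
  shows "good (rfl p q)"
proof -
  have "len (rfl p q) = 1" using assms root_nonzero by (intro len_rfl) auto
  moreover have "rfl p q \<in> trefl" using assms unfolding trefl_def by blast
  ultimately show ?thesis by (auto simp: good_def intro!: exI[of _ "[rfl p q]"])
qed

lemma good_plus:
  assumes "good u" "good v" "len (u + v) = len u + len v"
  shows "good (u + v)"
proof -
  obtain us vs where "set us \<subseteq> trefl" "length us = len u" "u = sum_list us"
    "set vs \<subseteq> trefl" "length vs = len v" "v = sum_list vs"
    using assms(1,2) by (auto simp: good_def)
  then show ?thesis using assms(3) unfolding good_def by (intro exI[of _ "us @ vs"]) auto
qed

text \<open>\<open>N\<close> is the sum of bottom and top rank of every cube, which may differ from
  the rank of \<open>P\<close>. Thus a translation by \<open>a\<close> adds
  \<open>2 * len a\<close>, whereas \<open>P\<close> itself need not contain the identity.\<close>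

definition nice :: "nat \<Rightarrow> mperm set \<Rightarrow> bool" where
  "nice N P \<longleftrightarrow> sbd le len N P \<and> (\<forall>w\<in>P. good w)"

lemma nice_empty: "nice N {}"
  by (simp add: nice_def partitioned_empty)

lemma nice_fibres: "(\<And>j. nice N {w \<in> P. key w = j}) \<Longrightarrow> nice N P"
  unfolding nice_def using partitioned_fibres[of "sym_cube le len N" P key] by blast

lemma nice_UN:
  assumes "\<And>j. j \<in> J \<Longrightarrow> nice N (P j)"
    and "\<And>j w. j \<in> J \<Longrightarrow> w \<in> P j \<Longrightarrow> key w = l j" "inj_on l J"
  shows "nice N (\<Union>j\<in>J. P j)"
proof -
  have "P i \<inter> P j = {}" if "i \<in> J" "j \<in> J" "i \<noteq> j" for i j
  proof (rule ccontr)
    assume "P i \<inter> P j \<noteq> {}"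
    then obtain w where "w \<in> P i" "w \<in> P j" by blast
    then have "l i = l j" using assms(2) that by metis
    then show False using assms(3) that by (auto dest: inj_onD)
  qed
  then have "sbd le len N (\<Union>j\<in>J. P j)"
    using assms(1) by (intro partitioned_UN) (auto simp: nice_def)
  then show ?thesis using assms(1) by (auto simp: nice_def)
qed

lemma nice_single:
  assumes "good a" "N = 2 * len a" shows "nice N {a}"
proof -
  have "sym_cube le len N {a}"
    unfolding sym_cube_def
    by (rule exI[of _ 0], rule exI[of _ "\<lambda>_. a"]) (auto simp: assms(2))
  then show ?thesis using assms(1) by (auto simp: nice_def intro: partitioned_self)
qed

lemma nice_pair:
  assumes "good a" "good b" "le a b" "len b = Suc (len a)" "N = Suc (2 * len a)"
  shows "nice N {a, b}"
proof -
  have "\<not> le b a" using assms(4) by (auto simp: le_def)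
  moreover have "{..<Suc 0} = {0::nat}" by auto
  moreover have "A \<subseteq> {0::nat} \<longleftrightarrow> A = {} \<or> A = {0}" for A by auto
  ultimately have "sym_cube le len N {a, b}"
    unfolding sym_cube_def using assms(3,4,5)
    by (intro exI[of _ "Suc 0"] exI[of _ "\<lambda>A. if A = {} then a else b"]) (auto simp: Pow_insert)
  then show ?thesis using assms(1,2) by (auto simp: nice_def intro: partitioned_self)
qed

lemma nice_plus:
  assumes "nice M P" "nice N Q"
    and "\<And>p q. p \<in> P \<Longrightarrow> q \<in> Q \<Longrightarrow> len (p + q) = len p + len q"
    and "\<And>p p' q q'. p \<in> P \<Longrightarrow> p' \<in> P \<Longrightarrow> q \<in> Q \<Longrightarrow> q' \<in> Q \<Longrightarrow>
      len ((- p + p') + (q' + - q)) = len (- p + p') + len (q' + - q)"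
  shows "nice (M + N) (P + Q)"
  using sbd_plus[of M P N Q] good_plus assms unfolding nice_def by (auto simp: set_plus_def)

lemma nice_shift:
  assumes "nice N Q" "good a" "\<And>q. q \<in> Q \<Longrightarrow> len (a + q) = len a + len q"
  shows "nice (2 * len a + N) ((+) a ` Q)"
proof -
  have "nice (2 * len a + N) ({a} + Q)"
    by (rule nice_plus[OF nice_single assms(1)]) (use assms in auto)
  moreover have "{a} + Q = (+) a ` Q" by (auto simp: set_plus_def)
  ultimately show ?thesis by simp
qed

text \<open>The repair for translates that are off centre: \<open>a Q\<close> has sum
  \<open>2 * len a + N\<close>, which is one too small, and its translate by one more reflection is
  one too large. Together they are the product of a two-element chain with \<open>Q\<close>. The
  reflection may fail to commute with \<open>Q\<close>; it suffices that \<open>Q\<close> fixes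
  \<open>p\<close>.\<close>

lemma nice_double:
  assumes "nice N Q" "good a" "good (rfl p y)" and py: "fst p \<noteq> fst y" "snd p \<noteq> 0" "snd y \<noteq> 0"
    and Q: "\<And>q. q \<in> Q \<Longrightarrow> app q p = p"
    and len: "len (a + rfl p y) = Suc (len a)"
    "\<And>q. q \<in> Q \<Longrightarrow> len (a + q) = len a + len q"
    "\<And>q. q \<in> Q \<Longrightarrow> len (a + rfl p y + q) = Suc (len a) + len q"
  shows "nice (2 * len a + 1 + N) ((+) a ` Q \<union> (+) (a + rfl p y) ` Q)"
proof -
  let ?r = "rfl p y"
  have rr: "?r + ?r = 0" "- ?r = ?r" using py(1) by (rule rfl_rfl, rule uminus_rfl_swap)
  have r: "len ?r = 1" using py by (intro len_rfl) auto
  have "le a (a + ?r)" using r len(1) by (simp add: le_def add.assoc[symmetric])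
  moreover have "good (a + ?r)" using good_plus[OF assms(2,3)] r len(1) by simp
  ultimately have "nice (2 * len a + 1) {a, a + ?r}"
    using assms(2) len(1) by (intro nice_pair) auto
  then have "nice (2 * len a + 1 + N) ({a, a + ?r} + Q)"
  proof (rule nice_plus[OF _ assms(1)])
    show "len (x + q) = len x + len q" if "x \<in> {a, a + ?r}" "q \<in> Q" for x q
      using that len by auto
    fix x x' q q' assume x: "x \<in> {a, a + ?r}" "x' \<in> {a, a + ?r}" and q: "q \<in> Q" "q' \<in> Q"
    have "app (q' + - q) p = p" using Q[OF q(1)] Q[OF q(2)] by (simp add: app_uminus_fixed)
    then have "len (?r + (q' + - q)) = Suc (len (q' + - q))"
      using py by (intro len_rfl_plus) auto
    moreover have "- x + x' = 0 \<or> - x + x' = ?r"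
      using x by (auto simp: minus_add add.assoc rr)
    ultimately show "len ((- x + x') + (q' + - q)) = len (- x + x') + len (q' + - q)"
      using r by auto
  qed
  moreover have "{a, a + ?r} + Q = (+) a ` Q \<union> (+) (a + ?r) ` Q" by (auto simp: set_plus_def)
  ultimately show ?thesis by simp
qed

lemma below_cyc_fixes_other: "w \<in> below (cyc \<eta> ps) \<Longrightarrow> i \<notin> fst ` set ps \<Longrightarrow> app w (i, 1) = (i, 1)"
  using le_fixes[of w "cyc \<eta> ps" "(i, 1)"] app_cyc_other[of "(i, 1)" ps \<eta>] by (simp add: below_def)

lemma nice_plus_cyc:
  assumes "nice M (below (cyc 1 xs))" "nice N Q" "pts xs" "\<And>q. q \<in> Q \<Longrightarrow> fixes_all q xs"
  shows "nice (M + N) (below (cyc 1 xs) + Q)"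
proof (rule nice_plus[OF assms(1,2)])
  have *: "len (z + x) = len z + len x"
    if "\<And>i. i \<notin> fst ` set xs \<Longrightarrow> app z (i, 1) = (i, 1)" "fixes_all x xs" for z x
  proof (rule len_plus_disjoint)
    fix i assume "app z (i, 1) \<noteq> (i, 1)"
    with that(1) have "i \<in> fst ` set xs" by blast
    then obtain q where "q \<in> set xs" "i = fst q" by blast
    then show "app x (i, 1) = (i, 1)"
      using app_fixes_scale[of x q "(i, 1)"] assms(3) that(2) by (simp add: fixes_all_def pts_def)
  qed
  show "len (p + q) = len p + len q" if "p \<in> below (cyc 1 xs)" "q \<in> Q" for p q
    using * that below_cyc_fixes_other assms(4) by blast
  fix p p' q q' assume pq: "p \<in> below (cyc 1 xs)" "p' \<in> below (cyc 1 xs)" "q \<in> Q" "q' \<in> Q"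
  show "len ((- p + p') + (q' + - q)) = len (- p + p') + len (q' + - q)"
  proof (rule *)
    show "app (- p + p') (i, 1) = (i, 1)" if "i \<notin> fst ` set xs" for i
      using below_cyc_fixes_other[OF pq(1) that] below_cyc_fixes_other[OF pq(2) that]
      by (simp add: app_uminus_eq_iff)
    show "fixes_all (q' + - q) xs"
      using assms(4)[OF pq(3)] assms(4)[OF pq(4)] by (simp add: fixes_all_def app_uminus_fixed)
  qed
qed

lemma below_fixes_all: "w \<in> below c \<Longrightarrow> fixes_all c ps \<Longrightarrow> pts ps \<Longrightarrow> fixes_all w ps"
  using le_fixes by (auto simp: below_def fixes_all_def pts_def)

text \<open>By the recursion on the image of \<open>p\<close>, the piece over \<open>qs ! k\<close>
  with \<open>k > 0\<close> has sum 2 + (k - 1) + (L - k - 1) = L for L points in \<open>qs\<close>,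
  so it is centred. For \<open>k = 0\<close> the first arc is empty, the sum becomes L + 1, and this
  piece is doubled with the elements that fix \<open>p\<close>.\<close>

theorem nice_cyc: "rpts ps \<Longrightarrow> nice (length ps - 1) (below (cyc 1 ps))"
proof (induction ps rule: length_induct)
  case (1 ps)
  show ?case
  proof (cases ps)
    case Nil
    then show ?thesis by (simp add: nice_single good_zero)
  next
    case (Cons p qs)
    have IH: "nice (length rs - 1) (below (cyc 1 rs))" if "length rs < length ps" "rpts rs" for rs
      using 1(1) that by blast
    have rp: "rpts qs" "pts qs" "pts (p # qs)" "fst p \<notin> fst ` set qs" "fst p < n" "snd p ^ d = 1" "snd p \<noteq> 0"
      using 1(2) rpts_imp_pts root_nonzero unfolding Cons by (auto simp: rpts_Cons)
    have fp: "app w p = p" if "w \<in> below (cyc 1 qs)" for w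
      using le_fixes[of w "cyc 1 qs" p] that app_cyc_other[of p qs] rp by (simp add: below_def)
    have y: "qs ! k \<in> set qs" "fst (qs ! k) \<noteq> fst p" "fst (qs ! k) < n" "snd (qs ! k) ^ d = 1" "snd (qs ! k) \<noteq> 0"
      if "k < length qs" for k
    proof -
      show 1: "qs ! k \<in> set qs" using that by simp
      then show "fst (qs ! k) \<noteq> fst p" using rp(4) by (metis imageI)
      show "fst (qs ! k) < n" "snd (qs ! k) ^ d = 1" using rp(1) 1 by (auto simp: rpts_def)
      then show "snd (qs ! k) \<noteq> 0" using root_nonzero by blast
    qed
    have good: "good (rfl p (qs ! k))" "len (rfl p (qs ! k)) = 1" if "k < length qs" for k
    proof -
      have "fst p \<noteq> fst (qs ! k)" "p \<noteq> qs ! k" using y(2)[OF that] by auto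
      then show "good (rfl p (qs ! k))" "len (rfl p (qs ! k)) = 1"
        using y[OF that] rp good_rfl len_rfl by blast+
    qed
    have sp: "rpts (take k qs)" "rpts (drop k qs)" "pts (take k qs)"
        "fst ` set (take k qs) \<inter> fst ` set (drop k qs) = {}" for k
    proof -
      have "rpts (take k qs @ drop k qs)" using rp(1) by simp
      then show "rpts (take k qs)" "rpts (drop k qs)" "pts (take k qs)"
        "fst ` set (take k qs) \<inter> fst ` set (drop k qs) = {}"
        using rpts_imp_pts unfolding rpts_append by auto
    qed
    define piece where "piece k = (+) (rfl p (qs ! k)) ` below (cyc 1 (take k qs) + cyc 1 (drop k qs))" for k
    have fixp: "app w p = p" if "w \<in> below (cyc 1 (take k qs) + cyc 1 (drop k qs))" for w k
    proof -
      have "fst p \<notin> fst ` set (take k qs)" "fst p \<notin> fst ` set (drop k qs)"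
        using rp(4) set_take_subset[of k qs] set_drop_subset[of k qs] by auto
      then have "app (cyc 1 (take k qs) + cyc 1 (drop k qs)) p = p" by (simp add: app_cyc_other)
      then show ?thesis using le_fixes that rp(7) by (auto simp: below_def)
    qed
    have decomp: "below (cyc 1 ps) = below (cyc 1 qs) \<union> (\<Union>k<length qs. piece k)"
      using below_cyc_Cons[of p qs 0] rp(3) by (simp add: Cons piece_def)
    show ?thesis
    proof (cases "qs = []")
      case True
      then show ?thesis unfolding decomp by (simp add: Cons nice_single good_zero)
    next
      case False
      \<comment> \<open>The elements fixing \<open>p\<close> are attached to the fibre over the
        first point, so the key below sends both kinds to \<open>qs ! 0\<close>.\<close>
      define Q where "Q k = (if k = 0 then below (cyc 1 qs) \<union> piece 0 else piece k)" for k
      have "below (cyc 1 ps) = (\<Union>k<length qs. Q k)"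
      proof -
        have ne: "0 \<in> {..<length qs}" using False by simp
        have "piece k \<subseteq> Q k" "Q k \<subseteq> below (cyc 1 qs) \<union> piece k" "below (cyc 1 qs) \<subseteq> Q 0" for k
          by (auto simp: Q_def)
        then show ?thesis unfolding decomp using ne by blast
      qed
      moreover have "nice (length qs) (\<Union>k<length qs. Q k)"
      proof (rule nice_UN[where key = "\<lambda>w. if app w p = p then qs ! 0 else app w p" and l = "(!) qs"])
        fix k assume k: "k \<in> {..<length qs}"
        then have kl: "k < length qs" by simp
        have app_piece: "app w p = qs ! k" if "w \<in> piece k" for w
          using that fixp y[OF kl] rp(7) by (auto simp: piece_def)
        show "(if app w p = p then qs ! 0 else app w p) = qs ! k" if "w \<in> Q k" for w
          using that app_piece fp y(2)[OF kl] False by (auto simp: Q_def split: if_splits)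
        show "nice (length qs) (Q k)"
        proof (cases "k = 0")
          case True
          have "nice (2 * len (0 :: mperm) + 1 + (length qs - 1)) ((+) 0 ` below (cyc 1 qs) \<union> (+) (0 + rfl p (qs ! 0)) ` below (cyc 1 qs))"
          proof (rule nice_double[OF IH[of qs]])
            show "good (rfl p (qs ! 0))" "len (0 + rfl p (qs ! 0)) = Suc (len (0 :: mperm))"
              using good[of 0] False by auto
            show "fst p \<noteq> fst (qs ! 0)" "snd (qs ! 0) \<noteq> 0" using y[of 0] False by auto
            show "len (0 + rfl p (qs ! 0) + q) = Suc (len (0 :: mperm)) + len q" if "q \<in> below (cyc 1 qs)" for q
              using len_rfl_plus[of q p "qs ! 0"] fp[OF that] y[of 0] False rp(7) by auto
          qed (use Cons rp fp good_zero in auto)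
          moreover have "piece 0 = (+) (rfl p (qs ! 0)) ` below (cyc 1 qs)" by (simp add: piece_def)
          ultimately show ?thesis using True False by (simp add: Q_def)
        next
          case k0: False
          have "nice (length (take k qs) - 1 + (length (drop k qs) - 1)) (below (cyc 1 (take k qs)) + below (cyc 1 (drop k qs)))"
          proof (rule nice_plus_cyc[OF IH IH])
            show "fixes_all q (take k qs)" if "q \<in> below (cyc 1 (drop k qs))" for q
              using that sp[of k] by (intro below_fixes_all[of q "cyc 1 (drop k qs)"] fixes_all_cyc)
          qed (use kl Cons sp in auto)
          moreover have "below (cyc 1 (take k qs)) + below (cyc 1 (drop k qs)) = below (cyc 1 (take k qs) + cyc 1 (drop k qs))"
            using sp[of k] by (intro below_cyc_plus[symmetric] fixes_all_cyc)
          ultimately have "nice (2 * len (rfl p (qs ! k)) + (length (take k qs) - 1 + (length (drop k qs) - 1))) (piece k)"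
            unfolding piece_def
          proof (intro nice_shift)
            show "len (rfl p (qs ! k) + q) = len (rfl p (qs ! k)) + len q"
              if "q \<in> below (cyc 1 (take k qs) + cyc 1 (drop k qs))" for q
              using len_rfl_plus[OF fixp[OF that], of "qs ! k"] good(2)[OF kl] y[OF kl] rp(7) by auto
          qed (use good kl in auto)
          moreover have "2 * len (rfl p (qs ! k)) + (length (take k qs) - 1 + (length (drop k qs) - 1)) = length qs"
            using good(2)[OF kl] kl k0 by simp
          ultimately show ?thesis using k0 by (simp add: Q_def)
        qed
      next
        have "distinct qs" using rp(2) by (auto simp: pts_def distinct_map)
        then show "inj_on ((!) qs) {..<length qs}" by (simp add: inj_on_nth)
      qed
      ultimately show ?thesis by (simp add: Cons)
    qed
  qed
qed

end

section \<open>Intervals below Coxeter elements\<close>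

context gddn
begin

definition col :: "mperm \<Rightarrow> complex" where
  "col w = (\<Prod>i<n. snd (app w (i, 1)))"

definition supported :: "mperm \<Rightarrow> bool" where
  "supported w \<longleftrightarrow> (\<forall>i\<ge>n. app w (i, 1) = (i, 1))"

definition W :: "mperm set" where
  "W = {w. supported w \<and> (\<forall>i. snd (app w (i, 1)) ^ d = 1) \<and> col w = 1}"

lemma supported_zero: "supported 0"
  by (simp add: supported_def)

lemma supported_plus: "supported u \<Longrightarrow> supported v \<Longrightarrow> supported (u + v)"
  by (simp add: supported_def)

lemma supported_uminus: "supported u \<Longrightarrow> supported (- u)"
  by (simp add: supported_def app_uminus_fixed)

lemma supported_less: "fst (app w (i, 1)) < n" if "supported w" "i < n"
proof (rule ccontr)
  define j where "j = fst (app w (i, 1))"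
  assume "\<not> fst (app w (i, 1)) < n"
  then have "app w (j, 1) = (j, 1)" using that(1) by (auto simp: supported_def j_def)
  then have "i = j" using fst_app_eq_iff[of w "(i, 1)" "(j, 1)"] by (simp add: j_def)
  then show False using \<open>\<not> fst (app w (i, 1)) < n\<close> that(2) j_def by simp
qed

lemma col_zero: "col 0 = 1"
  by (simp add: col_def)

lemma snd_app_plus: "snd (app (u + v) (i, 1)) = snd (app u (fst (app v (i, 1)), 1)) * snd (app v (i, 1))"
proof -
  have "app u (app v (i, 1)) = scl (snd (app v (i, 1))) (app u (fst (app v (i, 1)), 1))"
    by (rule app_eq_scl)
  then show ?thesis by simp
qed

lemma col_plus: "supported v \<Longrightarrow> col (u + v) = col u * col v"
proof -
  assume v: "supported v"
  define \<sigma> where "\<sigma> i = fst (app v (i, 1))" for i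
  have inj: "inj_on \<sigma> {..<n}"
  proof (rule inj_onI)
    fix i j assume "\<sigma> i = \<sigma> j"
    then show "i = j" using fst_app_eq_iff[of v "(i, 1)" "(j, 1)"] by (simp add: \<sigma>_def)
  qed
  have "\<sigma> ` {..<n} \<subseteq> {..<n}" using supported_less[OF v] by (auto simp: \<sigma>_def)
  then have img: "\<sigma> ` {..<n} = {..<n}" using inj by (intro endo_inj_surj) auto
  have "col (u + v) = (\<Prod>i<n. snd (app u (\<sigma> i, 1)) * snd (app v (i, 1)))"
    unfolding col_def \<sigma>_def by (intro prod.cong snd_app_plus) simp
  also have "\<dots> = (\<Prod>i<n. snd (app u (\<sigma> i, 1))) * col v"
    unfolding col_def by (rule prod.distrib)
  also have "(\<Prod>i<n. snd (app u (\<sigma> i, 1))) = (\<Prod>i\<in>\<sigma> ` {..<n}. snd (app u (i, 1)))"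
    by (simp add: prod.reindex[OF inj])
  also have "\<dots> = col u" unfolding img col_def ..
  finally show ?thesis .
qed

lemma W_zero: "0 \<in> W"
  by (simp add: W_def supported_zero col_zero)

lemma W_plus: "u \<in> W \<Longrightarrow> v \<in> W \<Longrightarrow> u + v \<in> W"
  unfolding W_def mem_Collect_eq using supported_plus col_plus
  by (auto simp: snd_app_plus power_mult_distrib simp del: app_plus)

lemma W_uminus: "u \<in> W \<Longrightarrow> - u \<in> W"
proof -
  assume u: "u \<in> W"
  then have s: "supported u" "supported (- u)" by (auto simp: W_def supported_uminus)
  have "col (- u) * col u = 1" using col_plus[OF s(1), of "- u"] by (simp add: col_zero)
  then have "col (- u) = 1" using u by (simp add: W_def)
  moreover have "snd (app (- u) (i, 1)) ^ d = 1" for i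
  proof -
    have "snd (app u (fst (app (- u) (i, 1)), 1)) * snd (app (- u) (i, 1)) = 1"
      using snd_app_plus[of u "- u" i] by simp
    then have "(snd (app u (fst (app (- u) (i, 1)), 1)) * snd (app (- u) (i, 1))) ^ d = 1" by simp
    then show ?thesis using u by (simp add: power_mult_distrib W_def)
  qed
  ultimately show ?thesis using s by (simp add: W_def)
qed

lemma W_plus_iff: "a \<in> W \<Longrightarrow> a + x \<in> W \<longleftrightarrow> x \<in> W"
  using W_plus[of a x] W_plus[of "- a" "a + x"] W_uminus[of a] by auto

lemma trefl_W: "trefl \<subseteq> W"
proof
  fix t assume "t \<in> trefl"
  then obtain p q where t: "t = rfl p q" "fst p \<noteq> fst q" "fst p < n" "fst q < n" "snd p ^ d = 1" "snd q ^ d = 1"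
    by (auto simp: trefl_def)
  then have nz: "snd p \<noteq> 0" "snd q \<noteq> 0" using root_nonzero by auto
  have snd: "snd (app t (i, 1)) = (if i = fst p then snd q / snd p else 1) * (if i = fst q then snd p / snd q else 1)" for i
    using t(2) by (simp add: t(1) app_rfl nz)
  have "col t = (\<Prod>i<n. if i = fst p then snd q / snd p else 1) * (\<Prod>i<n. if i = fst q then snd p / snd q else 1)"
    unfolding col_def snd by (rule prod.distrib)
  also have "\<dots> = 1" using t nz by (simp add: prod.delta)
  finally have "col t = 1" .
  moreover have "supported t" using t by (simp add: supported_def)
  moreover have "snd (app t (i, 1)) ^ d = 1" for i
    unfolding snd using t(5,6) by (simp add: power_mult_distrib power_divide)
  ultimately show "t \<in> W" by (simp add: W_def)
qed

lemma rfl_W: "fst p \<noteq> fst q \<Longrightarrow> fst p < n \<Longrightarrow> fst q < n \<Longrightarrow> snd p ^ d = 1 \<Longrightarrow> snd q ^ d = 1 \<Longrightarrow> rfl p q \<in> W"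
  using trefl_W unfolding trefl_def by blast

lemma good_W: "good w \<Longrightarrow> w \<in> W"
proof -
  have "set ts \<subseteq> trefl \<Longrightarrow> sum_list ts \<in> W" for ts
    using trefl_W by (induction ts) (auto simp: W_zero intro: W_plus)
  then show "good w \<Longrightarrow> w \<in> W" by (auto simp: good_def)
qed

lemma col_dilation: "snd p \<noteq> 0 \<Longrightarrow> \<zeta> \<noteq> 0 \<Longrightarrow> fst p < n \<Longrightarrow> col (rfl p (scl \<zeta> p)) = \<zeta>"
proof -
  assume *: "snd p \<noteq> 0" "\<zeta> \<noteq> 0" "fst p < n"
  have "snd (app (rfl p (scl \<zeta> p)) (i, 1)) = (if i = fst p then \<zeta> else 1)" for i
    using * by (simp add: app_rfl)
  then show "col (rfl p (scl \<zeta> p)) = \<zeta>" using * by (simp add: col_def prod.delta)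
qed

lemma image_plus_Int_W: "a \<in> W \<Longrightarrow> (+) a ` A \<inter> W = (+) a ` (A \<inter> W)"
  using W_plus_iff by auto

lemma set_plus_Int_W: "A \<subseteq> W \<Longrightarrow> (A + B) \<inter> W = A + (B \<inter> W)"
  using W_plus_iff unfolding set_plus_def by blast

lemma nice_W: "nice N P \<Longrightarrow> P \<subseteq> W"
  using good_W by (auto simp: nice_def)

end

lemma below_len_1: "len c = 1 \<Longrightarrow> below c = {0, c}"
proof -
  assume c: "len c = 1"
  have "w = 0 \<or> w = c" if "le w c" for w
  proof (cases "len w = 0")
    case False
    then have "len (- w + c) = 0" using that c unfolding le_def by linarith
    then show ?thesis by (metis add.right_neutral add_minus_cancel len_eq_0)
  qed simp
  then show ?thesis using c by (auto simp: below_def)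
qed

locale gddn_coxeter = gddn +
  fixes n0 :: nat and \<omega> :: complex
  assumes n0: "n0 < n" and \<omega>: "\<omega> ^ d = 1" "\<omega> \<noteq> 1"
begin

definition e :: "nat \<times> complex" where "e = (n0, 1)"

definition E :: mperm where "E = rfl e (scl (1 / \<omega>) e)"

lemma \<omega>_nz [simp]: "\<omega> \<noteq> 0"
  using root_nonzero \<omega>(1) by blast

lemma e_simps [simp]: "fst e = n0" "snd e = 1"
  by (simp_all add: e_def)

lemma len_E: "len E = 1"
proof -
  have "scl (1 / \<omega>) e \<noteq> e" using \<omega> by (auto simp: prod_eq_iff)
  then show ?thesis unfolding E_def by (intro len_rfl) auto
qed

lemma col_E: "col E = 1 / \<omega>"
  unfolding E_def using n0 by (intro col_dilation) auto

lemma E_notin_W: "E \<notin> W"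
  using col_E \<omega> by (simp add: W_def)

lemma app_E: "fst r \<noteq> n0 \<Longrightarrow> app E r = r"
  by (simp add: E_def)

lemma fixes_all_E: "n0 \<notin> fst ` set ps \<Longrightarrow> fixes_all E ps"
  by (auto simp: fixes_all_def intro!: app_E)

lemma below_E: "below E = {0, E}"
  by (rule below_len_1) (rule len_E)

abbreviation A :: "(nat \<times> complex) list \<Rightarrow> mperm set" where
  "A ps \<equiv> below (cyc 1 ps)"

definition D :: "(nat \<times> complex) list \<Rightarrow> mperm set" where
  "D ps = below (cyc \<omega> ps + E) \<inter> W"

text \<open>\<open>E\<close> has product of entries \<open>1 / \<omega>\<close>, so the intersection
  with \<open>W\<close> loses it. The sum of ranks is 0 instead of the value 1 that the formula for
  nonempty lists would give, and this puts the fibre over \<open>scl (1 / \<omega>) (qs ! 0)\<close>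
  off centre.\<close>

lemma D_Nil: "D [] = {0}"
  using E_notin_W W_zero by (auto simp: D_def below_E)

lemma A_W: "rpts ps \<Longrightarrow> A ps \<subseteq> W"
  using nice_cyc nice_W by blast

end

locale gddn_step = gddn_coxeter +
  fixes p :: "nat \<times> complex" and qs :: "(nat \<times> complex) list"
  assumes rpts: "rpts (p # qs)" and n0_notin: "n0 \<notin> fst ` set (p # qs)"
begin

lemma p_simps: "fst p < n" "snd p ^ d = 1" "snd p \<noteq> 0" "fst p \<noteq> n0" "n0 \<noteq> fst p" "p \<noteq> e" "e \<noteq> p"
  using rpts n0_notin root_nonzero by (auto simp: rpts_def e_def)

lemma pts: "pts (p # qs)"
  using rpts by (rule rpts_imp_pts)

lemma rpts_qs: "rpts qs"
  using rpts by (simp add: rpts_Cons)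

lemma p_notin: "fst p \<notin> fst ` set qs"
  using rpts by (simp add: rpts_Cons)

lemma nth_simps:
  assumes "k < length qs"
  shows "fst (qs ! k) < n" "snd (qs ! k) ^ d = 1" "snd (qs ! k) \<noteq> 0"
    "fst (qs ! k) \<noteq> fst p" "fst p \<noteq> fst (qs ! k)" "fst (qs ! k) \<noteq> n0" "n0 \<noteq> fst (qs ! k)"
proof -
  have "qs ! k \<in> set qs" using assms by simp
  then show "fst (qs ! k) < n" "snd (qs ! k) ^ d = 1" "snd (qs ! k) \<noteq> 0"
    "fst (qs ! k) \<noteq> fst p" "fst p \<noteq> fst (qs ! k)" "fst (qs ! k) \<noteq> n0" "n0 \<noteq> fst (qs ! k)"
    using rpts_qs root_nonzero p_notin n0_notin by (auto simp: rpts_def image_iff)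
qed

lemma sublists:
  "rpts (take k qs)" "rpts (drop k qs)" "pts (take k qs)" "pts (drop k qs)"
  "fst ` set (take k qs) \<inter> fst ` set (drop k qs) = {}"
  "n0 \<notin> fst ` set (take k qs)" "n0 \<notin> fst ` set (drop k qs)"
  "fst p \<notin> fst ` set (take k qs)" "fst p \<notin> fst ` set (drop k qs)"
proof -
  have "rpts (take k qs @ drop k qs)" using rpts_qs by simp
  then show "rpts (take k qs)" "rpts (drop k qs)" "fst ` set (take k qs) \<inter> fst ` set (drop k qs) = {}"
    unfolding rpts_append by auto
  then show "pts (take k qs)" "pts (drop k qs)" by (auto intro: rpts_imp_pts)
  show "n0 \<notin> fst ` set (take k qs)" "n0 \<notin> fst ` set (drop k qs)"
    "fst p \<notin> fst ` set (take k qs)" "fst p \<notin> fst ` set (drop k qs)"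
    using n0_notin p_notin set_take_subset[of k qs] set_drop_subset[of k qs] by auto
qed

section \<open>Fibres of the coloured interval over the image of the first point\<close>

definition c :: mperm where "c = cyc \<omega> (p # qs) + E"

definition X :: "mperm set" where "X = D (p # qs)"

definition F :: "nat \<times> complex \<Rightarrow> mperm set" where "F v = {w \<in> X. app w p = v}"

lemma F_eq: "F v = {w \<in> below c. app w p = v} \<inter> W"
  by (auto simp: F_def X_def D_def c_def)

lemma fixes_E: "fixes_all E (p # qs)"
  by (rule fixes_all_E) (rule n0_notin)

lemma F_p: "F p = D qs"
  unfolding F_eq c_def D_def using below_cyc_fixing[of p qs E \<omega>] pts fixes_E by simp

lemma D_fixes:
  assumes "w \<in> D rs" "fst r \<notin> fst ` set rs" "fst r \<noteq> n0" "snd r \<noteq> 0"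
  shows "app w r = r"
proof (rule le_fixes)
  show "le w (cyc \<omega> rs + E)" using assms(1) by (simp add: D_def below_def)
  show "app (cyc \<omega> rs + E) r = r" using assms by (simp add: app_E app_cyc_other)
qed (rule assms)

lemma A_fixes:
  assumes "w \<in> A rs" "fst r \<notin> fst ` set rs" "snd r \<noteq> 0"
  shows "app w r = r"
proof (rule le_fixes)
  show "le w (cyc 1 rs)" using assms(1) by (simp add: below_def)
  show "app (cyc 1 rs) r = r" using assms by (simp add: app_cyc_other)
qed (rule assms)

text \<open>The case \<open>\<zeta> = 1\<close> of \<open>below_cyc_moving\<close>: the arc before
  \<open>qs ! k\<close> becomes balanced and splits off, and the arc from \<open>qs ! k\<close> on
  keeps the colour \<open>\<omega>\<close> together with \<open>E\<close>.\<close>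

lemma F_nth:
  assumes k: "k < length qs"
  shows "F (qs ! k) = (+) (rfl p (qs ! k)) ` (A (take k qs) + D (drop k qs))"
proof -
  have "{w \<in> below c. app w p = qs ! k} =
    (+) (rfl p (qs ! k)) ` below (cyc 1 (take k qs) + (cyc \<omega> (drop k qs) + E))"
    using below_cyc_moving[of p "take k qs" "qs ! k" "drop (Suc k) qs" E \<omega> 1] k pts fixes_E
    unfolding c_def by (simp add: Cons_nth_drop_Suc del: pts_simps fixes_all_simps cyc.simps)
  also have "below (cyc 1 (take k qs) + (cyc \<omega> (drop k qs) + E)) =
      A (take k qs) + below (cyc \<omega> (drop k qs) + E)"
    using sublists[of k] by (intro below_cyc_plus fixes_all_plus fixes_all_cyc fixes_all_E) auto
  finally have *: "{w \<in> below c. app w p = qs ! k} =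
    (+) (rfl p (qs ! k)) ` (A (take k qs) + below (cyc \<omega> (drop k qs) + E))" .
  have "rfl p (qs ! k) \<in> W" using nth_simps[OF k] p_simps by (intro rfl_W) auto
  then show ?thesis
    unfolding F_eq * using A_W[OF sublists(1)] by (simp add: image_plus_Int_W set_plus_Int_W D_def)
qed

lemma cyc_commute:
  assumes "fst ` set xs \<inter> fst ` set ys = {}" shows "cyc \<eta> xs + cyc \<theta> ys = cyc \<theta> ys + cyc \<eta> xs"
proof (rule plus_commute_disjoint)
  fix i
  show "app (cyc \<eta> xs) (i, 1) = (i, 1) \<or> app (cyc \<theta> ys) (i, 1) = (i, 1)"
  proof (cases "i \<in> fst ` set xs")
    case True
    then have "i \<notin> fst ` set ys" using assms by blast
    then show ?thesis by (simp add: app_cyc_other)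
  qed (simp add: app_cyc_other)
qed

text \<open>The case \<open>\<zeta> = 1 / \<omega>\<close>: now the arc before \<open>qs ! k\<close>
  inherits the colour, and the arc from \<open>qs ! k\<close> on is balanced.\<close>

lemma F_nth':
  assumes k: "k < length qs"
  shows "F (scl (1 / \<omega>) (qs ! k)) =
    (+) (rfl p (scl (1 / \<omega>) (qs ! k))) ` (A (drop k qs) + D (take k qs))"
proof -
  have "{w \<in> below c. app w p = scl (1 / \<omega>) (qs ! k)} =
    (+) (rfl p (scl (1 / \<omega>) (qs ! k))) ` below (cyc \<omega> (take k qs) + (cyc 1 (drop k qs) + E))"
    using below_cyc_moving[of p "take k qs" "qs ! k" "drop (Suc k) qs" E \<omega> "1 / \<omega>"] k pts fixes_E
    unfolding c_def by (simp add: Cons_nth_drop_Suc del: pts_simps fixes_all_simps cyc.simps)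
  also have "cyc \<omega> (take k qs) + (cyc 1 (drop k qs) + E) = cyc 1 (drop k qs) + (cyc \<omega> (take k qs) + E)"
    using cyc_commute[OF sublists(5)] by (simp add: add.assoc[symmetric])
  also have "below (cyc 1 (drop k qs) + (cyc \<omega> (take k qs) + E)) =
      A (drop k qs) + below (cyc \<omega> (take k qs) + E)"
    using sublists[of k] by (intro below_cyc_plus fixes_all_plus fixes_all_cyc fixes_all_E) auto
  finally have *: "{w \<in> below c. app w p = scl (1 / \<omega>) (qs ! k)} =
    (+) (rfl p (scl (1 / \<omega>) (qs ! k))) ` (A (drop k qs) + below (cyc \<omega> (take k qs) + E))" .
  have "rfl p (scl (1 / \<omega>) (qs ! k)) \<in> W"
    using nth_simps[OF k] p_simps \<omega> by (intro rfl_W) (auto simp: power_divide power_mult_distrib)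
  then show ?thesis
    unfolding F_eq * using A_W[OF sublists(2)] by (simp add: image_plus_Int_W set_plus_Int_W D_def)
qed

definition r :: mperm where "r = rfl p e"
definition r' :: mperm where "r' = rfl p (scl \<omega> e)"

text \<open>Writes a product of two dilations, neither of which lies in \<open>W\<close>, as a
  product of two reflections of \<open>W\<close>.\<close>

lemma r_r': "r + r' = rfl p (scl \<omega> p) + E"
  unfolding r_def r'_def E_def using p_simps by (intro mperm_eqI) (auto simp: app_rfl)

lemma r_W: "r \<in> W" "r' \<in> W"
  unfolding r_def r'_def using p_simps n0 \<omega> by (auto intro!: rfl_W)

text \<open>Below the quotient there are the elements of \<open>A qs\<close> with or without a
  factor \<open>E\<close>. The dilation of \<open>p\<close> has colour \<open>\<omega>\<close>, so
  only those with \<open>E\<close> give elements of \<open>W\<close>, and dilation and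
  \<open>E\<close> combine to \<open>r + r'\<close>.\<close>

lemma F_scale: "F (scl \<omega> p) = (+) (r + r') ` A qs"
proof -
  have "{w \<in> below c. app w p = scl \<omega> p} = (+) (rfl p (scl \<omega> p)) ` below (cyc 1 qs + E)"
    using below_cyc_scaling[of p qs E \<omega> \<omega>] \<omega> pts fixes_E unfolding c_def by simp
  also have "below (cyc 1 qs + E) = A qs + {0, E}"
    using pts n0_notin unfolding below_E[symmetric] by (intro below_cyc_plus fixes_all_E) auto
  finally have *: "F (scl \<omega> p) = (+) (rfl p (scl \<omega> p)) ` (A qs + {0, E}) \<inter> W"
    unfolding F_eq by simp
  have comm: "a + E = E + a" if "a \<in> A qs" for a
  proof (rule plus_commute_disjoint)
    fix i
    show "app a (i, 1) = (i, 1) \<or> app E (i, 1) = (i, 1)"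
      using A_fixes[OF that, of "(i, 1)"] app_E[of "(i, 1)"] n0_notin by auto
  qed
  have aW: "a \<in> W" if "a \<in> A qs" for a using that A_W[OF rpts_qs] by blast
  have rot: "rfl p (scl \<omega> p) \<notin> W"
    using col_dilation[of p \<omega>] p_simps \<omega> by (auto simp: W_def)
  have no: "rfl p (scl \<omega> p) + a \<notin> W" if "a \<in> A qs" for a
  proof
    assume "rfl p (scl \<omega> p) + a \<in> W"
    then have "rfl p (scl \<omega> p) + a + - a \<in> W" using W_plus W_uminus aW[OF that] by blast
    then show False using rot by (simp add: add.assoc)
  qed
  have eq: "rfl p (scl \<omega> p) + (a + E) = (r + r') + a" if "a \<in> A qs" for a
    unfolding r_r' comm[OF that] by (simp add: add.assoc)
  have yes: "(r + r') + a \<in> W" if "a \<in> A qs" for a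
    using W_plus r_W aW[OF that] by blast
  show ?thesis
  proof (rule Set.set_eqI)
    fix w
    have "w \<in> F (scl \<omega> p) \<longleftrightarrow> (\<exists>a\<in>A qs. w = rfl p (scl \<omega> p) + a \<or> w = rfl p (scl \<omega> p) + (a + E)) \<and> w \<in> W"
      unfolding * by (auto simp: set_plus_def)
    also have "\<dots> \<longleftrightarrow> (\<exists>a\<in>A qs. w = (r + r') + a)"
      using no eq yes by metis
    finally show "w \<in> F (scl \<omega> p) \<longleftrightarrow> w \<in> (+) (r + r') ` A qs" by blast
  qed
qed

lemma rpts_e: "\<zeta> ^ d = 1 \<Longrightarrow> rpts (scl \<zeta> e # qs)"
  using rpts_qs n0 n0_notin by (auto simp: rpts_Cons)

text \<open>The reflection joins the cycle of colour \<open>\<omega>\<close> to the one-point cycle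
  \<open>E\<close> of colour \<open>1 / \<omega>\<close>, and the result is a single balanced cycle.
  This is \<open>cyc_split\<close> with scalar \<open>1 / \<omega>\<close>, so the point on the axis
  of \<open>e\<close> must be \<open>scl (\<omega> * \<zeta>) e\<close>. Peeling removes
  \<open>p\<close>.\<close>

lemma F_e:
  assumes \<zeta>: "\<zeta> ^ d = 1"
  shows "F (scl \<zeta> e) = (+) (rfl p (scl \<zeta> e)) ` A (scl (\<omega> * \<zeta>) e # qs)"
proof -
  have nz: "\<zeta> \<noteq> 0" using \<zeta> root_nonzero by blast
  let ?t = "rfl p (scl \<zeta> e)" and ?y = "scl (\<omega> * \<zeta>) e"
  have t: "?t + ?t = 0" "- ?t = ?t" using p_simps by (simp_all add: uminus_rfl_swap)
  have "pts (p # qs @ [?y])"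
    using pts p_simps n0_notin nz by (auto simp: pts_append)
  then have "?t + (cyc \<omega> (p # qs) + cyc (1 / \<omega>) [?y]) = cyc 1 (p # qs @ [?y])"
    using cyc_split[of p qs ?y "[]" 1 "1 / \<omega>"] nz by simp
  moreover have "cyc (1 / \<omega>) [?y] = E"
    using nz rfl_scl[of "\<omega> * \<zeta>" e "scl (1 / \<omega>) e"] by (simp add: E_def mult.commute)
  ultimately have tc: "- ?t + c = cyc 1 (p # qs @ [?y])"
    unfolding t c_def by simp
  \<comment> \<open>A balanced cycle may start at any of its points. With the point on the axis of
    \<open>e\<close> in front, the recursion can later be applied to its image.\<close>
  have rot: "cyc 1 (qs @ [?y]) = cyc 1 (?y # qs)"
  proof (cases qs)
    case (Cons q rs)
    have "cyc 1 (q # rs @ [?y]) = rfl q ?y + (cyc 1 (q # rs) + cyc 1 [?y])"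
      using cyc_split[of q rs ?y "[]" 1 1] \<open>pts (p # qs @ [?y])\<close> by (simp add: Cons)
    moreover have "rfl q ?y = rfl ?y q"
      using n0_notin by (intro rfl_commute) (auto simp: Cons)
    ultimately show ?thesis by (simp add: Cons)
  qed simp
  have peel: "peel p (- ?t + c) = cyc 1 (?y # qs)"
    using peel_cyc[of p "qs @ [?y]" 1 0] \<open>pts (p # qs @ [?y])\<close> unfolding tc rot[symmetric] by simp
  have l1: "len (- ?t + c) = Suc (length qs)"
    unfolding tc using len_cyc_plus[OF \<open>pts (p # qs @ [?y])\<close>, of 1 0] by simp
  have l2: "len c = Suc (length qs) + 1"
    unfolding c_def using len_cyc_plus[OF pts _ fixes_E, of \<omega>] \<omega> len_E by simp
  have "{w \<in> below c. app w p = scl \<zeta> e} = (+) ?t ` A (?y # qs)"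
  proof -
    have "scl \<zeta> e \<noteq> p" using p_simps(4) by auto
    then show ?thesis
      using below_moving[of "scl \<zeta> e" p c] l1 l2 peel p_simps nz by (simp del: cyc.simps)
  qed
  moreover have "?t \<in> W" using p_simps n0 \<zeta> by (intro rfl_W) auto
  moreover have "A (?y # qs) \<subseteq> W" using \<zeta> \<omega> by (intro A_W rpts_e) (simp add: power_mult_distrib)
  ultimately show ?thesis unfolding F_eq by (simp add: image_plus_Int_W Int_absorb2)
qed

lemma moves_within:
  assumes w: "w \<in> X"
  obtains "app w p = p" | "app w p = scl \<omega> p" | \<zeta> where "\<zeta> ^ d = 1" "app w p = scl \<zeta> e"
  | k where "k < length qs" "app w p = qs ! k" | k where "k < length qs" "app w p = scl (1 / \<omega>) (qs ! k)"
proof -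
  define v where "v = app w p"
  have wc: "w \<in> below c" and W: "w \<in> W" using w by (auto simp: X_def D_def c_def)
  have v: "snd v ^ d = 1"
  proof -
    have "v = scl (snd p) (app w (fst p, 1))" unfolding v_def by (rule app_eq_scl)
    then show ?thesis using W p_simps by (simp add: power_mult_distrib W_def)
  qed
  then have vnz: "snd v \<noteq> 0" using root_nonzero by blast
  have "fst v \<in> insert n0 (fst ` set (p # qs))"
  proof (rule ccontr)
    assume *: "fst v \<notin> insert n0 (fst ` set (p # qs))"
    then have "app c v = v" unfolding c_def using app_E[of v] app_cyc_other[of v "p # qs" \<omega>] by simp
    then have "app w v = v" using le_fixes wc vnz by (auto simp: below_def)
    then have "app w v = app w p" by (simp add: v_def)
    then have "v = p" by simp
    then show False using * by simp
  qed
  then consider "fst v = n0" | "fst v = fst p" | k where "k < length qs" "fst v = fst (qs ! k)"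
    by (auto simp: in_set_conv_nth)
  then show ?thesis
  proof cases
    case 1
    then have "v = scl (snd v) e" by (simp add: prod_eq_iff)
    then show ?thesis using that(3) v unfolding v_def by metis
  next
    case 2
    define \<zeta> where "\<zeta> = snd v / snd p"
    have v\<zeta>: "v = scl \<zeta> p" "\<zeta> \<noteq> 0" using 2 p_simps vnz by (auto simp: prod_eq_iff \<zeta>_def)
    show ?thesis
    proof (cases "\<zeta> = 1")
      case True
      then show ?thesis using that(1) v\<zeta> by (simp add: v_def)
    next
      case False
      have "w \<in> {w \<in> below c. app w p = scl \<zeta> p}" using wc v\<zeta> by (simp add: v_def)
      then have "\<zeta> = \<omega>"
        using below_cyc_scaling[OF pts fixes_E \<omega>_nz v\<zeta>(2) False] unfolding c_def by (auto split: if_splits)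
      then show ?thesis using that(2) v\<zeta> by (simp add: v_def)
    qed
  next
    case 3
    define \<zeta> where "\<zeta> = snd v / snd (qs ! k)"
    have v\<zeta>: "v = scl \<zeta> (qs ! k)" "\<zeta> \<noteq> 0" using 3 nth_simps[OF 3(1)] vnz by (auto simp: prod_eq_iff \<zeta>_def)
    have "w \<in> {w \<in> below c. app w p = scl \<zeta> (qs ! k)}" using wc v\<zeta> by (simp add: v_def)
    moreover have qs: "take k qs @ qs ! k # drop (Suc k) qs = qs" using 3(1) by (simp add: Cons_nth_drop_Suc)
    ultimately have "\<zeta> = 1 \<or> \<omega> * \<zeta> = 1"
      using below_cyc_moving[of p "take k qs" "qs ! k" "drop (Suc k) qs" E \<omega> \<zeta>] pts fixes_E v\<zeta>(2)
      unfolding c_def qs by (auto split: if_splits)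
    then show ?thesis
    proof
      assume "\<zeta> = 1"
      then show ?thesis using that(4) 3(1) v\<zeta> by (simp add: v_def)
    next
      assume "\<omega> * \<zeta> = 1"
      then have "\<zeta> = 1 / \<omega>" by (simp add: field_simps)
      then show ?thesis using that(5)[OF 3(1)] v\<zeta>(1) unfolding v_def by simp
    qed
  qed
qed

end

lemma zero_set_plus: "{0} + B = (B :: mperm set)" "B + {0} = (B :: mperm set)"
  by (auto simp: set_plus_def)

context gddn_step
begin

section \<open>Centring the fibres\<close>

lemma rfl_nth:
  assumes "k < length qs" "\<zeta> ^ d = 1"
  shows "good (rfl p (scl \<zeta> (qs ! k)))" "len (rfl p (scl \<zeta> (qs ! k))) = 1"
    "app q p = p \<Longrightarrow> len (rfl p (scl \<zeta> (qs ! k)) + q) = 1 + len q"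
proof -
  have nz: "\<zeta> \<noteq> 0" using assms(2) root_nonzero by blast
  show "good (rfl p (scl \<zeta> (qs ! k)))"
    using nth_simps[OF assms(1)] p_simps assms(2) by (intro good_rfl) (auto simp: power_mult_distrib)
  have ne: "scl \<zeta> (qs ! k) \<noteq> p" using nth_simps(4)[OF assms(1)] by auto
  then show "len (rfl p (scl \<zeta> (qs ! k))) = 1"
    using nth_simps[OF assms(1)] p_simps nz by (intro len_rfl) auto
  show "len (rfl p (scl \<zeta> (qs ! k)) + q) = 1 + len q" if "app q p = p"
    using len_rfl_plus[OF that ne] nth_simps[OF assms(1)] p_simps nz by simp
qed

lemma rfl_e:
  assumes "\<zeta> ^ d = 1"
  shows "good (rfl p (scl \<zeta> e))" "len (rfl p (scl \<zeta> e)) = 1"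
    "app q p = p \<Longrightarrow> len (rfl p (scl \<zeta> e) + q) = 1 + len q"
proof -
  have nz: "\<zeta> \<noteq> 0" using assms(1) root_nonzero by blast
  show "good (rfl p (scl \<zeta> e))" using p_simps n0 assms(1) by (intro good_rfl) auto
  have ne: "scl \<zeta> e \<noteq> p" using p_simps by auto
  then show "len (rfl p (scl \<zeta> e)) = 1" using p_simps nz by (intro len_rfl) auto
  show "len (rfl p (scl \<zeta> e) + q) = 1 + len q" if "app q p = p"
    using len_rfl_plus[OF that ne] p_simps nz by simp
qed

lemma good_r: "good r" "len r = 1" "good r'" "len r' = 1"
  unfolding r_def r'_def using rfl_e[of 1] rfl_e[OF \<omega>(1)] by simp_all

lemma fixes_p:
  "q \<in> A qs \<Longrightarrow> app q p = p" "q \<in> D qs \<Longrightarrow> app q p = p"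
  "q \<in> A (take k qs) + D (drop k qs) \<Longrightarrow> app q p = p"
  "q \<in> A (drop k qs) + D (take k qs) \<Longrightarrow> app q p = p"
  "q \<in> A (take k qs) + A (drop k qs) \<Longrightarrow> app q p = p"
  using A_fixes[of _ _ p] D_fixes[of _ _ p] p_notin p_simps sublists(8,9)[of k]
  by (auto simp: set_plus_def)

lemma fixes_e: "q \<in> A qs \<Longrightarrow> app q e = e" "q \<in> A (take k qs) + A (drop k qs) \<Longrightarrow> app q e = e"
  using A_fixes[of _ _ e] n0_notin sublists(6,7)[of k] by (auto simp: set_plus_def)

text \<open>The fibre over \<open>p\<close> is \<open>D qs\<close>, one too small in the sum of
  ranks, and the fibre over \<open>qs ! 0\<close> is its translate by one reflection, one too
  large.\<close>

lemma nice_F_0: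
  assumes "qs \<noteq> []" "nice (Suc (length qs)) (D qs)"
  shows "nice (Suc (Suc (length qs))) (F p \<union> F (qs ! 0))"
proof -
  have k: "0 < length qs" using assms(1) by simp
  have "nice (2 * len (0 :: mperm) + 1 + Suc (length qs)) ((+) 0 ` D qs \<union> (+) (0 + rfl p (qs ! 0)) ` D qs)"
    using rfl_nth[OF k, of 1] fixes_p(2) nth_simps[OF k] p_simps
    by (intro nice_double[OF assms(2) good_zero]) auto
  moreover have "F (qs ! 0) = (+) (rfl p (qs ! 0)) ` D qs" using F_nth[OF k] by (simp add: zero_set_plus)
  ultimately show ?thesis unfolding F_p by simp
qed

text \<open>The count is 2 + (k - 1) + (L - k + 1) = L + 2. For \<open>k = 0\<close> the truncated
  subtraction in the length of the empty arc would spoil it.\<close>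

lemma nice_F_nth:
  assumes k: "k < length qs" "k \<noteq> 0" and D: "nice (Suc (length (drop k qs))) (D (drop k qs))"
  shows "nice (Suc (Suc (length qs))) (F (qs ! k))"
proof -
  have "nice (length (take k qs) - 1 + Suc (length (drop k qs))) (A (take k qs) + D (drop k qs))"
  proof (rule nice_plus_cyc[OF nice_cyc D])
    show "fixes_all q (take k qs)" if "q \<in> D (drop k qs)" for q
      using that sublists[of k] unfolding D_def
      by (intro below_fixes_all[of q "cyc \<omega> (drop k qs) + E"] fixes_all_plus fixes_all_cyc fixes_all_E) auto
  qed (rule sublists)+
  then have "nice (2 * len (rfl p (qs ! k)) + (length (take k qs) - 1 + Suc (length (drop k qs)))) (F (qs ! k))"
    unfolding F_nth[OF k(1)]
    using rfl_nth[OF k(1), of 1] fixes_p(3) by (intro nice_shift) auto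
  then show ?thesis using rfl_nth(2)[OF k(1), of 1] k by (simp add: Suc_diff_Suc)
qed

text \<open>The count is 2 + (L - k - 1) + (k + 1) = L + 2. For \<open>k = 0\<close> the coloured
  part is \<open>D []\<close>, whose sum is 0 and not 1.\<close>

lemma nice_F_nth':
  assumes k: "k < length qs" "k \<noteq> 0" and D: "nice (Suc (length (take k qs))) (D (take k qs))"
  shows "nice (Suc (Suc (length qs))) (F (scl (1 / \<omega>) (qs ! k)))"
proof -
  have \<omega>': "(1 / \<omega>) ^ d = 1" using \<omega> by (simp add: power_divide)
  have "nice (length (drop k qs) - 1 + Suc (length (take k qs))) (A (drop k qs) + D (take k qs))"
  proof (rule nice_plus_cyc[OF nice_cyc D])
    show "fixes_all q (drop k qs)" if "q \<in> D (take k qs)" for q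
      using that sublists[of k] unfolding D_def
      by (intro below_fixes_all[of q "cyc \<omega> (take k qs) + E"] fixes_all_plus fixes_all_cyc fixes_all_E) auto
  qed (rule sublists)+
  then have "nice (2 * len (rfl p (scl (1 / \<omega>) (qs ! k))) + (length (drop k qs) - 1 + Suc (length (take k qs))))
      (F (scl (1 / \<omega>) (qs ! k)))"
    unfolding F_nth'[OF k(1)]
    using rfl_nth[OF k(1) \<omega>'] fixes_p(4) by (intro nice_shift) auto
  moreover have "2 * len (rfl p (scl (1 / \<omega>) (qs ! k))) + (length (drop k qs) - 1 + Suc (length (take k qs))) =
      Suc (Suc (length qs))"
    using rfl_nth(2)[OF k(1) \<omega>'] k by simp
  ultimately show ?thesis by simp
qed

lemma nice_F_e:
  assumes \<zeta>: "\<zeta> ^ d = 1"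
  shows "nice (Suc (Suc (length qs))) (F (scl \<zeta> e))"
proof -
  have \<omega>\<zeta>: "(\<omega> * \<zeta>) ^ d = 1" using \<zeta> \<omega> by (simp add: power_mult_distrib)
  let ?A = "A (scl (\<omega> * \<zeta>) e # qs)"
  have fp: "app q p = p" if "q \<in> ?A" for q
    using that p_notin p_simps by (intro A_fixes[of q "scl (\<omega> * \<zeta>) e # qs" p]) auto
  have "nice (2 * len (rfl p (scl \<zeta> e)) + (length (scl (\<omega> * \<zeta>) e # qs) - 1)) (F (scl \<zeta> e))"
    unfolding F_e[OF \<zeta>]
  proof (rule nice_shift[OF nice_cyc])
    show "rpts (scl (\<omega> * \<zeta>) e # qs)" by (rule rpts_e[OF \<omega>\<zeta>])
    show "good (rfl p (scl \<zeta> e))" by (rule rfl_e(1)[OF \<zeta>])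
    show "len (rfl p (scl \<zeta> e) + q) = len (rfl p (scl \<zeta> e)) + len q" if "q \<in> ?A" for q
      using rfl_e(2,3)[OF \<zeta>] fp[OF that] by simp
  qed
  then show ?thesis using rfl_e(2)[OF \<zeta>] by simp
qed

text \<open>The three fibres of \<open>w \<mapsto> app w p\<close> over \<open>e\<close>, \<open>scl \<omega> p\<close> and \<open>scl (1 / \<omega>) (qs ! 0)\<close> are not
  rank-symmetric one by one. Their union is regrouped into two doubled copies of \<open>A qs\<close> and
  translates of products.\<close>

lemma nice_star:
  assumes ne: "qs \<noteq> []"
  shows "nice (Suc (Suc (length qs))) (F (scl (1 / \<omega>) (qs ! 0)) \<union> F e \<union> F (scl \<omega> p))"
proof -
  let ?L = "length qs" and ?y0 = "scl (1 / \<omega>) (qs ! 0)"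
  have k0: "0 < ?L" using ne by simp
  have \<omega>': "(1 / \<omega>) ^ d = 1" using \<omega> by (simp add: power_divide)
  define s where "s = rfl p ?y0"
  define t where "t k = rfl (scl \<omega> e) (qs ! k)" for k
  \<comment> \<open>For \<open>k = ?L\<close> the fibre over \<open>scl \<omega> p\<close>, too
    high, is paired with the part \<open>r A qs\<close> of the fibre over \<open>e\<close>; for
    \<open>k = 0\<close> the fibre over \<open>?y0\<close>, too low, is paired with the part
    \<open>r t_0 A qs\<close>. The other parts of the fibre over \<open>e\<close> have sum 4 + (k -
    1) + (L - k - 1) = L + 2.\<close>
  define P where "P k = (if k = ?L then (+) r ` A qs \<union> (+) (r + r') ` A qs
    else if k = 0 then (+) s ` A qs \<union> (+) (s + r) ` A qs
    else (+) (r + t k) ` (A (take k qs) + A (drop k qs)))" for k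
  \<comment> \<open>Conjugation by \<open>r\<close> turns \<open>t 0\<close> into \<open>s\<close>,
    so the piece \<open>r t_0 A qs\<close> is \<open>s r A qs\<close> and differs from
    \<open>s A qs\<close> by the reflection \<open>r\<close>.\<close>
  have sr: "s + r = r + t 0"
  proof -
    have "r + t 0 = rfl (app r (scl \<omega> e)) (app r (qs ! 0)) + r"
      unfolding t_def by (rule rfl_conj)
    also have "app r (scl \<omega> e) = scl \<omega> p" unfolding r_def using p_simps by (subst app_scl) simp
    also have "app r (qs ! 0) = qs ! 0" unfolding r_def using nth_simps[OF k0] by simp
    also have "rfl (scl \<omega> p) (qs ! 0) = s"
      unfolding s_def using rfl_scl[of \<omega> p ?y0] by simp
    finally show ?thesis ..
  qed
  have t: "good (t k)" "len (t k + q) = 1 + len q" "app (t k + q) p = p"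
      "app (t k + q) e = scl (1 / \<omega>) (qs ! k)"
    if k: "k < ?L" and q: "app q p = p" "app q e = e" for k q
  proof -
    note y = nth_simps[OF k]
    have "good (rfl (scl \<omega> e) (qs ! k))" using y n0 \<omega> by (intro good_rfl) auto
    then show "good (t k)" unfolding t_def .
    have "t k = rfl e (scl (1 / \<omega>) (qs ! k))"
      unfolding t_def using rfl_scl[of \<omega> e "scl (1 / \<omega>) (qs ! k)"] by simp
    moreover have "scl (1 / \<omega>) (qs ! k) \<noteq> e" using y(6) by (metis e_simps(1) fst_scl)
    ultimately show "len (t k + q) = 1 + len q" "app (t k + q) e = scl (1 / \<omega>) (qs ! k)"
      using len_rfl_plus[OF q(2), of "scl (1 / \<omega>) (qs ! k)"] y q by simp_all
    show "app (t k + q) p = p" unfolding t_def using y p_simps q by simp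
  qed
  have len_t: "len (t k) = 1" if "k < ?L" for k using t(2)[OF that, of 0] by simp
  have lr: "len (r + x) = 1 + len x" if "app x p = p" for x
    using rfl_e(3)[of 1 x] that unfolding r_def by simp
  have ls: "len (s + x) = 1 + len x" if "app x p = p" for x
    using rfl_nth(3)[OF k0 \<omega>' that] unfolding s_def .
  have lrr: "len (r + r' + q) = 2 + len q" if "app q p = p" "app q e = e" for q
  proof -
    have "app (E + q) p = p" using that app_E[of p] p_simps by simp
    moreover have "scl \<omega> p \<noteq> p" using \<omega> p_simps by (auto simp: prod_eq_iff)
    ultimately have "len (rfl p (scl \<omega> p) + (E + q)) = 1 + len (E + q)"
      using len_rfl_plus[of "E + q" p "scl \<omega> p"] p_simps by simp
    moreover have "scl (1 / \<omega>) e \<noteq> e" using \<omega> by (auto simp: prod_eq_iff)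
    then have "len (E + q) = 1 + len q"
      unfolding E_def using len_rfl_plus[OF that(2), of "scl (1 / \<omega>) e"] by simp
    ultimately show ?thesis unfolding r_r' by (simp add: add.assoc)
  qed
  have lsr: "len (s + r + q) = 2 + len q" if "app q p = p" "app q e = e" for q
    unfolding sr add.assoc using lr[OF t(3)[OF k0 that]] t(2)[OF k0 that] by simp
  have "F e = (+) r ` A (scl \<omega> e # qs)" using F_e[of 1] by (simp add: r_def)
  also have "A (scl \<omega> e # qs) = A qs \<union> (\<Union>k<?L. (+) (t k) ` (A (take k qs) + A (drop k qs)))"
  proof -
    have "below (cyc 1 (take k qs) + (cyc 1 (drop k qs) + 0)) = A (take k qs) + A (drop k qs)" for k
      using below_cyc_plus[of "take k qs" "cyc 1 (drop k qs)"] fixes_all_cyc sublists[of k] by simp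
    then show ?thesis
      using below_cyc_Cons[of "scl \<omega> e" qs 0] rpts_imp_pts[OF rpts_e[OF \<omega>(1)]] by (simp add: t_def)
  qed
  finally have Fe: "F e = (+) r ` A qs \<union> (\<Union>k<?L. (+) (r + t k) ` (A (take k qs) + A (drop k qs)))"
    by (simp add: image_Un image_UN image_image add.assoc)
  have F0: "F ?y0 = (+) s ` A qs"
    using F_nth'[OF k0] by (simp add: D_Nil s_def zero_set_plus)
  have un: "F ?y0 \<union> F e \<union> F (scl \<omega> p) = (\<Union>k\<in>{..?L}. P k)"
  proof -
    have "{..?L} = insert ?L (insert 0 {0<..<?L})" "{..<?L} = insert 0 {0<..<?L}" using k0 by auto
    moreover have "(\<Union>k\<in>{0<..<?L}. P k) = (\<Union>k\<in>{0<..<?L}. (+) (r + t k) ` (A (take k qs) + A (drop k qs)))"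
      by (rule SUP_cong) (auto simp: P_def)
    moreover have "P ?L = (+) r ` A qs \<union> (+) (r + r') ` A qs" "P 0 = (+) s ` A qs \<union> (+) (r + t 0) ` A qs"
      using k0 by (simp_all add: P_def sr)
    ultimately show ?thesis unfolding Fe F0 F_scale by (simp only: UN_insert Un_ac take_0 drop_0 cyc.simps(1) below_zero zero_set_plus)
  qed
  have ne_pts: "scl \<omega> p \<noteq> e" "scl \<omega> p \<noteq> ?y0" "e \<noteq> ?y0" "?y0 \<noteq> e" "p \<noteq> ?y0"
    using nth_simps[OF k0] p_simps by (auto simp: prod_eq_iff)
  show ?thesis
    unfolding un
  \<comment> \<open>All pieces of the fibre over \<open>e\<close> agree at \<open>p\<close>, so they
    are told apart by their value at \<open>e\<close>. The key overrides this value on the two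
    attached fibres.\<close>
  proof (rule nice_UN[where key = "\<lambda>w. if app w p = scl \<omega> p then p else if app w p = ?y0 then ?y0 else app w e"
        and l = "\<lambda>k. if k = ?L then p else scl (1 / \<omega>) (qs ! k)"])
    fix k assume "k \<in> {..?L}"
    then consider "k = ?L" | "k = 0" "k \<noteq> ?L" | "0 < k" "k < ?L" using k0 by fastforce
    note k_cases = this
    show "nice (Suc (Suc ?L)) (P k)"
      using k_cases
    proof cases
      case 1
      have "nice (2 * len r + 1 + (?L - 1)) ((+) r ` A qs \<union> (+) (r + rfl p (scl \<omega> e)) ` A qs)"
      proof (rule nice_double[OF nice_cyc[OF rpts_qs] good_r(1)])
        show "len (r + rfl p (scl \<omega> e)) = Suc (len r)" using lrr[of 0] good_r(2) by (simp add: r'_def)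
        show "good (rfl p (scl \<omega> e))" using good_r(3) by (simp add: r'_def)
        show "len (r + rfl p (scl \<omega> e) + q) = Suc (len r) + len q" if "q \<in> A qs" for q
          using lrr[of q] fixes_p(1)[OF that] fixes_e(1)[OF that] good_r(2) by (simp add: r'_def)
        show "len (r + q) = len r + len q" if "q \<in> A qs" for q
          using lr fixes_p(1)[OF that] good_r(2) by simp
      qed (use fixes_p(1) p_simps in auto)
      then show ?thesis using 1 k0 good_r(2) by (simp add: P_def r'_def)
    next
      case 2
      have s: "good s" "len s = 1" using rfl_nth(1,2)[OF k0 \<omega>'] by (simp_all add: s_def)
      have "nice (2 * len s + 1 + (?L - 1)) ((+) s ` A qs \<union> (+) (s + rfl p e) ` A qs)"
      proof (rule nice_double[OF nice_cyc[OF rpts_qs] s(1)])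
        show "len (s + rfl p e) = Suc (len s)" using lsr[of 0] s(2) by (simp add: r_def)
        show "good (rfl p e)" using good_r(1) by (simp add: r_def)
        show "len (s + rfl p e + q) = Suc (len s) + len q" if "q \<in> A qs" for q
          using lsr[of q] fixes_p(1)[OF that] fixes_e(1)[OF that] s(2) by (simp add: r_def)
        show "len (s + q) = len s + len q" if "q \<in> A qs" for q
          using ls fixes_p(1)[OF that] s(2) by simp
      qed (use fixes_p(1) p_simps in auto)
      then show ?thesis using 2 k0 s(2) by (simp add: P_def r_def)
    next
      case 3
      have rt: "len (r + t k) = 2" using lr[of "t k"] t(3)[OF 3(2), of 0] len_t[OF 3(2)] by simp
      have "nice (length (take k qs) - 1 + (length (drop k qs) - 1)) (A (take k qs) + A (drop k qs))"
      proof (rule nice_plus_cyc[OF nice_cyc nice_cyc])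
        show "fixes_all q (take k qs)" if "q \<in> A (drop k qs)" for q
          using that sublists[of k] by (intro below_fixes_all[of q "cyc 1 (drop k qs)"] fixes_all_cyc) auto
      qed (rule sublists)+
      then have "nice (2 * len (r + t k) + (length (take k qs) - 1 + (length (drop k qs) - 1)))
          ((+) (r + t k) ` (A (take k qs) + A (drop k qs)))"
      proof (rule nice_shift)
        show "good (r + t k)"
          using good_plus[of r "t k"] good_r t(1)[OF 3(2), of 0] rt len_t[OF 3(2)] by simp
        show "len (r + t k + q) = len (r + t k) + len q" if "q \<in> A (take k qs) + A (drop k qs)" for q
          unfolding rt add.assoc
          using lr[OF t(3)[OF 3(2) fixes_p(5)[OF that] fixes_e(2)[OF that]]]
            t(2)[OF 3(2) fixes_p(5)[OF that] fixes_e(2)[OF that]] by simp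
      qed
      then show ?thesis using 3 rt by (simp add: P_def)
    qed
    show "(if app w p = scl \<omega> p then p else if app w p = ?y0 then ?y0 else app w e) =
        (if k = ?L then p else scl (1 / \<omega>) (qs ! k))" if w: "w \<in> P k" for w
      using k_cases
    proof cases
      case 1
      then obtain a where a: "a \<in> A qs" "w = r + a \<or> w = r + r' + a" using w by (auto simp: P_def)
      have fx: "app a p = p" "app a e = e" using fixes_p(1) fixes_e(1) a(1) by auto
      have "app (r + a) p = e" "app (r + a) e = p" using fx p_simps by (auto simp: r_def)
      moreover have "app (r + r' + a) p = scl \<omega> p"
        unfolding r_r' using fx app_E[of p] p_simps by simp
      ultimately show ?thesis using a(2) 1 ne_pts by auto
    next
      case 2
      then obtain a where a: "a \<in> A qs" "w = s + a \<or> w = s + r + a" using w by (auto simp: P_def)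
      have fx: "app a p = p" "app a e = e" using fixes_p(1) fixes_e(1) a(1) by auto
      have "app (s + a) p = ?y0" using fx p_simps nth_simps[OF k0] by (simp add: s_def)
      moreover have "app (s + r + a) p = e" "app (s + r + a) e = ?y0"
        using fx p_simps nth_simps[OF k0] by (simp_all add: s_def r_def)
      ultimately show ?thesis using a(2) 2 ne_pts by auto
    next
      case 3
      then obtain q where q: "q \<in> A (take k qs) + A (drop k qs)" "w = r + t k + q" using w by (auto simp: P_def)
      note tk = t[OF 3(2) fixes_p(5)[OF q(1)] fixes_e(2)[OF q(1)]]
      have "w = r + (t k + q)" using q(2) by (simp add: add.assoc)
      then have "app w p = e" "app w e = app r (scl (1 / \<omega>) (qs ! k))"
        using tk(3,4) p_simps by (simp_all add: r_def del: app_scl)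
      moreover have "app r (scl (1 / \<omega>) (qs ! k)) = scl (1 / \<omega>) (qs ! k)"
        unfolding r_def using nth_simps[OF 3(2)] by (intro app_rfl_other) auto
      ultimately show ?thesis using 3 ne_pts by auto
    qed
  next
    have "distinct (map fst qs)" using rpts_qs by (simp add: rpts_def)
    then have "i = j" if "i < ?L" "j < ?L" "scl (1 / \<omega>) (qs ! i) = scl (1 / \<omega>) (qs ! j)" for i j
      using that by (metis distinct_map fst_scl inj_on_def nth_eq_iff_index_eq nth_mem)
    moreover have "p \<noteq> scl (1 / \<omega>) (qs ! j)" if "j < ?L" for j using nth_simps[OF that] by auto
    ultimately show "inj_on (\<lambda>k. if k = ?L then p else scl (1 / \<omega>) (qs ! k)) {..?L}"
      unfolding inj_on_def by (metis atMost_iff le_neq_implies_less)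
  qed
qed

text \<open>The dihedral case. The interval consists of the identity, the product
  \<open>r + r'\<close> and the reflections \<open>rfl p (scl \<zeta> e)\<close>. The identity,
  \<open>r\<close>, \<open>r'\<close> and their product form a square, and every other reflection is
  a one-element cube in the middle rank.\<close>

lemma nice_base:
  assumes "qs = []"
  shows "nice 2 X"
proof (rule nice_fibres[where key = "\<lambda>w. if app w p \<in> {p, scl \<omega> p, scl \<omega> e} then e else app w p"])
  fix v
  have Fp: "F p = {0}" using F_p D_Nil assms by simp
  have Fs: "F (scl \<omega> p) = {r + r'}" using F_scale assms by simp
  have Fe: "F (scl \<zeta> e) = {rfl p (scl \<zeta> e)}" if "\<zeta> ^ d = 1" for \<zeta>
    using F_e[OF that] assms by simp
  have lrr: "len (r + r') = 2"
    unfolding r_r' using len_cyc_plus[of "[p]" \<omega> E] fixes_E \<omega> p_simps len_E by simp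
  have rr: "r + r = 0" "- r = r" "r' + r' = 0" "- r' = r'"
    unfolding r_def r'_def using p_simps by (simp_all add: uminus_rfl_swap)
  show "nice 2 {w \<in> X. (if app w p \<in> {p, scl \<omega> p, scl \<omega> e} then e else app w p) = v}"
  proof (cases "v = e")
    case True
    have "{w \<in> X. (if app w p \<in> {p, scl \<omega> p, scl \<omega> e} then e else app w p) = v} =
      F p \<union> F (scl \<omega> p) \<union> F (scl \<omega> e) \<union> F (scl 1 e)"
      unfolding True by (auto simp: F_def split: if_splits)
    also have "\<dots> = {0, r} + {0, r'}"
      unfolding Fp Fs Fe[OF \<omega>(1)] Fe[OF power_one] by (auto simp: set_plus_def r_def r'_def)
    also have "nice (1 + 1) \<dots>"
    proof (rule nice_plus)
      show "nice 1 {0, r}" "nice 1 {0, r'}"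
        using nice_pair[OF good_zero, of r 1] nice_pair[OF good_zero, of r' 1] good_r by simp_all
      show "len (x + y) = len x + len y" if "x \<in> {0, r}" "y \<in> {0, r'}" for x y
        using that lrr good_r by auto
      show "len ((- x + x') + (y' + - y)) = len (- x + x') + len (y' + - y)"
        if "x \<in> {0, r}" "x' \<in> {0, r}" "y \<in> {0, r'}" "y' \<in> {0, r'}" for x x' y y'
        using that lrr good_r by (auto simp: rr)
    qed
    finally show ?thesis by (simp add: numeral_2_eq_2)
  next
    case False
    show ?thesis
    proof (cases "v \<notin> {p, scl \<omega> p, scl \<omega> e} \<and> F v \<noteq> {}")
      case True
      have sub: "{w \<in> X. (if app w p \<in> {p, scl \<omega> p, scl \<omega> e} then e else app w p) = v} = F v"
        using True False by (auto simp: F_def)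
      obtain w where w: "w \<in> X" "app w p = v" using True by (auto simp: F_def)
      obtain \<zeta> where "\<zeta> ^ d = 1" "v = scl \<zeta> e"
        using w(1) by (rule moves_within) (use True w(2) assms in auto)
      then show ?thesis unfolding sub using Fe rfl_e[of \<zeta>] by (simp add: nice_single)
    next
      case f: False
      have "{w \<in> X. (if app w p \<in> {p, scl \<omega> p, scl \<omega> e} then e else app w p) = v} = {}"
        using False f by (auto simp: F_def split: if_splits)
      then show ?thesis by (simp only: nice_empty)
    qed
  qed
qed

lemma nice_step:
  assumes ne: "qs \<noteq> []"
    and IH: "\<And>rs. length rs \<le> length qs \<Longrightarrow> rs \<noteq> [] \<Longrightarrow> rpts rs \<Longrightarrow> n0 \<notin> fst ` set rs \<Longrightarrow> nice (Suc (length rs)) (D rs)"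
  shows "nice (Suc (Suc (length qs))) X"
proof -
  let ?y0 = "scl (1 / \<omega>) (qs ! 0)"
  \<comment> \<open>The key merges the fibres over \<open>p\<close> and \<open>qs ! 0\<close> for
    \<open>nice_F_0\<close>, and those over \<open>e\<close>, \<open>scl \<omega> p\<close> and
    \<open>?y0\<close> for \<open>nice_star\<close>. The other fibres remain separate and are
    centred.\<close>
  define key where "key w = (if app w p = p then qs ! 0 else if app w p \<in> {scl \<omega> p, ?y0} then e else app w p)" for w
  have k0: "0 < length qs" using ne by simp
  have ne_pts: "qs ! 0 \<noteq> e" "qs ! 0 \<noteq> p" "scl \<omega> p \<noteq> p" "scl \<omega> p \<noteq> qs ! 0" "?y0 \<noteq> p" "?y0 \<noteq> qs ! 0"
    "e \<noteq> p" "scl \<omega> p \<noteq> e" "?y0 \<noteq> e"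
    using nth_simps[OF k0] p_simps \<omega> by (auto simp: prod_eq_iff field_simps)
  show ?thesis
  proof (rule nice_fibres[where key = key])
    fix v
    show "nice (Suc (Suc (length qs))) {w \<in> X. key w = v}"
    proof (cases "v = qs ! 0 \<or> v = e")
      case True
      then show ?thesis
      proof
        assume v: "v = qs ! 0"
        have "{w \<in> X. key w = v} = F p \<union> F (qs ! 0)"
          unfolding v key_def F_def using ne_pts by (auto split: if_splits)
        moreover have "nice (Suc (length qs)) (D qs)" using IH[of qs] ne rpts_qs n0_notin by simp
        ultimately show ?thesis using nice_F_0[OF ne] by simp
      next
        assume v: "v = e"
        have "{w \<in> X. key w = v} = F ?y0 \<union> F e \<union> F (scl \<omega> p)"
          unfolding v key_def F_def using ne_pts by (auto split: if_splits)
        then show ?thesis using nice_star[OF ne] by simp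
      qed
    next
      case v: False
      show ?thesis
      proof (cases "v \<notin> {p, scl \<omega> p, ?y0} \<and> F v \<noteq> {}")
        case True
        have sub: "{w \<in> X. key w = v} = F v"
          using True v unfolding key_def F_def by auto
        obtain w where w: "w \<in> X" "app w p = v" using True by (auto simp: F_def)
        show ?thesis
          using w(1)
        proof (cases rule: moves_within)
          case (3 \<zeta>)
          then show ?thesis using nice_F_e[of \<zeta>] w(2) sub by simp
        next
          case (4 k)
          then have "k \<noteq> 0" using v w(2) by (cases k) auto
          moreover have "nice (Suc (length (drop k qs))) (D (drop k qs))"
            using 4(1) sublists[of k] by (intro IH) auto
          ultimately show ?thesis using nice_F_nth[of k] 4 w(2) sub by simp
        next
          case (5 k)
          then have "k \<noteq> 0" using True w(2) by (cases k) auto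
          moreover have "nice (Suc (length (take k qs))) (D (take k qs))"
            using 5(1) sublists[of k] ne \<open>k \<noteq> 0\<close> by (intro IH) auto
          ultimately show ?thesis using nice_F_nth'[of k] 5 w(2) sub by simp
        qed (use True w(2) in auto)
      next
        case f: False
        have "{w \<in> X. key w = v} = {}"
          using v f unfolding key_def F_def by (auto split: if_splits)
        then show ?thesis by (simp only: nice_empty)
      qed
    qed
  qed
qed

end

context gddn_coxeter
begin

theorem nice_D:
  "rpts ps \<Longrightarrow> n0 \<notin> fst ` set ps \<Longrightarrow> ps \<noteq> [] \<Longrightarrow> nice (Suc (length ps)) (D ps)"
proof (induction ps rule: length_induct)
  case (1 ps)
  obtain p qs where ps: "ps = p # qs" using 1(4) by (cases ps) auto
  interpret gddn_step d n n0 \<omega> p qs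
    by unfold_locales (use 1(2,3) ps in auto)
  show ?case
  proof (cases "qs = []")
    case True
    then show ?thesis using nice_base unfolding X_def ps by (simp add: numeral_2_eq_2)
  next
    case False
    have "nice (Suc (Suc (length qs))) X"
      using False
    proof (rule nice_step)
      show "nice (Suc (length rs)) (D rs)"
        if "length rs \<le> length qs" "rs \<noteq> []" "rpts rs" "n0 \<notin> fst ` set rs" for rs
        using 1(1) that ps by simp
    qed
    then show ?thesis by (simp add: ps X_def)
  qed
qed

end

section \<open>Matrices\<close>

context gddn
begin

definition matof :: "mperm \<Rightarrow> complex mat" where
  "matof w = mat n n (\<lambda>(i, j). if fst (app w (j, 1)) = i then snd (app w (j, 1)) else 0)"

lemma matof_carrier [simp]: "matof w \<in> carrier_mat n n" "dim_row (matof w) = n" "dim_col (matof w) = n"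
  by (simp_all add: matof_def)

lemma matof_index: "i < n \<Longrightarrow> j < n \<Longrightarrow>
    matof w $$ (i, j) = (if fst (app w (j, 1)) = i then snd (app w (j, 1)) else 0)"
  by (simp add: matof_def)

lemma matof_zero: "matof 0 = 1\<^sub>m n"
  by (rule eq_matI) (auto simp: matof_index)

lemma matof_plus: "supported v \<Longrightarrow> matof (u + v) = matof u * matof v"
proof (rule eq_matI)
  fix i j assume v: "supported v" and "i < dim_row (matof u * matof v)" "j < dim_col (matof u * matof v)"
  then have ij: "i < n" "j < n" by auto
  define k where "k = fst (app v (j, 1))"
  have k: "k < n" unfolding k_def using supported_less[OF v ij(2)] .
  have "(matof u * matof v) $$ (i, j) = (\<Sum>l<n. matof u $$ (i, l) * matof v $$ (l, j))"
    using ij by (simp add: scalar_prod_def atLeast0LessThan)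
  also have "\<dots> = (\<Sum>l<n. if k = l then matof u $$ (i, k) * snd (app v (j, 1)) else 0)"
    using ij by (intro sum.cong) (auto simp: matof_index k_def)
  also have "\<dots> = matof u $$ (i, k) * snd (app v (j, 1))" using k by simp
  also have "\<dots> = matof (u + v) $$ (i, j)"
  proof -
    have "fst (app (u + v) (j, 1)) = fst (app u (k, 1))"
      unfolding k_def app_plus by (rule fst_app)
    then show ?thesis
      using ij k snd_app_plus[of u v j] by (simp add: matof_index k_def del: app_plus)
  qed
  finally show "matof (u + v) $$ (i, j) = (matof u * matof v) $$ (i, j)" ..
qed simp_all

lemma matof_eq_imp:
  assumes "matof u = matof v" "supported u" "supported v"
  shows "u = v"
proof (rule mperm_eqI)
  fix j
  show "app u (j, 1) = app v (j, 1)"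
  proof (cases "j < n")
    case True
    define i where "i = fst (app u (j, 1))"
    have i: "i < n" unfolding i_def using supported_less[OF assms(2) True] .
    have "matof u $$ (i, j) = snd (app u (j, 1))" using i True by (simp add: matof_index i_def)
    moreover have "snd (app u (j, 1)) \<noteq> 0" by (simp add: snd_app_nonzero)
    ultimately have "matof v $$ (i, j) = snd (app u (j, 1))" "matof v $$ (i, j) \<noteq> 0" using assms(1) by auto
    then have "fst (app v (j, 1)) = i" "snd (app v (j, 1)) = snd (app u (j, 1))"
      using i True by (auto simp: matof_index split: if_splits)
    then show ?thesis by (simp add: prod_eq_iff i_def)
  next
    case False
    then show ?thesis using assms by (simp add: supported_def)
  qed
qed

lemma W_supported: "w \<in> W \<Longrightarrow> supported w"
  by (simp add: W_def)

lemma matof_eq_iff: "u \<in> W \<Longrightarrow> v \<in> W \<Longrightarrow> matof u = matof v \<longleftrightarrow> u = v"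
  using matof_eq_imp W_supported by blast

lemma mperm_exists:
  assumes "bij_betw \<sigma> {..<n} {..<n}" "\<And>j. j < n \<Longrightarrow> a j \<noteq> 0"
  obtains w where "supported w" "\<And>j. j < n \<Longrightarrow> app w (j, 1) = (\<sigma> j, a j)"
proof -
  define f where "f p = (if fst p < n then (\<sigma> (fst p), a (fst p) * snd p) else p)" for p :: "nat \<times> complex"
  define \<tau> where "\<tau> = inv_into {..<n} \<sigma>"
  define f' where "f' p = (if fst p < n then (\<tau> (fst p), snd p / a (\<tau> (fst p))) else p)" for p :: "nat \<times> complex"
  have \<sigma>: "\<sigma> j < n" "\<tau> (\<sigma> j) = j" if "j < n" for j
    using assms(1) that by (auto simp: \<tau>_def bij_betw_def)
  have \<tau>: "\<tau> j < n" "\<sigma> (\<tau> j) = j" if "j < n" for j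
  proof -
    have "j \<in> \<sigma> ` {..<n}" using assms(1) that by (auto simp: bij_betw_def)
    then show "\<tau> j < n" "\<sigma> (\<tau> j) = j"
      unfolding \<tau>_def using inv_into_into[of j \<sigma> "{..<n}"] f_inv_into_f[of j \<sigma> "{..<n}"] by auto
  qed
  have "f' (f p) = p" "f (f' p) = p" for p
    unfolding f_def f'_def using \<sigma>[of "fst p"] \<tau>[of "fst p"] assms(2)[of "fst p"] assms(2)[of "\<tau> (fst p)"] by auto
  then have "bij f" by (intro o_bij[of f']) (simp_all add: fun_eq_iff)
  moreover have "f (scl c p) = scl c (f p)" for c p
    by (simp add: f_def scl_def)
  moreover have "finite {i. f (i, 1) \<noteq> (i, 1)}"
    by (rule finite_subset[of _ "{..<n}"]) (auto simp: f_def split: if_splits)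
  ultimately have f: "app (Mperm f) = f" by (intro Mperm_inverse) blast
  show ?thesis
    by (rule that[of "Mperm f"]) (simp_all add: f f_def supported_def)
qed

lemma matof_in_Gddn: "w \<in> W \<Longrightarrow> matof w \<in> Gddn d n"
proof -
  assume w: "w \<in> W"
  note s = W_supported[OF w]
  define \<sigma> where "\<sigma> j = fst (app w (j, 1))" for j
  have nz: "snd (app w (j, 1)) \<noteq> 0" for j by (simp add: snd_app_nonzero)
  have ne: "matof w $$ (i, j) \<noteq> 0 \<longleftrightarrow> i = \<sigma> j" if "i < n" "j < n" for i j
    using that nz[of j] by (auto simp: matof_index \<sigma>_def)
  have inj: "\<sigma> i = \<sigma> j \<Longrightarrow> i = j" for i j
    using fst_app_eq_iff[of w "(i, 1)" "(j, 1)"] by (simp add: \<sigma>_def)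
  have lt: "\<sigma> j < n" if "j < n" for j using supported_less[OF s that] by (simp add: \<sigma>_def)
  have "\<sigma> ` {..<n} = {..<n}" using lt inj by (intro endo_inj_surj) (auto simp: inj_on_def)
  then have surj: "\<exists>j<n. i = \<sigma> j" if "i < n" for i using that by (auto simp: set_eq_iff)
  have "\<exists>!j. j < n \<and> matof w $$ (i, j) \<noteq> 0" if "i < n" for i
    using surj[OF that] inj ne[OF that] by metis
  moreover have "\<exists>!i. i < n \<and> matof w $$ (i, j) \<noteq> 0" if "j < n" for j
    using lt[OF that] ne that by metis
  moreover have "(matof w $$ (i, j)) ^ d = 1" if "i < n" "j < n" "matof w $$ (i, j) \<noteq> 0" for i j
    using that w by (auto simp: matof_index W_def split: if_splits)
  moreover have "(\<Prod>p\<in>{(i,j). i < n \<and> j < n \<and> matof w $$ (i,j) \<noteq> 0}. matof w $$ p) = 1"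
  proof -
    have "{(i,j). i < n \<and> j < n \<and> matof w $$ (i,j) \<noteq> 0} = (\<lambda>j. (\<sigma> j, j)) ` {..<n}"
      using ne lt by auto
    moreover have "inj_on (\<lambda>j. (\<sigma> j, j)) {..<n}" by (auto simp: inj_on_def)
    ultimately have "(\<Prod>p\<in>{(i,j). i < n \<and> j < n \<and> matof w $$ (i,j) \<noteq> 0}. matof w $$ p) = (\<Prod>j<n. matof w $$ (\<sigma> j, j))"
      by (simp add: prod.reindex)
    also have "\<dots> = col w"
      unfolding col_def by (rule prod.cong) (use lt in \<open>auto simp: matof_index \<sigma>_def\<close>)
    finally show ?thesis using w by (simp add: W_def)
  qed
  ultimately show ?thesis unfolding Gddn_def by simp
qed

lemma Gddn_matof:
  assumes "g \<in> Gddn d n"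
  obtains w where "w \<in> W" "g = matof w"
proof -
  note * = assms[unfolded Gddn_def mem_Collect_eq]
  note g = *[THEN conjunct1] *[THEN conjunct2, THEN conjunct1, rule_format]
      *[THEN conjunct2, THEN conjunct2, THEN conjunct1, rule_format]
      *[THEN conjunct2, THEN conjunct2, THEN conjunct2, THEN conjunct1, rule_format]
      *[THEN conjunct2, THEN conjunct2, THEN conjunct2, THEN conjunct2]
  define \<sigma> where "\<sigma> j = (THE i. i < n \<and> g $$ (i,j) \<noteq> 0)" for j
  have \<sigma>: "\<sigma> j < n" "g $$ (\<sigma> j, j) \<noteq> 0" if "j < n" for j
    using theI'[OF g(3)[OF that]] by (simp_all add: \<sigma>_def)
  have ne: "g $$ (i, j) \<noteq> 0 \<longleftrightarrow> i = \<sigma> j" if "i < n" "j < n" for i j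
  proof
    show "i = \<sigma> j" if "g $$ (i, j) \<noteq> 0"
      unfolding \<sigma>_def by (rule the1_equality[symmetric, OF g(3)[OF \<open>j < n\<close>]]) (use \<open>i < n\<close> that in simp)
  qed (use \<sigma>[OF that(2)] in simp)
  have inj: "inj_on \<sigma> {..<n}"
  proof (rule inj_onI)
    fix i j assume *: "i \<in> {..<n}" "j \<in> {..<n}" "\<sigma> i = \<sigma> j"
    then have "i < n \<and> g $$ (\<sigma> i, i) \<noteq> 0" "j < n \<and> g $$ (\<sigma> i, j) \<noteq> 0" using \<sigma>[of i] \<sigma>[of j] by simp_all
    moreover have "\<exists>!k. k < n \<and> g $$ (\<sigma> i, k) \<noteq> 0" using g(2) \<sigma>(1)[of i] *(1) by simp
    ultimately show "i = j" by (elim ex1E) metis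
  qed
  have "\<sigma> ` {..<n} = {..<n}" using \<sigma> inj by (intro endo_inj_surj) auto
  then have bij: "bij_betw \<sigma> {..<n} {..<n}" using inj by (simp add: bij_betw_def)
  obtain w where w: "supported w" "\<And>j. j < n \<Longrightarrow> app w (j, 1) = (\<sigma> j, g $$ (\<sigma> j, j))"
    by (rule mperm_exists[OF bij, of "\<lambda>j. g $$ (\<sigma> j, j)"]) (use \<sigma>(2) in blast)+
  have gw: "g = matof w"
  proof (rule eq_matI)
    fix i j assume "i < dim_row (matof w)" "j < dim_col (matof w)"
    then have ij: "i < n" "j < n" by simp_all
    show "g $$ (i, j) = matof w $$ (i, j)"
      using ne[OF ij] w(2)[OF ij(2)] ij by (simp add: matof_index) blast
  qed (use g(1) in auto)
  have "snd (app w (j, 1)) ^ d = 1" for j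
  proof (cases "j < n")
    case True
    then show ?thesis using w(2) \<sigma> g(4) by simp
  next
    case False
    then show ?thesis using w(1) by (simp add: supported_def)
  qed
  moreover have "col w = 1"
  proof -
    have "{(i,j). i < n \<and> j < n \<and> g $$ (i,j) \<noteq> 0} = (\<lambda>j. (\<sigma> j, j)) ` {..<n}"
      using ne \<sigma> by auto
    moreover have "inj_on (\<lambda>j. (\<sigma> j, j)) {..<n}" by (auto simp: inj_on_def)
    ultimately have "(\<Prod>p\<in>{(i,j). i < n \<and> j < n \<and> g $$ (i,j) \<noteq> 0}. g $$ p) = (\<Prod>j<n. g $$ (\<sigma> j, j))"
      by (simp add: prod.reindex)
    also have "\<dots> = col w" unfolding col_def using w(2) by simp
    finally show ?thesis using g(5) by simp
  qed
  ultimately have "w \<in> W" using w(1) by (simp add: W_def)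
  then show ?thesis using that gw by blast
qed

lemma matof_trefl: "t \<in> trefl \<Longrightarrow> matof t \<in> reflections n (Gddn d n)"
proof -
  assume t: "t \<in> trefl"
  then obtain p q where pq: "t = rfl p q" "fst p \<noteq> fst q" "fst p < n" "fst q < n" "snd p ^ d = 1" "snd q ^ d = 1"
    by (auto simp: trefl_def)
  then have nz: "snd p \<noteq> 0" "snd q \<noteq> 0" using root_nonzero by auto
  define b where "b = snd q / snd p"
  have b: "b \<noteq> 0" using nz by (simp add: b_def)
  have app_t: "app t (j, 1) = (if j = fst p then (fst q, b) else if j = fst q then (fst p, 1 / b) else (j, 1))" for j
    using pq(2) nz by (simp add: pq(1) app_rfl b_def)
  have "t \<noteq> 0" using app_t[of "fst p"] pq(2) by auto
  then have "matof t \<noteq> 1\<^sub>m n" using matof_eq_iff[of t 0] t trefl_W W_zero by (auto simp: matof_zero)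
  moreover have "matof t \<in> Gddn d n" using t trefl_W matof_in_Gddn by blast
  moreover have "matof t - 1\<^sub>m n = mat n n (\<lambda>(i, j).
      vec n (\<lambda>i. if i = fst p then 1 else if i = fst q then - b else 0) $ i *
      vec n (\<lambda>j. if j = fst p then - 1 else if j = fst q then 1 / b else 0) $ j)"
    by (rule eq_matI) (use pq(2) b in \<open>auto simp: matof_index app_t\<close>)
  ultimately show ?thesis
    unfolding reflections_def mem_Collect_eq by (meson vec_carrier)
qed

text \<open>If the matrix is the identity plus a product of a column \<open>u\<close> and a row
  \<open>v\<close>, a covector is fixed as soon as it annihilates \<open>u\<close>, so one
  functional suffices.\<close>

lemma len_reflection:
  assumes "matof w \<in> reflections n (Gddn d n)" "supported w"
  shows "len w \<le> 1"
proof -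
  obtain u v where uv: "matof w - 1\<^sub>m n = mat n n (\<lambda>(i, j). u $ i * v $ j)"
    using assms(1) unfolding reflections_def by blast
  have "cuts [\<lambda>x. \<Sum>i<n. x i * u $ i] (Fix w)"
    unfolding cuts_def
  proof (intro conjI allI impI)
    show "\<forall>\<phi>\<in>set [\<lambda>x. \<Sum>i<n. x i * u $ i]. lin \<phi>"
      by (auto simp: lin_def sum.distrib sum_distrib_left algebra_simps)
    fix x :: "nat \<Rightarrow> complex" assume "\<forall>\<phi>\<in>set [\<lambda>x. \<Sum>i<n. x i * u $ i]. \<phi> x = 0"
    then have x: "(\<Sum>i<n. x i * u $ i) = 0" by simp
    show "x \<in> Fix w"
    proof (rule FixI)
      fix j
      show "ev x (app w (j, 1)) = x j"
      proof (cases "j < n")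
        case True
        define k where "k = fst (app w (j, 1))"
        have k: "k < n" unfolding k_def using supported_less[OF assms(2) True] .
        have "(\<Sum>i<n. x i * ((matof w - 1\<^sub>m n) $$ (i, j))) = (\<Sum>i<n. x i * u $ i) * v $ j"
          unfolding uv using True by (simp add: sum_distrib_right mult.assoc)
        also have "\<dots> = 0" using x by simp
        also have "(\<Sum>i<n. x i * ((matof w - 1\<^sub>m n) $$ (i, j))) =
            (\<Sum>i<n. (if k = i then x k * snd (app w (j, 1)) else 0) - (if j = i then x j else 0))"
          using True by (intro sum.cong) (auto simp: matof_index k_def algebra_simps)
        also have "\<dots> = x k * snd (app w (j, 1)) - x j"
          using k True by (simp add: sum_subtractf)
        finally show ?thesis by (simp add: ev_def k_def mult.commute)
      qed (use assms(2) in \<open>simp add: supported_def ev_def\<close>)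
    qed
  qed
  then show ?thesis using len_le by fastforce
qed

lemma mat_list_prod_matof: "set ts \<subseteq> W \<Longrightarrow> mat_list_prod n (map matof ts) = matof (sum_list ts) \<and> sum_list ts \<in> W"
proof (induction ts)
  case Nil
  then show ?case by (simp add: mat_list_prod_def matof_zero W_zero)
next
  case (Cons t ts)
  then have "mat_list_prod n (map matof ts) = matof (sum_list ts)" "sum_list ts \<in> W" "t \<in> W" by auto
  then show ?case
    using matof_plus[OF W_supported] W_plus by (simp add: mat_list_prod_def)
qed

lemma len_sum_list: "(\<And>t. t \<in> set ts \<Longrightarrow> len t \<le> 1) \<Longrightarrow> len (sum_list ts) \<le> length ts"
proof (induction ts)
  case (Cons t ts)
  then show ?case using len_plus_le[of t "sum_list ts"] by fastforce
qed simp

lemma trefl_I: "fst p \<noteq> fst q \<Longrightarrow> fst p < n \<Longrightarrow> fst q < n \<Longrightarrow> snd p ^ d = 1 \<Longrightarrow> snd q ^ d = 1 \<Longrightarrow> rfl p q \<in> trefl"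
  unfolding trefl_def by blast

text \<open>Ensures that the minimum in \<open>abs_len\<close> is attained. Induction on the number
  of moved axes: some reflections reproduce \<open>w\<close> at a moved point and fix all that
  \<open>w\<close> fixes, so their quotient moves fewer axes.\<close>

lemma trefl_generate:
  "w \<in> W \<Longrightarrow> \<exists>ts. set ts \<subseteq> trefl \<and> w = sum_list ts"
proof (induction "card {i. app w (i, 1) \<noteq> (i, 1)}" arbitrary: w rule: less_induct)
  case less
  show ?case
  proof (cases "w = 0")
    case True
    then show ?thesis by (intro exI[of _ "[]"]) simp
  next
    case False
    then obtain i where i: "app w (i, 1) \<noteq> (i, 1)" using mperm_eqI[of w 0] by auto
    have s: "supported w" using less.prems by (rule W_supported)
    have "i < n" using i s by (auto simp: supported_def intro: leI)
    define p where "p = (i, 1 :: complex)"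
    define q where "q = app w p"
    have q: "fst q < n" "snd q ^ d = 1" "snd q \<noteq> 0"
      using supported_less[OF s \<open>i < n\<close>] less.prems root_nonzero by (auto simp: q_def p_def W_def)
    have step: "\<exists>ts. set ts \<subseteq> trefl \<and> w = sum_list ts"
      if rs: "set rs \<subseteq> trefl" "app (sum_list rs) p = q"
        and fixed: "\<And>j. app w (j, 1) = (j, 1) \<Longrightarrow> app (sum_list rs) (j, 1) = (j, 1)" for rs
    proof -
      define w' where "w' = - sum_list rs + w"
      have "sum_list rs \<in> W" using mat_list_prod_matof[of rs] rs(1) trefl_W by blast
      then have "w' \<in> W" unfolding w'_def using less.prems W_plus W_uminus by blast
      moreover have "app w' p = p" using rs(2) by (simp add: w'_def app_uminus_eq_iff q_def)
      then have "{j. app w' (j, 1) \<noteq> (j, 1)} \<subset> {j. app w (j, 1) \<noteq> (j, 1)}"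
        using i fixed by (auto simp: w'_def p_def app_uminus_fixed)
      then have "card {j. app w' (j, 1) \<noteq> (j, 1)} < card {j. app w (j, 1) \<noteq> (j, 1)}"
        by (rule psubset_card_mono[OF finite_app])
      ultimately obtain ts where "set ts \<subseteq> trefl" "w' = sum_list ts" using less.hyps by blast
      moreover have "w = sum_list rs + w'" by (simp add: w'_def add.assoc[symmetric])
      ultimately show ?thesis using rs(1) by (intro exI[of _ "rs @ ts"]) auto
    qed
    show ?thesis
    proof (cases "fst q = i")
      case False
      show ?thesis
      proof (rule step[of "[rfl p q]"])
        show "set [rfl p q] \<subseteq> trefl"
        proof -
          have "rfl p q \<in> trefl"
            using False q \<open>i < n\<close> by (intro trefl_I) (simp_all add: p_def)
          then show ?thesis by simp
        qed
        show "app (sum_list [rfl p q]) p = q" using q by (simp add: p_def)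
        show "app (sum_list [rfl p q]) (j, 1) = (j, 1)" if "app w (j, 1) = (j, 1)" for j
        proof -
          have "j \<noteq> i" using that i by auto
          moreover have "j \<noteq> fst q"
            using fst_app_eq_iff[of w p "(j, 1)"] that \<open>j \<noteq> i\<close> by (auto simp: q_def p_def)
          ultimately show ?thesis by (simp add: p_def)
        qed
      qed
    next
      case True
      then have q_eq: "q = scl (snd q) p" by (simp add: p_def prod_eq_iff)
      have "\<exists>j<n. j \<noteq> i \<and> app w (j, 1) \<noteq> (j, 1)"
      proof (rule ccontr)
        assume "\<not> ?thesis"
        then have "snd (app w (j, 1)) = (if i = j then snd q else 1)" if "j < n" for j
          using that by (auto simp: q_def p_def)
        then have "col w = (\<Prod>j<n. if i = j then snd q else 1)" unfolding col_def by (intro prod.cong) auto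
        also have "\<dots> = snd q" using \<open>i < n\<close> by simp
        finally have "snd q = 1" using less.prems by (simp add: W_def)
        then show False using q_eq i by (simp add: q_def p_def)
      qed
      then obtain j where j: "j < n" "j \<noteq> i" "app w (j, 1) \<noteq> (j, 1)" by blast
      \<comment> \<open>\<open>w\<close> dilates the axis of \<open>p\<close>, and the product of
        entries 1 forces a second moved axis \<open>j\<close>. Two reflections between these axes
        multiply to the dilation of \<open>p\<close> by \<open>snd q\<close> and the inverse
        dilation of \<open>y\<close>.\<close>
      define y where "y = (j, 1 :: complex)"
      show ?thesis
      proof (rule step[of "[rfl p y, rfl p (scl (snd q) y)]"])
        have "rfl p y \<in> trefl" "rfl p (scl (snd q) y) \<in> trefl"
          using j q(2) \<open>i < n\<close> by (auto intro!: trefl_I simp: p_def y_def)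
        then show "set [rfl p y, rfl p (scl (snd q) y)] \<subseteq> trefl" by simp
        have "app (rfl p y) y = p" using j by (simp add: p_def y_def)
        then show "app (sum_list [rfl p y, rfl p (scl (snd q) y)]) p = q"
          using q q_eq by (simp add: p_def y_def)
        show "app (sum_list [rfl p y, rfl p (scl (snd q) y)]) (k, 1) = (k, 1)" if "app w (k, 1) = (k, 1)" for k
        proof -
          have "k \<noteq> i" "k \<noteq> j" using that i j by auto
          then show ?thesis by (simp add: p_def y_def)
        qed
      qed
    qed
  qed
qed

section \<open>Absolute length and order against codimension\<close>

abbreviation abs_length :: "mperm \<Rightarrow> nat" where
  "abs_length w \<equiv> abs_len n (Gddn d n) (matof w)"

lemma abs_len_witness:
  assumes "w \<in> W"
  shows "\<exists>ts. length ts = abs_length w \<and> set ts \<subseteq> reflections n (Gddn d n) \<and> matof w = mat_list_prod n ts"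
proof -
  obtain ts where ts: "set ts \<subseteq> trefl" "w = sum_list ts" using trefl_generate[OF assms] by blast
  have "matof w = mat_list_prod n (map matof ts)"
    using mat_list_prod_matof[of ts] ts trefl_W by auto
  moreover have "set (map matof ts) \<subseteq> reflections n (Gddn d n)" using ts matof_trefl by auto
  ultimately have "\<exists>k ts. length ts = k \<and> set ts \<subseteq> reflections n (Gddn d n) \<and> matof w = mat_list_prod n ts"
    by blast
  then show ?thesis unfolding abs_len_def by (rule LeastI_ex)
qed

text \<open>Every reflection of the matrix group has codimension at most one, and codimension is
  subadditive.\<close>

lemma len_le_abs_len:
  assumes "w \<in> W" shows "len w \<le> abs_length w"
proof -
  obtain As where As: "length As = abs_length w" "set As \<subseteq> reflections n (Gddn d n)" "matof w = mat_list_prod n As"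
    using abs_len_witness[OF assms] by blast
  have "\<exists>t. t \<in> W \<and> B = matof t" if "B \<in> set As" for B
  proof -
    have "B \<in> Gddn d n" using As(2) that unfolding reflections_def by blast
    then show ?thesis by (rule Gddn_matof) blast
  qed
  then obtain f where f: "\<And>B. B \<in> set As \<Longrightarrow> f B \<in> W \<and> B = matof (f B)" by metis
  define ts where "ts = map f As"
  have "map matof ts = As" unfolding ts_def map_map by (rule map_idI) (use f in auto)
  moreover have ts: "set ts \<subseteq> W" unfolding ts_def using f by auto
  ultimately have "matof w = matof (sum_list ts)" "sum_list ts \<in> W" using mat_list_prod_matof As(3) by auto
  then have "w = sum_list ts" using matof_eq_iff assms by blast
  moreover have "len t \<le> 1" if t: "t \<in> set ts" for t
  proof -
    obtain B where "B \<in> set As" "t = f B" using t by (auto simp: ts_def)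
    then have "matof t \<in> reflections n (Gddn d n)" "t \<in> W" using f[of B] As(2) by auto
    then show ?thesis using len_reflection W_supported by blast
  qed
  ultimately have "len w \<le> length ts" using len_sum_list by blast
  then show ?thesis using As(1) by (simp add: ts_def)
qed

lemma abs_len_good:
  assumes "good w" shows "abs_length w = len w"
proof (rule antisym)
  obtain ts where ts: "set ts \<subseteq> trefl" "length ts = len w" "w = sum_list ts"
    using assms by (auto simp: good_def)
  have "matof w = mat_list_prod n (map matof ts)"
    using mat_list_prod_matof[of ts] ts trefl_W by auto
  moreover have "set (map matof ts) \<subseteq> reflections n (Gddn d n)" using ts matof_trefl by auto
  ultimately show "abs_length w \<le> len w"
    unfolding abs_len_def ts(2)[symmetric] by (intro Least_le exI[of _ "map matof ts"]) auto
qed (rule len_le_abs_len[OF good_W[OF assms]])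

lemma abs_le_matof:
  assumes "u \<in> W" "v \<in> W"
  shows "abs_le n (Gddn d n) (matof u) (matof v) \<longleftrightarrow> abs_length v = abs_length u + abs_length (- u + v)"
proof -
  have uv: "- u + v \<in> W" using assms W_plus W_uminus by blast
  have "matof v = matof u * X \<longleftrightarrow> X = matof (- u + v)" if X: "X \<in> Gddn d n" for X
  proof -
    obtain x where x: "x \<in> W" "X = matof x" using Gddn_matof[OF X] .
    have "matof v = matof u * X \<longleftrightarrow> matof v = matof (u + x)"
      using matof_plus W_supported x by simp
    also have "\<dots> \<longleftrightarrow> v = u + x" using matof_eq_iff assms W_plus x by blast
    also have "\<dots> \<longleftrightarrow> x = - u + v" by (auto simp: add.assoc[symmetric])
    also have "\<dots> \<longleftrightarrow> X = matof (- u + v)" using matof_eq_iff uv x by simp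
    finally show ?thesis .
  qed
  then show ?thesis
    unfolding abs_le_def using assms uv matof_in_Gddn by blast
qed

lemma finite_W: "finite W"
proof (rule inj_on_finite)
  let ?f = "\<lambda>w. restrict (\<lambda>i. app w (i, 1)) {..<n}"
  show "inj_on ?f W"
  proof (rule inj_onI)
    fix u v assume uv: "u \<in> W" "v \<in> W" "?f u = ?f v"
    show "u = v"
    proof (rule mperm_eqI)
      fix i
      show "app u (i, 1) = app v (i, 1)"
      proof (cases "i < n")
        case True
        then show ?thesis using fun_cong[OF uv(3), of i] by simp
      next
        case False
        then show ?thesis using uv(1,2) by (simp add: W_def supported_def)
      qed
    qed
  qed
  show "?f ` W \<subseteq> PiE {..<n} (\<lambda>_. {..<n} \<times> {z. z ^ d = 1})"
  proof (rule image_subsetI)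
    fix w assume w: "w \<in> W"
    have "app w (i, 1) \<in> {..<n} \<times> {z. z ^ d = 1}" if "i < n" for i
      using supported_less[OF W_supported[OF w] that] w by (simp add: W_def mem_Times_iff)
    then show "?f w \<in> PiE {..<n} (\<lambda>_. {..<n} \<times> {z. z ^ d = 1})" by (intro restrict_PiE_iff[THEN iffD2] ballI) simp
  qed
  have "finite {z :: complex. z ^ d = 1}" using d_pos by (intro finite_roots_unity) auto
  then show "finite (PiE {..<n} (\<lambda>_. {..<n} \<times> {z :: complex. z ^ d = 1}))"
    by (intro finite_PiE) auto
qed

end

lemma le_transitive:
  assumes "le u v" "le v c" shows "le u c"
proof -
  have "len (- u + c) \<le> len (- u + v) + len (- v + c)"
    using len_plus_le[of "- u + v" "- v + c"] by (simp add: add.assoc)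
  moreover have "len c \<le> len u + len (- u + c)" using len_plus_le[of u "- u + c"] by (simp add: add.assoc[symmetric])
  ultimately show ?thesis using assms by (simp add: le_def)
qed

text \<open>Conjugating \<open>u\<close> past \<open>v\<close> bounds the complement of
  \<open>- u + v\<close> in \<open>c\<close>. So quotients stay in the interval, where the
  certificate \<open>good\<close> is available for them.\<close>

lemma le_quotient:
  assumes "le u v" "le v c" shows "le (- u + v) c"
proof -
  have "- (- u + v) + c = (- v + u + v) + (- v + c)" by (simp add: minus_add add.assoc)
  then have "len (- (- u + v) + c) \<le> len u + len (- v + c)"
    using len_plus_le[of "- v + u + v" "- v + c"] by (simp only: len_conj)
  moreover have "len c \<le> len (- u + v) + len (- (- u + v) + c)"
    using len_plus_le[of "- u + v" "- (- u + v) + c"] by (simp add: add.assoc[symmetric])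
  ultimately show ?thesis using assms by (simp add: le_def)
qed

section \<open>Coxeter elements\<close>

context gddn
begin

lemma below_W_closed:
  assumes "c \<in> W" "v \<in> below c \<inter> W" "le u v" "u \<in> W"
  shows "u \<in> below c \<inter> W" "- u + v \<in> below c \<inter> W"
  using assms le_transitive[of u v c] le_quotient[of u v c] W_plus W_uminus by (auto simp: below_def)

text \<open>From the matrix order to \<open>le\<close>, the element \<open>u\<close> is not known to
  lie in the interval: its codimension and that of the quotient are at most their absolute lengths,
  and equality holds for \<open>v\<close>, so subadditivity closes the gap. In the other direction
  \<open>u\<close> and the quotient are below \<open>c\<close> and hence
  \<open>good\<close>.\<close>

lemma abs_le_below:
  assumes c: "c \<in> W" "\<And>w. w \<in> below c \<inter> W \<Longrightarrow> good w"
    and u: "u \<in> W" and v: "v \<in> below c \<inter> W"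
  shows "abs_le n (Gddn d n) (matof u) (matof v) \<longleftrightarrow> le u v"
proof -
  have vW: "v \<in> W" and uv: "- u + v \<in> W" using u v W_plus W_uminus by auto
  have "abs_length v = abs_length u + abs_length (- u + v) \<longleftrightarrow> le u v"
  proof
    assume *: "abs_length v = abs_length u + abs_length (- u + v)"
    have "len v \<le> len u + len (- u + v)"
      using len_plus_le[of u "- u + v"] by (simp add: add.assoc[symmetric])
    then show "le u v"
      using * len_le_abs_len[OF u] len_le_abs_len[OF uv] abs_len_good[OF c(2)[OF v]] by (simp add: le_def)
  next
    assume le: "le u v"
    then show "abs_length v = abs_length u + abs_length (- u + v)"
      using abs_len_good c(2) v below_W_closed[OF c(1) v le u] by (simp add: le_def)
  qed
  then show ?thesis using abs_le_matof[OF u vW] by simp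
qed

lemma NC_matof:
  assumes c: "c \<in> W" "\<And>w. w \<in> below c \<inter> W \<Longrightarrow> good w"
  shows "NC n (Gddn d n) (matof c) = matof ` (below c \<inter> W)"
proof -
  have cc: "c \<in> below c \<inter> W" using c(1) by (simp add: below_def)
  have one: "abs_le n (Gddn d n) (1\<^sub>m n) (matof w)" if "w \<in> W" for w
    using abs_le_matof[OF W_zero that] abs_len_good[OF good_zero] by (simp add: matof_zero)
  have le_c: "abs_le n (Gddn d n) (matof w) (matof c) \<longleftrightarrow> w \<in> below c" if "w \<in> W" for w
    using abs_le_below[OF c that cc] by (simp add: below_def)
  show ?thesis
  proof (intro Set.set_eqI iffI)
    fix x assume x: "x \<in> NC n (Gddn d n) (matof c)"
    then have "x \<in> Gddn d n" by (simp add: NC_def)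
    then obtain w where w: "w \<in> W" "x = matof w" by (rule Gddn_matof)
    then show "x \<in> matof ` (below c \<inter> W)" using x le_c[OF w(1)] by (simp add: NC_def)
  next
    fix x assume "x \<in> matof ` (below c \<inter> W)"
    then obtain w where "w \<in> below c" "w \<in> W" "x = matof w" by blast
    then show "x \<in> NC n (Gddn d n) (matof c)"
      using one le_c matof_in_Gddn by (simp add: NC_def)
  qed
qed

theorem NC_consequences:
  assumes c: "c \<in> W" and nice: "nice (len c) (below c \<inter> W)"
  defines "P \<equiv> NC n (Gddn d n) (matof c)" and "leq \<equiv> abs_le n (Gddn d n)"
    and "rk \<equiv> abs_len n (Gddn d n)" and "N \<equiv> abs_len n (Gddn d n) (matof c)"
  shows "symmetric_boolean_decomposition P leq rk N" "symmetric_chain_decomposition P leq rk N"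
    "strongly_Sperner P leq rk N" "symmetric_seq (rank_number P rk) N"
    "unimodal_seq (rank_number P rk) N" "gamma_nonneg (rank_number P rk) N"
proof -
  have good: "\<And>w. w \<in> below c \<inter> W \<Longrightarrow> good w" using nice by (auto simp: nice_def)
  have P: "P = matof ` (below c \<inter> W)" unfolding P_def by (rule NC_matof[OF c good])
  have cc: "c \<in> below c \<inter> W" using c by (simp add: below_def)
  have rk: "rk (matof w) = len w" if "w \<in> below c \<inter> W" for w
    unfolding rk_def by (rule abs_len_good[OF good[OF that]])
  have leq: "leq (matof u) (matof v) \<longleftrightarrow> le u v" if "u \<in> below c \<inter> W" "v \<in> below c \<inter> W" for u v
    unfolding leq_def using that by (intro abs_le_below[OF c good]) auto
  have N: "N = len c" unfolding N_def by (rule abs_len_good[OF good[OF cc]])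
  interpret graded_set P leq rk N
  proof
    show "finite P" unfolding P using finite_W by simp
    show "rk x \<le> rk y" if "x \<in> P" "y \<in> P" "leq x y" for x y
      using that unfolding P by (auto simp: rk leq) (simp add: le_def)
    show "x = y" if "x \<in> P" "y \<in> P" "leq x y" "rk x = rk y" for x y
      using that unfolding P by (auto simp: rk leq dest: le_eq_len)
  qed
  have sbd: "sbd leq rk N P"
    unfolding P N
  proof (rule partitioned_image)
    show "sbd le len (len c) (below c \<inter> W)" using nice by (simp add: nice_def)
    show "inj_on matof (below c \<inter> W)" using matof_eq_iff by (auto simp: inj_on_def)
    fix D assume D: "D \<subseteq> below c \<inter> W" "sym_cube le len (len c) D"
    then obtain k f where f: "D = f ` Pow {..<k}"
      "\<And>A B. A \<subseteq> {..<k} \<Longrightarrow> B \<subseteq> {..<k} \<Longrightarrow> le (f A) (f B) \<longleftrightarrow> A \<subseteq> B"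
      "\<And>A. A \<subseteq> {..<k} \<Longrightarrow> len (f A) = len (f {}) + card A" "2 * len (f {}) + k = len c"
      unfolding sym_cube_def by metis
    have fD: "f A \<in> below c \<inter> W" if "A \<subseteq> {..<k}" for A using D(1) f(1) that by blast
    show "sym_cube leq rk (len c) (matof ` D)"
      unfolding sym_cube_def
    proof (intro exI conjI allI impI)
      show "matof ` D = (\<lambda>A. matof (f A)) ` Pow {..<k}" unfolding f(1) by (simp add: image_image)
      show "leq (matof (f A)) (matof (f B)) \<longleftrightarrow> A \<subseteq> B" if "A \<subseteq> {..<k}" "B \<subseteq> {..<k}" for A B
        using leq[OF fD[OF that(1)] fD[OF that(2)]] f(2)[OF that] by simp
      show "rk (matof (f A)) = rk (matof (f {})) + card A" if "A \<subseteq> {..<k}" for A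
        using rk[OF fD[OF that]] rk[OF fD[of "{}"]] f(3)[OF that] by simp
      show "2 * rk (matof (f {})) + k = len c" using rk[OF fD[of "{}"]] f(4) by simp
    qed
  qed
  have rk_le: "rk x \<le> N" if "x \<in> P" for x
    using that unfolding P N by (auto simp: rk) (simp add: below_def le_def)
  note chains = sbd_imp_chains[OF sbd]
  show "symmetric_boolean_decomposition P leq rk N" by (rule boolean_decomposition[OF sbd])
  show "symmetric_chain_decomposition P leq rk N" by (rule chain_decomposition[OF chains])
  show "strongly_Sperner P leq rk N" by (rule strongly_Sperner[OF chains])
  show "symmetric_seq (rank_number P rk) N" "unimodal_seq (rank_number P rk) N"
    by (rule symmetric_unimodal[OF chains])+
  show "gamma_nonneg (rank_number P rk) N" by (rule gamma_nonneg[OF sbd rk_le])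
qed

end

lemma app_cyc_nth:
  "pts ps \<Longrightarrow> \<eta> \<noteq> 0 \<Longrightarrow> k < length ps \<Longrightarrow>
    app (cyc \<eta> ps) (ps ! k) = (if Suc k < length ps then ps ! Suc k else scl \<eta> (ps ! 0))"
proof (induction \<eta> ps arbitrary: k rule: cyc.induct)
  case (3 \<eta> p q ps)
  have nz: "snd p \<noteq> 0" "snd q \<noteq> 0" "fst q \<noteq> fst p" using 3(2) by auto
  show ?case
  proof (cases k)
    case 0
    have "app (cyc \<eta> (q # ps)) p = p" using 3(2) by (intro app_cyc_other) auto
    then show ?thesis using nz 0 by simp
  next
    case (Suc j)
    have IH: "app (cyc \<eta> (q # ps)) ((q # ps) ! j) =
        (if Suc j < length (q # ps) then (q # ps) ! Suc j else scl \<eta> q)"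
      using 3(1)[of j] 3(2-4) Suc by auto
    show ?thesis
    proof (cases "Suc j < length (q # ps)")
      case True
      then have "ps ! j \<in> set ps" by simp
      then have "fst (ps ! j) \<in> fst ` set ps" by simp
      moreover have "fst p \<notin> fst ` set ps" "fst q \<notin> fst ` set ps" using 3(2) by auto
      ultimately have "fst (ps ! j) \<noteq> fst p" "fst (ps ! j) \<noteq> fst q" by metis+
      then show ?thesis using IH True Suc by simp
    next
      case False
      then show ?thesis using IH Suc nz by simp
    qed
  qed
qed auto

text \<open>The shape of the element is read off from a regular eigenvector \<open>v\<close>.
  Regularity separates the coordinates of \<open>v\<close> up to d-th roots of unity, and the
  eigenvalue equation along an orbit of axes then determines the length and colour of the
  cycle.\<close>

lemma (in gddn) coxeter_element_cyc:
  assumes "d \<ge> 2" "n \<ge> 2" and cox: "coxeter_element n (Gddn d n) (cox_num_Gddn d n) g"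
  obtains n0 \<omega> qs where "n0 < n" "\<omega> ^ d = 1" "\<omega> \<noteq> 1" "rpts qs" "qs \<noteq> []" "n0 \<notin> fst ` set qs"
    "cyc \<omega> qs + rfl (n0, 1) (n0, 1 / \<omega>) \<in> W" "g = matof (cyc \<omega> qs + rfl (n0, 1) (n0, 1 / \<omega>))"
proof -
  define h where "h = (n - 1) * d"
  define m where "m = n - 1"
  define \<zeta> where "\<zeta> = exp (2 * pi * \<i> / of_nat h)"
  have m: "0 < m" "m < n" "n = Suc m" using assms(2) by (simp_all add: m_def)
  have h: "0 < h" "h = m * d" using assms(1,2) by (simp_all add: h_def m_def)
  have \<zeta>_pow: "\<zeta> ^ k = cis (2 * pi * real k / real h)" for k
  proof -
    have "\<zeta> = cis (2 * pi / real h)" by (simp add: \<zeta>_def cis_conv_exp mult_ac)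
    then show ?thesis by (simp add: DeMoivre mult_ac)
  qed
  have \<zeta>_h: "\<zeta> ^ h = 1" using h(1) by (simp add: \<zeta>_pow)
  have \<zeta>_ne: "\<zeta> ^ k \<noteq> 1" if "0 < k" "k < h" for k
  proof
    assume "\<zeta> ^ k = 1"
    then have "cis (2 * pi * real k / real h) = cis (2 * pi * real 0 / real h)" by (simp add: \<zeta>_pow)
    moreover have "inj_on (\<lambda>k. cis (2 * pi * real k / real h)) {..<h}"
      using bij_betw_roots_unity[OF h(1)] by (simp add: bij_betw_def)
    ultimately have "k = 0" using that by (auto dest: inj_onD[of _ _ k 0])
    then show False using that by simp
  qed
  obtain w where w: "w \<in> W" "g = matof w"
    using cox Gddn_matof unfolding coxeter_element_def by blast
  note s = W_supported[OF w(1)]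
  obtain v where v: "v \<in> carrier_vec n" "g *\<^sub>v v = \<zeta> \<cdot>\<^sub>v v"
      "\<And>t. t \<in> reflections n (Gddn d n) \<Longrightarrow> t *\<^sub>v v \<noteq> v"
    using cox unfolding coxeter_element_def cox_num_Gddn_def \<zeta>_def h_def by blast
  have mv: "(matof u *\<^sub>v v) $ i = (\<Sum>j<n. if fst (app u (j, 1)) = i then snd (app u (j, 1)) * v $ j else 0)"
    if "i < n" for u i
    using that v(1) by (simp add: scalar_prod_def matof_index atLeast0LessThan if_distrib[of "\<lambda>x. x * _"] cong: if_cong)
  have mv1: "(matof u *\<^sub>v v) $ fst (app u (j, 1)) = snd (app u (j, 1)) * v $ j"
    if "supported u" "j < n" for u j
  proof -
    have "fst (app u (l, 1)) = fst (app u (j, 1)) \<longleftrightarrow> l = j" for l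
      using fst_app_eq_iff[of u "(l, 1)" "(j, 1)"] by simp
    then show ?thesis using mv[OF supported_less[OF that]] that(2) by simp
  qed
  have eig: "snd (app w (j, 1)) * v $ j = \<zeta> * v $ fst (app w (j, 1))" if "j < n" for j
    using mv1[OF s that] supported_less[OF s that] v(1) unfolding v(2)[unfolded w(2)] by simp
  \<comment> \<open>Otherwise the reflection \<open>t\<close>, which exchanges \<open>(i, 1)\<close>
    and \<open>(j, \<eta>)\<close>, would fix \<open>v\<close>. In particular at most one coordinate
    of \<open>v\<close> vanishes.\<close>
  have regular: "v $ j \<noteq> \<eta> * v $ i" if ij: "i < n" "j < n" "i \<noteq> j" and \<eta>: "\<eta> ^ d = 1" for i j \<eta>
  proof
    assume eq: "v $ j = \<eta> * v $ i"
    define t where "t = rfl (i, 1) (j, \<eta>)"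
    have nz: "\<eta> \<noteq> 0" using \<eta> root_nonzero by blast
    have "t \<in> trefl" unfolding t_def using ij \<eta> by (intro trefl_I) auto
    then have ts: "supported t" "matof t \<in> reflections n (Gddn d n)"
      using trefl_W W_supported matof_trefl by auto
    have "matof t *\<^sub>v v = v"
    proof (rule eq_vecI)
      fix k assume "k < dim_vec v"
      then have k: "k < n" using v(1) by auto
      consider "k = j" | "k = i" | "k \<noteq> i" "k \<noteq> j" by blast
      then show "(matof t *\<^sub>v v) $ k = v $ k"
      proof cases
        case 1
        then show ?thesis using mv1[OF ts(1) ij(1)] nz eq by (simp add: t_def app_rfl)
      next
        case 2
        then show ?thesis using mv1[OF ts(1) ij(2)] nz eq ij(3) by (simp add: t_def app_rfl)
      next
        case 3
        then show ?thesis using mv1[OF ts(1) k] by (simp add: t_def)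
      qed
    qed (use v(1) in auto)
    then show False using v(3)[OF ts(2)] by simp
  qed
  obtain i0 where i0: "i0 < n" "v $ i0 \<noteq> 0"
  proof (cases "v $ 0 = 0")
    case True
    then have "v $ 1 \<noteq> 0" using regular[of 0 1 1] assms(2) by simp
    then show ?thesis using that[of 1] assms(2) by simp
  next
    case False
    then show ?thesis using that[of 0] assms(2) by simp
  qed
  define q where "q k = ((app w) ^^ k) (i0, 1)" for k
  have q0: "q 0 = (i0, 1)" and qSuc: "q (Suc k) = app w (q k)" for k
    by (simp_all add: q_def)
  \<comment> \<open>The orbit of \<open>(i0, 1)\<close> under \<open>w\<close>: iterating the
    eigenvalue equation compares the coordinates of \<open>v\<close> along it with
    \<open>v $ i0\<close>.\<close>
  have q: "fst (q k) < n \<and> snd (q k) ^ d = 1 \<and> \<zeta> ^ k * v $ fst (q k) = snd (q k) * v $ i0" for k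
  proof (induction k)
    case 0
    then show ?case using i0 by (simp add: q0)
  next
    case (Suc k)
    define j where "j = fst (q k)"
    have app: "app w (q k) = scl (snd (q k)) (app w (j, 1))" unfolding j_def by (rule app_eq_scl)
    have j: "j < n" using Suc by (simp add: j_def)
    have root: "snd (app w (j, 1)) ^ d = 1" using w(1) by (simp add: W_def)
    have "\<zeta> ^ Suc k * v $ fst (app w (j, 1)) = \<zeta> ^ k * (\<zeta> * v $ fst (app w (j, 1)))" by simp
    also have "\<dots> = snd (app w (j, 1)) * (\<zeta> ^ k * v $ j)" unfolding eig[OF j, symmetric] by (simp only: mult_ac)
    also have "\<zeta> ^ k * v $ j = snd (q k) * v $ i0" using Suc by (simp only: j_def)
    finally have "\<zeta> ^ Suc k * v $ fst (app w (j, 1)) = (snd (q k) * snd (app w (j, 1))) * v $ i0"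
      by (simp only: mult_ac)
    then show ?case
      unfolding qSuc app fst_scl snd_scl using Suc root supported_less[OF s j]
      by (simp only: power_mult_distrib mult_1_left simp_thms)
  qed
  define \<omega> where "\<omega> = \<zeta> ^ m"
  have \<omega>: "\<omega> ^ d = 1" "\<omega> \<noteq> 1"
  proof -
    show "\<omega> ^ d = 1" using \<zeta>_h by (simp add: \<omega>_def power_mult[symmetric] h(2))
    have "m < h" unfolding h(2) using m(1) assms(1) by simp
    then show "\<omega> \<noteq> 1" using \<zeta>_ne[of m] m(1) by (simp add: \<omega>_def)
  qed
  have \<omega>nz: "\<omega> \<noteq> 0" using \<omega>(1) root_nonzero by blast
  \<comment> \<open>As \<open>\<omega>\<close> is a d-th root of unity, so is the ratio of the
    coordinates of \<open>v\<close> at the axis of \<open>q m\<close> and at \<open>i0\<close>.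
    Regularity makes these axes equal, and the comparison gives the scalar.\<close>
  have qm: "q m = (i0, \<omega>)"
  proof -
    have *: "\<omega> * v $ fst (q m) = snd (q m) * v $ i0" using q[of m] by (simp add: \<omega>_def)
    have "fst (q m) = i0"
    proof (rule ccontr)
      assume ne: "fst (q m) \<noteq> i0"
      have "v $ fst (q m) = (snd (q m) / \<omega>) * v $ i0" using * \<omega>nz by (simp add: field_simps)
      moreover have "(snd (q m) / \<omega>) ^ d = 1" using q[of m] \<omega>(1) by (simp add: power_divide)
      ultimately show False using regular[of i0 "fst (q m)" "snd (q m) / \<omega>"] ne i0 q[of m] by simp
    qed
    then show ?thesis using * i0(2) by (simp add: prod_eq_iff)
  qed
  \<comment> \<open>An earlier return to the axis \<open>i0\<close> would make
    \<open>\<zeta> ^ k\<close> a d-th root of unity although \<open>k * d < h\<close>.\<close>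
  have ret: "fst (q k) \<noteq> i0" if k: "0 < k" "k < m" for k
  proof
    assume "fst (q k) = i0"
    then have "\<zeta> ^ k = snd (q k)" using q[of k] i0(2) by simp
    then have "\<zeta> ^ (k * d) = 1" using q[of k] by (simp add: power_mult)
    moreover have "0 < k * d" "k * d < h" unfolding h(2) using k assms(1) by auto
    ultimately show False using \<zeta>_ne by blast
  qed
  have inj: "fst (q a) \<noteq> fst (q b)" if "a < b" "b < m" for a b
    using that
  proof (induction a arbitrary: b)
    case 0
    then show ?case using ret[of b] by (auto simp: q0)
  next
    case (Suc a)
    then obtain b' where b: "b = Suc b'" by (cases b) auto
    then show ?case using Suc fst_app_eq_iff[of w "q a" "q b'"] by (simp add: qSuc)
  qed
  define qs where "qs = map q [0..<m]"
  have len_qs: "length qs = m" and nth_qs: "k < m \<Longrightarrow> qs ! k = q k" for k by (simp_all add: qs_def)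
  have inj_on: "inj_on (\<lambda>k. fst (q k)) {..<m}"
    unfolding inj_on_def using inj by (metis lessThan_iff linorder_neqE_nat)
  have "distinct (map fst qs)"
    using inj_on by (auto simp: qs_def distinct_map comp_def atLeast0LessThan)
  then have rpts: "rpts qs" using q by (auto simp: rpts_def qs_def)
  note pts = rpts_imp_pts[OF rpts]
  have fst_qs: "fst ` set qs = (\<lambda>k. fst (q k)) ` {..<m}"
    by (simp add: qs_def image_image atLeast0LessThan)
  have "card (fst ` set qs) = m" unfolding fst_qs using card_image[OF inj_on] by simp
  moreover have sub: "fst ` set qs \<subseteq> {..<n}" using q by (auto simp: fst_qs)
  ultimately have "card ({..<n} - fst ` set qs) = 1" using m by (subst card_Diff_subset) auto
  then obtain n0 where "{..<n} - fst ` set qs = {n0}" by (auto simp: card_1_singleton_iff)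
  then have n0: "n0 < n" "n0 \<notin> fst ` set qs" and all: "\<And>i. i < n \<Longrightarrow> i = n0 \<or> i \<in> fst ` set qs" by auto
  have w_q: "app w (qs ! k) = app (cyc \<omega> qs) (qs ! k)" if "k < m" for k
  proof (cases "Suc k < m")
    case True
    then show ?thesis using app_cyc_nth[OF pts \<omega>nz, of k] by (simp add: len_qs nth_qs qSuc)
  next
    case False
    then have "Suc k = m" using that by simp
    then have "app w (qs ! k) = q m" using nth_qs[OF that] qSuc[of k] by simp
    then show ?thesis
      using app_cyc_nth[OF pts \<omega>nz, of k] that \<open>Suc k = m\<close> m(1) by (simp add: len_qs nth_qs qm q0 scl_def)
  qed
  \<comment> \<open>The axes of the cycle are permuted among themselves by \<open>w\<close>, so the
    one axis left over is mapped to itself.\<close>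
  have "fst (app w (n0, 1)) = n0"
  proof (rule ccontr)
    assume "fst (app w (n0, 1)) \<noteq> n0"
    then have "fst (app w (n0, 1)) \<in> fst ` set qs" using all supported_less[OF s n0(1)] by blast
    then obtain k where k: "k < m" "fst (app w (n0, 1)) = fst (q k)" by (auto simp: fst_qs)
    obtain l where l: "l < m" "fst (q k) = fst (app w (q l))"
    proof (cases k)
      case 0
      have "app w (q (m - 1)) = (i0, \<omega>)" using m(1) qSuc[of "m - 1"] by (simp add: qm)
      then show ?thesis using that[of "m - 1"] m(1) 0 by (simp add: q0)
    next
      case (Suc j)
      then show ?thesis using that[of j] k(1) by (simp add: qSuc)
    qed
    then have "n0 = fst (q l)" using k(2) fst_app_eq_iff[of w "(n0, 1)" "q l"] by simp
    then show False using n0(2) l(1) by (auto simp: fst_qs)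
  qed
  then obtain c0 where c0: "app w (n0, 1) = (n0, c0)" by (metis prod.collapse)
  have c0nz: "c0 \<noteq> 0" using snd_app_nonzero[of w "(n0, 1)"] c0 by simp
  define u where "u = rfl (n0, 1) (n0, c0)"
  have u_other: "app u r = r" if "fst r \<noteq> n0" for r using that by (simp add: u_def)
  have w_eq: "w = cyc \<omega> qs + u"
  proof (rule mperm_eqI)
    fix i
    show "app w (i, 1) = app (cyc \<omega> qs + u) (i, 1)"
    proof (cases "i \<in> fst ` set qs")
      case True
      then obtain k where k: "k < m" "i = fst (qs ! k)" by (auto simp: in_set_conv_nth len_qs)
      then have nz: "snd (qs ! k) \<noteq> 0" using q[of k] root_nonzero by (auto simp: nth_qs)
      have i: "(i, 1) = scl (1 / snd (qs ! k)) (qs ! k)" using k nz by (simp add: prod_eq_iff)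
      have "i \<noteq> n0" using True n0(2) by auto
      then have "app (cyc \<omega> qs + u) (i, 1) = app (cyc \<omega> qs) (i, 1)" using u_other by simp
      then show ?thesis unfolding i using w_q[OF k(1)] by simp
    next
      case False
      have cyc_i: "app (cyc \<omega> qs) (i, z) = (i, z)" for z using False by (intro app_cyc_other) simp
      show ?thesis
      proof (cases "i = n0")
        case True
        then show ?thesis using c0 c0nz cyc_i by (simp add: u_def)
      next
        case F: False
        then have "\<not> i < n" using all False by blast
        then have "app w (i, 1) = (i, 1)" using s by (simp add: supported_def)
        then show ?thesis using u_other[of "(i, 1)"] F cyc_i by simp
      qed
    qed
  qed
  \<comment> \<open>The product of the entries of \<open>w\<close> is the colour of the cycle times
    \<open>c0\<close>, and it equals 1 in \<open>W\<close>.\<close>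
  have "\<omega> * c0 = 1"
  proof -
    obtain p ps where ps: "qs = p # ps" using len_qs m(1) by (cases qs) auto
    have p: "fst p < n" "snd p \<noteq> 0" using rpts root_nonzero by (auto simp: ps rpts_Cons)
    have "cyc 1 qs \<in> W" using nice_W[OF nice_cyc[OF rpts]] by (auto simp: below_def)
    then have cy: "supported (cyc 1 qs)" "col (cyc 1 qs) = 1" by (auto simp: W_def)
    have us: "supported u" using n0(1) by (auto simp: supported_def u_def)
    have "cyc \<omega> qs = rfl p (scl \<omega> p) + cyc 1 qs"
      using cyc_scale[of p ps 1 \<omega>] pts \<omega>nz by (simp add: ps)
    then have "col w = col (rfl p (scl \<omega> p)) * col (cyc 1 qs) * col u"
      unfolding w_eq by (simp add: col_plus cy us)
    also have "\<dots> = \<omega> * c0"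
      using col_dilation[OF p(2) \<omega>nz p(1)] col_dilation[of "(n0, 1)" c0] n0(1) c0nz cy(2)
      by (simp add: u_def scl_def)
    finally show ?thesis using w(1) by (simp add: W_def)
  qed
  then have c0_eq: "c0 = 1 / \<omega>" using \<omega>nz by (simp add: field_simps)
  have "qs \<noteq> []" using len_qs m(1) by auto
  then show ?thesis
    using that[OF n0(1) \<omega> rpts _ n0(2)] w w_eq unfolding u_def c0_eq by simp
qed

theorem theorem1p3:
  fixes d n :: nat and g :: "complex mat"
  assumes "d \<ge> 2" and "n \<ge> 2"
    and "coxeter_element n (Gddn d n) (cox_num_Gddn d n) g"
  shows "let P = NC n (Gddn d n) g; leq = abs_le n (Gddn d n);
             rk = abs_len n (Gddn d n); N = abs_len n (Gddn d n) g
         in symmetric_boolean_decomposition P leq rk N \<and>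
            symmetric_chain_decomposition P leq rk N \<and>
            strongly_Sperner P leq rk N \<and>
            symmetric_seq (rank_number P rk) N \<and>
            unimodal_seq (rank_number P rk) N \<and>
            gamma_nonneg (rank_number P rk) N"
proof -
  interpret gddn d n by unfold_locales (use assms(1) in simp)
  obtain n0 \<omega> qs where *: "n0 < n" "\<omega> ^ d = 1" "\<omega> \<noteq> 1" "rpts qs" "qs \<noteq> []" "n0 \<notin> fst ` set qs"
    "cyc \<omega> qs + rfl (n0, 1) (n0, 1 / \<omega>) \<in> W" "g = matof (cyc \<omega> qs + rfl (n0, 1) (n0, 1 / \<omega>))"
    by (rule coxeter_element_cyc[OF assms])
  interpret gddn_coxeter d n n0 \<omega> by unfold_locales (use * in auto)
  define c where "c = cyc \<omega> qs + E"
  have c: "c \<in> W" "g = matof c"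
    using *(7,8) by (simp_all add: c_def E_def e_def scl_def)
  have "len c = Suc (length qs)"
    unfolding c_def
    using len_cyc_plus[OF rpts_imp_pts[OF *(4)] \<omega>_nz fixes_all_E[OF *(6)]] *(3) len_E by simp
  moreover have "below c \<inter> W = D qs" by (simp add: c_def D_def)
  ultimately have "nice (len c) (below c \<inter> W)" using nice_D[OF *(4,6,5)] by simp
  from NC_consequences[OF c(1) this] show ?thesis unfolding Let_def c(2) by blast
qed

end
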